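(* Let $X=O\Lambda Z\sim P\in\mathcal{E}(O,\Lambda)$ and assume that the density $f_R(r)$ of $R:=\|Z\|$ is bounded, $\phi_1(S_P)>1/2$ and $\mathrm{E}(Z_1^2)<\infty$. Let $X_1,X_2,\ldots$ be i.i.d. from $P$, and for each $n$ let $v_n$ be any minimizer of $f_{P_n}$ over $\mathcal{B}(H_n+1/2)$. Let $\psi>0$ be such that $\pm\psi o_1$ are the minimizers of $f_P$ over $\mathbb{R}^p$. Then there exists a sequence of (sample-dependent) signs $s_n\in\{-1,1\}$ such that $$\sqrt{n}(s_nv_n-\psi o_1)\rightsquigarrow\mathcal{N}_p(0,\Sigma)$$ as $n\to\infty$ (convergence in distribution), where $\Sigma=O\{q_1e_1e_1'+q_2(I_p-e_1e_1')\}O'$ and $$q_1=2(c_1-\sigma_1+\psi^2)(a_1-2a_2+2a_4)^{-2},\qquad q_2=2(d_1-\sigma_2)(a_1-2b_2+2b_4)^{-2},$$ with the constants $a_i,b_i,c_1,d_1,\sigma_1,\sigma_2$ defined in the context.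
   Context: Let $p\ge 2$ be an integer. $\|\cdot\|$ is the Euclidean norm and $'$ denotes transpose. $\mathcal{O}^p$ is the set of $p\times p$ orthogonal matrices; $o_1,\ldots,o_p$ denote the columns of $O$. $\mathcal{D}_1^p=\{\sigma\,\mathrm{diag}(\lambda,1,\ldots,1)\mid \sigma>0,\ \lambda>1\}$ (diagonal $p\times p$ matrices). For fixed $O\in\mathcal{O}^p$ and $\Lambda\in\mathcal{D}_1^p$, a probability distribution $P$ on $\mathbb{R}^p$ belongs to $\mathcal{E}(O,\Lambda)$ if $X\sim P$ admits the representation $X=O\Lambda Z$ for some random $p$-vector $Z$ such that: (1) $Z$ is spherical, i.e. $VZ$ has the same distribution as $Z$ for every $V\in\mathcal{O}^p$; (2) $R:=\|Z\|$ admits a density $f_R:(0,\infty)\to(0,\infty)$ with respect to Lebesgue measure; (3) $r\mapsto f_R(r)/r^{p-1}$ is strictly decreasing on $(0,\infty)$; (4) $\mathrm{E}(R)<\infty$. $S_P=\mathrm{E}(XX'/\|X\|^2)$ and $\phi_1(S_P)$ is its largest eigenvalue. $f_P(v)=\mathrm{E}(\|X-v\|\,\|X+v\|-\|X\|^2)$; when $\phi_1(S_P)>1/2$ there is a unique $\psi>0$ such that the minimizers of $f_P$ over $\mathbb{R}^p$ are precisely $\pm\psi o_1$. The sample objective is $f_{P_n}(v)=\frac1n\sum_{i=1}^n(\|X_i-v\|\,\|X_i+v\|-\|X_i\|^2)$, where $P_n$ is the empirical distribution of $X_1,\ldots,X_n$. $e_1$ is the first standard basis vector and $Z_1$ the first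 coordinate of $Z$. $\mathcal{B}(\rho)=\{x\in\mathbb{R}^p\mid\|x\|\le \rho\}$. The data-dependent radius $H_n$ is defined as follows. Let $G_n$ be the empirical distribution of $\|X_1\|,\ldots,\|X_n\|$ and $R_{n0}:=Q_{0.75}(G_n)$ its $0.75$-quantile ($Q_q(G)=\inf\{t: G((-\infty,t])\ge q\}$). Let $y_n(h):=[2P_n\{X\in\mathcal{B}(R_{n0})\}-1]h^2-2hR_{n0}-R_{n0}^2-f_{P_n}(0)$, where $P_n\{X\in\mathcal B(R_{n0})\}$ is the proportion of sample points in $\mathcal B(R_{n0})$, let $H_{n0}$ be the largest root of the polynomial $y_n$, and put $H_n:=H_{n0}+1$. Constants: with $v:=\psi o_1$, let $M_1=\mathrm{E}\left[\frac{\|v+X\|}{\|v-X\|}+\frac{\|v-X\|}{\|v+X\|}\right]I_p$, $M_2=\mathrm{E}\left[\frac{\|v+X\|}{\|v-X\|^3}(v-X)(v-X)'\right]$, $M_4=\mathrm{E}\left[\frac{1}{\|v+X\|\,\|v-X\|}(v+X)(v-X)'\right]$, and $a_i=o_1'M_io_1$, $b_i=o_2'M_io_2$ for $i=1,2,4$. Further, $c_1=\mathrm{E}\left[\frac{\|v+X\|^2}{\|v-X\|^2}\{o_1'(v-X)\}^2\right]$, $d_1=\mathrm{E}\left[\frac{\|v+X\|^2}{\|v-X\|^2}\{o_2'(v-X)\}^2\right]$, and $\sigma_1,\sigma_2$ are respectively the leading eigenvalue and the common value of the remaining $p-1$ eigenvalues of $\mathrm{Cov}(X)$. *)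

theory Defs
  imports "HOL-Probability.Probability"
begin

subsection \<open>Matrices\<close>

definition outer :: "real^'p \<Rightarrow> real^'p \<Rightarrow> real^'p^'p" where
  "outer u v = (columnvector u :: real^1^'p) ** (rowvector v :: real^'p^1)"

definition is_eigenvalue :: "real^'p^'p \<Rightarrow> real \<Rightarrow> bool" where
  "is_eigenvalue A l \<longleftrightarrow> (\<exists>x. x \<noteq> 0 \<and> A *v x = l *\<^sub>R x)"

definition phi1 :: "real^'p^'p \<Rightarrow> real" where
  "phi1 A = Max {l. is_eigenvalue A l}"

text \<open>The common value of the eigenvalues other than the leading one, all counted with
  multiplicity (used only for matrices whose characteristic polynomial has this shape).\<close>

definition phi_rest :: "real^'p^'p \<Rightarrow> real" where
  "phi_rest A = (THE l. \<forall>t. det (mat t - A) = (t - phi1 A) * (t - l) ^ (CARD('p) - 1))"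

text \<open>The index type \<^typ>\<open>'p\<close> carries no order, so the leading coordinate \<open>k1\<close>
  is an explicit parameter throughout.\<close>

definition D1 :: "'p \<Rightarrow> (real^'p^'p) set" where
  "D1 k1 = {\<sigma> *\<^sub>R (\<chi> i j. if i = j then (if i = k1 then l else 1) else 0) | \<sigma> l. \<sigma> > 0 \<and> l > 1}"

subsection \<open>The distribution class\<close>

definition spherical :: "'a measure \<Rightarrow> ('a \<Rightarrow> real^'p) \<Rightarrow> bool" where
  "spherical M Z \<longleftrightarrow> Z \<in> borel_measurable M \<and>
     (\<forall>V. orthogonal_matrix V \<longrightarrow> distr M borel (\<lambda>\<omega>. V *v Z \<omega>) = distr M borel Z)"

text \<open>\<open>P\<close> belongs to the class with parameters \<open>U\<close> and \<open>\<Lambda>\<close> iff it admits such a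
  representation with some \<open>Z\<close> on some probability space \<open>M\<close> and some \<open>f\<close>; only the
  values of \<open>f\<close> on the positive half-line matter.\<close>

definition elliptical_rep ::
  "'p \<Rightarrow> real^'p^'p \<Rightarrow> real^'p^'p \<Rightarrow> (real^'p) measure \<Rightarrow>
   'a measure \<Rightarrow> ('a \<Rightarrow> real^'p) \<Rightarrow> (real \<Rightarrow> real) \<Rightarrow> bool" where
  "elliptical_rep k1 U \<Lambda> P M Z f \<longleftrightarrow>
     orthogonal_matrix U \<and> \<Lambda> \<in> D1 k1 \<and> prob_space M \<and>
     spherical M Z \<and>
     distributed M lborel (\<lambda>\<omega>. norm (Z \<omega>)) (\<lambda>r. ennreal (f r) * indicator {0<..} r) \<and>
     (\<forall>r>0. f r > 0) \<and>
     strict_antimono_on {0<..} (\<lambda>r. f r / r ^ (CARD('p) - 1)) \<and>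
     integrable M (\<lambda>\<omega>. norm (Z \<omega>)) \<and>
     P = distr M borel (\<lambda>\<omega>. (U ** \<Lambda>) *v Z \<omega>)"

definition sign_cov :: "(real^'p) measure \<Rightarrow> real^'p^'p" where
  "sign_cov P = (\<integral>x. (1 / (norm x)\<^sup>2) *\<^sub>R outer x x \<partial>P)"

definition cov :: "(real^'p) measure \<Rightarrow> real^'p^'p" where
  "cov P = (\<integral>x. outer (x - (\<integral>y. y \<partial>P)) (x - (\<integral>y. y \<partial>P)) \<partial>P)"

subsection \<open>Population and sample objectives, and the data-dependent radius\<close>

definition loss :: "real^'p \<Rightarrow> real^'p \<Rightarrow> real" where
  "loss v x = norm (x - v) * norm (x + v) - (norm x)\<^sup>2"

definition obj :: "(real^'p) measure \<Rightarrow> real^'p \<Rightarrow> real" where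
  "obj P v = (\<integral>x. loss v x \<partial>P)"

text \<open>A sample of size \<open>n\<close> is given by the values \<open>x i\<close> for \<open>i < n\<close>.\<close>

definition emp_obj :: "nat \<Rightarrow> (nat \<Rightarrow> real^'p) \<Rightarrow> real^'p \<Rightarrow> real" where
  "emp_obj n x v = (\<Sum>i<n. loss v (x i)) / real n"

definition emp_prob :: "nat \<Rightarrow> (nat \<Rightarrow> 'a) \<Rightarrow> 'a set \<Rightarrow> real" where
  "emp_prob n x A = real (card {i. i < n \<and> x i \<in> A}) / real n"

definition quantile :: "real \<Rightarrow> (real set \<Rightarrow> real) \<Rightarrow> real" where
  "quantile q G = Inf {t. G {..t} \<ge> q}"

definition R0 :: "nat \<Rightarrow> (nat \<Rightarrow> real^'p) \<Rightarrow> real" where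
  "R0 n x = quantile 0.75 (emp_prob n (\<lambda>i. norm (x i)))"

definition y_poly :: "nat \<Rightarrow> (nat \<Rightarrow> real^'p) \<Rightarrow> real \<Rightarrow> real" where
  "y_poly n x h =
     (2 * emp_prob n x (cball 0 (R0 n x)) - 1) * h\<^sup>2 - 2 * h * R0 n x - (R0 n x)\<^sup>2 - emp_obj n x 0"

definition H0 :: "nat \<Rightarrow> (nat \<Rightarrow> real^'p) \<Rightarrow> real" where
  "H0 n x = Max {h. y_poly n x h = 0}"

definition H :: "nat \<Rightarrow> (nat \<Rightarrow> real^'p) \<Rightarrow> real" where
  "H n x = H0 n x + 1"

subsection \<open>The constants of the limiting covariance\<close>

definition M1 :: "(real^'p) measure \<Rightarrow> real^'p \<Rightarrow> real^'p^'p" where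
  "M1 P v = (\<integral>x. norm (v + x) / norm (v - x) + norm (v - x) / norm (v + x) \<partial>P) *\<^sub>R mat 1"

definition M2 :: "(real^'p) measure \<Rightarrow> real^'p \<Rightarrow> real^'p^'p" where
  "M2 P v = (\<integral>x. (norm (v + x) / norm (v - x) ^ 3) *\<^sub>R outer (v - x) (v - x) \<partial>P)"

definition M4 :: "(real^'p) measure \<Rightarrow> real^'p \<Rightarrow> real^'p^'p" where
  "M4 P v = (\<integral>x. (1 / (norm (v + x) * norm (v - x))) *\<^sub>R outer (v + x) (v - x) \<partial>P)"

definition qform :: "real^'p^'p \<Rightarrow> real^'p \<Rightarrow> real" where
  "qform A u = u \<bullet> (A *v u)"

text \<open>The constants \<open>c\<^sub>1\<close> and \<open>d\<^sub>1\<close> are the cases \<open>u = o\<^sub>1\<close> and \<open>u = o\<^sub>2\<close>.\<close>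

definition grad_moment :: "(real^'p) measure \<Rightarrow> real^'p \<Rightarrow> real^'p \<Rightarrow> real" where
  "grad_moment P v u = (\<integral>x. ((norm (v + x))\<^sup>2 / (norm (v - x))\<^sup>2) * (u \<bullet> (v - x))\<^sup>2 \<partial>P)"

definition q1 :: "(real^'p) measure \<Rightarrow> real \<Rightarrow> real^'p \<Rightarrow> real" where
  "q1 P \<psi> o1 =
     (let v = \<psi> *\<^sub>R o1; c1 = grad_moment P v o1; \<sigma>1 = phi1 (cov P);
          a1 = qform (M1 P v) o1; a2 = qform (M2 P v) o1; a4 = qform (M4 P v) o1
      in 2 * (c1 - \<sigma>1 + \<psi>\<^sup>2) * (a1 - 2 * a2 + 2 * a4) powi (-2))"

definition q2 :: "(real^'p) measure \<Rightarrow> real \<Rightarrow> real^'p \<Rightarrow> real^'p \<Rightarrow> real" where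
  "q2 P \<psi> o1 o2 =
     (let v = \<psi> *\<^sub>R o1; d1 = grad_moment P v o2; \<sigma>2 = phi_rest (cov P);
          a1 = qform (M1 P v) o1; b2 = qform (M2 P v) o2; b4 = qform (M4 P v) o2
      in 2 * (d1 - \<sigma>2) * (a1 - 2 * b2 + 2 * b4) powi (-2))"

subsection \<open>Multivariate normal law and convergence in distribution\<close>

definition std_mvnormal :: "(real^'p) measure" where
  "std_mvnormal = density lborel (\<lambda>x. ennreal (\<Prod>i\<in>UNIV. std_normal_density (x $ i)))"

text \<open>The law of \<open>\<mu> + A W\<close> with \<open>W\<close> standard normal depends on \<open>A\<close> only through
  \<open>A A' = S\<close>. This covers singular \<open>S\<close>, for which there is no Lebesgue density.\<close>

definition mvnormal :: "real^'p \<Rightarrow> real^'p^'p \<Rightarrow> (real^'p) measure" where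
  "mvnormal \<mu> S = distr std_mvnormal borel
     (\<lambda>w. \<mu> + (SOME A :: real^'p^'p. A ** transpose A = S) *v w)"

definition conv_in_distr ::
  "'a measure \<Rightarrow> (nat \<Rightarrow> 'a \<Rightarrow> real^'p) \<Rightarrow> (real^'p) measure \<Rightarrow> bool" where
  "conv_in_distr M Y Q \<longleftrightarrow> (\<forall>n. Y n \<in> borel_measurable M) \<and>
     (\<forall>g :: real^'p \<Rightarrow> real. continuous_on UNIV g \<and> bounded (range g) \<longrightarrow>
        (\<lambda>n. \<integral>\<omega>. g (Y n \<omega>) \<partial>M) \<longlonglongrightarrow> (\<integral>x. g x \<partial>Q))"

text \<open>The \<open>\<sigma>\<close>-algebra generated by the first \<open>n\<close> observations and the estimator
  computed from them.\<close>

definition sample_algebra ::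
  "'a measure \<Rightarrow> (nat \<Rightarrow> 'a \<Rightarrow> real^'p) \<Rightarrow> nat \<Rightarrow> ('a \<Rightarrow> real^'p) \<Rightarrow> 'a measure" where
  "sample_algebra M X n v =
     vimage_algebra (space M) (\<lambda>\<omega>. (\<lambda>i\<in>{..<n}. X i \<omega>, v \<omega>))
       ((\<Pi>\<^sub>M i\<in>{..<n}. borel) \<Otimes>\<^sub>M borel)"

end

(* Writing N = |x|^2 + |v|^2 and s = |x - v| |x + v|, one has s^2 = N^2 - 4 (x.v)^2, a polynomial in v.
   Expanding s(v + h)^2 - s(v)^2 algebraically gives a second-order expansion of the loss at v whose
   remainder is at most |h|^2 times min(B(x), |h| C(x)), with B integrable under P (the singularity of B
   is of order 1/|x - v|, and p >= 2) and C finite almost everywhere. By dominated convergence and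
   Markov's inequality the averaged remainder is o(|h|^2) uniformly over small h, with high probability,
   so that no empirical process theory is needed: a consistent minimizer of the sample objective is
   within o(1/sqrt n) of the minimizer of its quadratic approximation, and the central limit theorem
   applies to the score, whose norm is bounded by 2 |v|.

   The Hessian of the population objective at psi o1 is diagonal in the basis of the columns of O, by
   reflection invariance. Its entries are positive: along o1, subtracting a multiple of the mean-zero
   score leaves a positive integrand; across o1, the integrand is the derivative of a periodic function
   along the rotations of the (o1, o2)-plane, and it is positively associated along each orbit with the
   density, which increases with (x.o1)^2. The density of Z is identified from its radial part through
   the characteristic function: for spherical Z and independent unit spherical Y,
   E exp(i t.Z) = E exp(i |t| Y.Z) depends only on the law of |Z|. *)

theory Submission
  imports Defs
begin

subsection \<open>Characteristic functions on Euclidean space\<close>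

text \<open>The loss has a kink at v = x and v = -x. Its second derivative blows up there like 1/|x
  - v|, which is integrable but in the plane not square integrable, and the natural third-order
  bound is not integrable there at all. The averages of the Hessian therefore call for a law of
  large numbers under a first moment only, and the cubic bound is truncated before it is averaged.
  The data-dependent ball is disposed of deterministically: beyond the root that defines it the
  sample objective exceeds its value 0 at the origin, so the estimator is a global minimizer.
  Evenness of the loss leaves the sign open, and the first component of the estimator fixes it. The
  limit covariance is the score covariance between two inverse Hessians. Squared score and Hessian
  both contain a singular term together with its image under x -> -x, and P is symmetric; hence the
  factor 2 of c1, d1, a2 and b2, while the cross terms are the source of psi^2, the eigenvalues of
  Cov(X), a4 and b4. Characteristic functions are handled by Gaussian smoothing, which also serves
  to identify spherical laws.\<close>

lemma
  fixes f :: "'a::euclidean_space \<Rightarrow> real \<Rightarrow> complex"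
  assumes f: "\<And>b. b \<in> Basis \<Longrightarrow> integrable lborel (f b)"
  shows lborel_integral_prod_Basis:
    "(\<integral>x. (\<Prod>b\<in>Basis. f b (x \<bullet> b)) \<partial>lborel) = (\<Prod>b\<in>Basis. \<integral>x. f b x \<partial>lborel)"
proof -
  interpret product_sigma_finite "\<lambda>b::'a. lborel :: real measure" ..
  have [measurable]: "f b \<in> borel_measurable borel" if "b \<in> Basis" for b
    using f[OF that] by (simp add: borel_measurable_integrable)
  have "(\<integral>x. (\<Prod>b\<in>Basis. f b (x \<bullet> b)) \<partial>lborel) =
      (\<integral>x. (\<Prod>b\<in>Basis. f b ((\<Sum>b\<in>Basis. x b *\<^sub>R b) \<bullet> b)) \<partial>(\<Pi>\<^sub>M b\<in>Basis. lborel))"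
    by (subst lborel_eq, subst integral_distr) auto
  also have "\<dots> = (\<integral>x. (\<Prod>b\<in>Basis. f b (x b)) \<partial>(\<Pi>\<^sub>M b\<in>(Basis::'a set). lborel))"
    by (intro Bochner_Integration.integral_cong refl prod.cong) simp
  also have "\<dots> = (\<Prod>b\<in>Basis. \<integral>x. f b x \<partial>lborel)"
    by (rule product_integral_prod) (auto intro: f)
  finally show ?thesis .
qed

lemma prod_UNIV_eq_prod_Basis:
  fixes x :: "real^'p" and G :: "real^'p \<Rightarrow> real \<Rightarrow> 'b::comm_monoid_mult"
  shows "(\<Prod>b\<in>Basis. G b (x \<bullet> b)) = (\<Prod>i\<in>UNIV. G (axis i 1) (x $ i))"
proof -
  have B: "(Basis :: (real^'p) set) = range (\<lambda>i. axis i 1)"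
    by (auto simp: Basis_vec_def)
  have inj: "inj (\<lambda>i::'p. axis i (1::real))"
    by (auto simp: inj_on_def axis_eq_axis)
  show ?thesis unfolding B by (subst prod.reindex[OF inj]) (simp add: inner_axis)
qed

text \<open>The density depends on the norm alone. The smoothing formula needs this form, and so
  does the transfer of rotation invariance to Lebesgue measure.\<close>

lemma std_mvnormal_density_eq:
  "(\<Prod>i\<in>UNIV. std_normal_density (x $ i)) =
     (1 / sqrt (2 * pi)) ^ CARD('p) * exp (- (norm x)\<^sup>2 / 2)" for x :: "real^'p"
proof -
  have "(norm x)\<^sup>2 = (\<Sum>i\<in>UNIV. (x $ i)\<^sup>2)"
    by (simp add: norm_vec_def L2_set_def sum_nonneg)
  then have "exp (- (norm x)\<^sup>2 / 2) = (\<Prod>i\<in>UNIV. exp (- (x $ i)\<^sup>2 / 2))"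
    by (simp add: exp_sum[symmetric] sum_negf sum_divide_distrib)
  then show ?thesis
    by (simp add: normal_density_def prod.distrib[symmetric] power_divide flip: prod_constant)
qed

lemma sets_std_mvnormal [simp, measurable_cong]: "sets std_mvnormal = sets borel"
  and space_std_mvnormal [simp]: "space std_mvnormal = UNIV"
  by (auto simp: std_mvnormal_def)

lemma prob_space_std_mvnormal: "prob_space (std_mvnormal :: (real^'p) measure)"
proof
  have "emeasure std_mvnormal (space (std_mvnormal :: (real^'p) measure)) =
      (\<integral>\<^sup>+(x::real^'p). (\<Prod>b\<in>Basis. ennreal (std_normal_density (x \<bullet> b))) \<partial>lborel)"
    by (subst prod_UNIV_eq_prod_Basis)
      (auto simp: std_mvnormal_def emeasure_density prod_ennreal normal_density_nonneg)
  also have "\<dots> = (\<Prod>b\<in>(Basis :: (real^'p) set). \<integral>\<^sup>+x. ennreal (std_normal_density x) \<partial>lborel)"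
    by (rule nn_integral_lborel_prod[where f="\<lambda>_ x. ennreal (std_normal_density x)"]) auto
  also have "(\<integral>\<^sup>+x. ennreal (std_normal_density x) \<partial>lborel) = 1"
    by (subst nn_integral_eq_integral) (auto simp: integrable_normal_density)
  finally show "emeasure std_mvnormal (space (std_mvnormal :: (real^'p) measure)) = 1" by simp
qed

text \<open>The integral factorizes over the coordinates. The result is also used from right to
  left: a Gaussian kernel is an average of characters.\<close>

theorem char_std_mvnormal:
  "(\<integral>x. iexp (t \<bullet> x) \<partial>std_mvnormal) = complex_of_real (exp (- (norm t)\<^sup>2 / 2))" for t :: "real^'p"
proof -
  have "(\<integral>x. iexp (t \<bullet> x) \<partial>std_mvnormal) =
      (\<integral>x. (\<Prod>i\<in>UNIV. std_normal_density (x $ i)) *\<^sub>R iexp (t \<bullet> x) \<partial>lborel)"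
    unfolding std_mvnormal_def
    by (subst integral_density) (auto simp: prod_nonneg normal_density_nonneg)
  also have "\<dots> = (\<integral>x. (\<Prod>b\<in>Basis. std_normal_density (x \<bullet> b) *\<^sub>R iexp ((t \<bullet> b) * (x \<bullet> b))) \<partial>lborel)"
  proof (intro Bochner_Integration.integral_cong refl)
    fix x :: "real^'p"
    have "iexp (t \<bullet> x) = (\<Prod>b\<in>Basis. iexp ((t \<bullet> b) * (x \<bullet> b)))"
      by (subst euclidean_inner) (simp add: sum_distrib_left exp_sum)
    moreover have "(\<Prod>i\<in>UNIV. std_normal_density (x $ i)) = (\<Prod>b\<in>Basis. std_normal_density (x \<bullet> b))"
      by (subst prod_UNIV_eq_prod_Basis) simp
    ultimately show "(\<Prod>i\<in>UNIV. std_normal_density (x $ i)) *\<^sub>R iexp (t \<bullet> x) =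
        (\<Prod>b\<in>Basis. std_normal_density (x \<bullet> b) *\<^sub>R iexp ((t \<bullet> b) * (x \<bullet> b)))"
      by (simp add: scaleR_conv_of_real prod.distrib)
  qed
  also have "\<dots> = (\<Prod>b\<in>Basis. \<integral>x. std_normal_density x *\<^sub>R iexp ((t \<bullet> b) * x) \<partial>lborel)"
    by (rule lborel_integral_prod_Basis[where f="\<lambda>b x. std_normal_density x *\<^sub>R iexp ((t \<bullet> b) * x)"])
      (rule Bochner_Integration.integrable_bound[OF integrable_normal_density[of 1 0]], auto)
  also have "\<dots> = (\<Prod>b\<in>Basis. complex_of_real (exp (- (t \<bullet> b)\<^sup>2 / 2)))"
  proof (rule prod.cong[OF refl])
    fix b :: "real^'p"
    have "(\<integral>x. std_normal_density x *\<^sub>R iexp ((t \<bullet> b) * x) \<partial>lborel) = char std_normal_distribution (t \<bullet> b)"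
      unfolding char_def by (subst integral_density) (auto simp: normal_density_nonneg)
    then show "(\<integral>x. std_normal_density x *\<^sub>R iexp ((t \<bullet> b) * x) \<partial>lborel) = complex_of_real (exp (- (t \<bullet> b)\<^sup>2 / 2))"
      by (simp add: char_std_normal_distribution)
  qed
  also have "\<dots> = complex_of_real (exp (\<Sum>b\<in>Basis. - (t \<bullet> b)\<^sup>2 / 2))"
    by (subst exp_sum) auto
  also have "(\<Sum>b\<in>Basis. - (t \<bullet> b)\<^sup>2 / 2) = - (norm t)\<^sup>2 / 2"
    unfolding power2_norm_eq_inner
    by (subst euclidean_inner) (simp add: power2_eq_square sum_negf sum_divide_distrib)
  finally show ?thesis .
qed


section \<open>The continuity theorem for characteristic functions\<close>

text \<open>Justifies fixing a smoothing or cut-off level before n grows: the approximating sequence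
  and its limit may depend on e.\<close>

lemma LIMSEQ_approx:
  fixes a :: "nat \<Rightarrow> real"
  assumes "\<And>e. e > 0 \<Longrightarrow> \<exists>b c. b \<longlonglongrightarrow> c \<and> (\<forall>\<^sub>F n in sequentially. \<bar>a n - b n\<bar> \<le> e) \<and> \<bar>l - c\<bar> \<le> e"
  shows "a \<longlonglongrightarrow> l"
proof (rule tendstoI)
  fix e :: real assume "e > 0"
  then obtain b c where b: "b \<longlonglongrightarrow> c" "\<forall>\<^sub>F n in sequentially. \<bar>a n - b n\<bar> \<le> e / 4" "\<bar>l - c\<bar> \<le> e / 4"
    using assms[of "e / 4"] by auto
  have "\<forall>\<^sub>F n in sequentially. dist (b n) c < e / 4"
    using b(1) \<open>e > 0\<close> by (auto dest!: tendstoD[where e="e / 4"])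
  with b(2) show "\<forall>\<^sub>F n in sequentially. dist (a n) l < e"
  proof eventually_elim
    case (elim n)
    then show ?case using b(3) \<open>e > 0\<close> unfolding dist_real_def by linarith
  qed
qed

lemma (in prob_space) tight_norm:
  fixes X :: "'a \<Rightarrow> 'b::{real_normed_vector,second_countable_topology}"
  assumes [measurable]: "X \<in> borel_measurable M" and "e > 0"
  shows "\<exists>K>0. prob {\<omega>\<in>space M. norm (X \<omega>) > K} < e"
proof -
  define A where "A k = {\<omega>\<in>space M. norm (X \<omega>) > real k}" for k :: nat
  have [measurable]: "A k \<in> events" for k unfolding A_def by measurable
  have "(\<lambda>k. prob (A k)) \<longlonglongrightarrow> prob (\<Inter>k. A k)"
    by (rule finite_Lim_measure_decseq) (auto simp: decseq_def A_def)
  moreover have "(\<Inter>k. A k) = {}"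
  proof -
    have "\<exists>k. \<omega> \<notin> A k" for \<omega>
    proof -
      obtain k :: nat where "norm (X \<omega>) < real k" using reals_Archimedean2 by blast
      then show ?thesis by (intro exI[of _ k]) (auto simp: A_def)
    qed
    then show ?thesis by blast
  qed
  ultimately have "(\<lambda>k. prob (A k)) \<longlonglongrightarrow> 0" by simp
  then have "\<forall>\<^sub>F k in sequentially. prob (A k) < e"
    using \<open>e > 0\<close> by (rule order_tendstoD)
  then obtain k0 where "\<forall>k\<ge>k0. prob (A k) < e"
    by (auto simp: eventually_sequentially)
  \<comment> \<open>The index is \<open>Suc k0\<close> because the radius must be positive and
    \<open>k0\<close> may be 0.\<close>
  then have "prob (A (Suc k0)) < e" by auto
  then show ?thesis unfolding A_def by (intro exI[of _ "real (Suc k0)"]) auto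
qed

text \<open>The kernel value is the mean of a character over a normal variable w; Fubini then moves
  the integral over \<open>N\<close> inside. The integral of any Gaussian bump is thus determined by
  the characteristic function of \<open>N\<close>.\<close>

lemma gauss_kernel_char:
  fixes N :: "(real^'p) measure"
  assumes "prob_space N" and [measurable_cong]: "sets N = sets borel" and "\<epsilon> > 0"
  shows "complex_of_real (\<integral>x. exp (- (norm ((a - x) /\<^sub>R \<epsilon>))\<^sup>2 / 2) \<partial>N) =
     (\<integral>w. iexp (a \<bullet> (w /\<^sub>R \<epsilon>)) * (\<integral>x. iexp (- (w /\<^sub>R \<epsilon>) \<bullet> x) \<partial>N) \<partial>std_mvnormal)"
proof -
  interpret N: prob_space N by fact
  interpret W: prob_space "std_mvnormal :: (real^'p) measure" by (rule prob_space_std_mvnormal)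
  interpret pair_prob_space N "std_mvnormal :: (real^'p) measure" ..
  have "complex_of_real (\<integral>x. exp (- (norm ((a - x) /\<^sub>R \<epsilon>))\<^sup>2 / 2) \<partial>N) =
      (\<integral>x. complex_of_real (exp (- (norm ((a - x) /\<^sub>R \<epsilon>))\<^sup>2 / 2)) \<partial>N)"
    by simp
  also have "\<dots> = (\<integral>x. (\<integral>w. iexp (((a - x) /\<^sub>R \<epsilon>) \<bullet> w) \<partial>std_mvnormal) \<partial>N)"
    by (simp only: char_std_mvnormal)
  also have "\<dots> = (\<integral>w. (\<integral>x. iexp (((a - x) /\<^sub>R \<epsilon>) \<bullet> w) \<partial>N) \<partial>std_mvnormal)"
    by (rule Fubini_integral[symmetric])
      (rule integrable_const_bound[where B=1], auto simp: case_prod_beta)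
  also have "\<dots> = (\<integral>w. iexp (a \<bullet> (w /\<^sub>R \<epsilon>)) * (\<integral>x. iexp (- (w /\<^sub>R \<epsilon>) \<bullet> x) \<partial>N) \<partial>std_mvnormal)"
    by (subst integral_mult_right_zero[symmetric])
      (intro Bochner_Integration.integral_cong refl, simp add: exp_add[symmetric] inner_diff_left inner_commute algebra_simps)
  finally show ?thesis .
qed

text \<open>The substitution a = y + \<epsilon> w turns the Gaussian mean around y into a
  convolution with the kernel of \<open>gauss_kernel_char\<close>, in which the argument of g no
  longer involves y.\<close>

lemma gauss_smooth_eq:
  fixes g :: "real^'p \<Rightarrow> real"
  assumes [measurable]: "g \<in> borel_measurable borel" and "\<epsilon> > 0"
  shows "(\<integral>w. g (y + \<epsilon> *\<^sub>R w) \<partial>std_mvnormal) =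
    (1 / sqrt (2 * pi)) ^ CARD('p) / \<epsilon> ^ CARD('p) * (\<integral>a. g a * exp (- (norm ((a - y) /\<^sub>R \<epsilon>))\<^sup>2 / 2) \<partial>lborel)"
proof -
  let ?c = "(1 / sqrt (2 * pi)) ^ CARD('p)"
  have [simp]: "inverse \<epsilon> * (\<epsilon> * r) = r" for r using \<open>\<epsilon> > 0\<close> by simp
  have "(\<integral>a. g a * exp (- (norm ((a - y) /\<^sub>R \<epsilon>))\<^sup>2 / 2) \<partial>lborel) =
      (\<integral>a. g a * exp (- (norm ((a - y) /\<^sub>R \<epsilon>))\<^sup>2 / 2) \<partial>(density (distr lborel borel (\<lambda>x. y + \<epsilon> *\<^sub>R x)) (\<lambda>_. ennreal (\<bar>\<epsilon>\<bar> ^ DIM(real^'p)))))"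
    using \<open>\<epsilon> > 0\<close> lborel_affine[of \<epsilon> y] by simp
  also have "\<dots> = \<epsilon> ^ CARD('p) * (\<integral>w. g (y + \<epsilon> *\<^sub>R w) * exp (- (norm w)\<^sup>2 / 2) \<partial>lborel)"
    using \<open>\<epsilon> > 0\<close> by (subst integral_density) (auto simp: integral_distr)
  finally have *: "(\<integral>a. g a * exp (- (norm ((a - y) /\<^sub>R \<epsilon>))\<^sup>2 / 2) \<partial>lborel) =
      \<epsilon> ^ CARD('p) * (\<integral>w. g (y + \<epsilon> *\<^sub>R w) * exp (- (norm w)\<^sup>2 / 2) \<partial>lborel)" .
  have "(\<integral>w. g (y + \<epsilon> *\<^sub>R w) \<partial>std_mvnormal) = (\<integral>w. ?c * (g (y + \<epsilon> *\<^sub>R w) * exp (- (norm w)\<^sup>2 / 2)) \<partial>lborel)"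
    unfolding std_mvnormal_def
    by (subst integral_density) (auto simp: prod_nonneg normal_density_nonneg std_mvnormal_density_eq mult_ac)
  then show ?thesis using * \<open>\<epsilon> > 0\<close> by simp
qed

lemma continuous_compact_support_imp_integrable_lborel:
  fixes g :: "'a::euclidean_space \<Rightarrow> real"
  assumes "continuous_on UNIV g" "\<And>x. norm x > L \<Longrightarrow> g x = 0"
  shows "integrable lborel g"
proof -
  have "integrable lborel (\<lambda>x. indicator (cball 0 L) x *\<^sub>R g x)"
    by (rule borel_integrable_compact) (auto intro: continuous_on_subset[OF assms(1)])
  also have "(\<lambda>x. indicator (cball 0 L) x *\<^sub>R g x) = g"
    using assms(2) by (auto simp: indicator_def fun_eq_iff)
  finally show ?thesis .
qed

context
  fixes N :: "nat \<Rightarrow> (real^'p) measure" and Q :: "(real^'p) measure"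
  assumes N: "\<And>n. prob_space (N n)" and sets_N [measurable_cong]: "\<And>n. sets (N n) = sets borel"
    and Q: "prob_space Q" and sets_Q [measurable_cong]: "sets Q = sets borel"
    and char_conv: "\<And>t. (\<lambda>n. \<integral>x. iexp (t \<bullet> x) \<partial>N n) \<longlonglongrightarrow> (\<integral>x. iexp (t \<bullet> x) \<partial>Q)"
begin

interpretation N: prob_space "N n" for n by (rule N)
interpretation Q: prob_space Q by (rule Q)
interpretation W: prob_space "std_mvnormal :: (real^'p) measure" by (rule prob_space_std_mvnormal)

private lemma norm_char_le_1: "norm (\<integral>x. iexp (t \<bullet> x) \<partial>N n) \<le> 1"
proof -
  have "norm (\<integral>x. iexp (t \<bullet> x) \<partial>N n) \<le> (\<integral>x. norm (iexp (t \<bullet> x)) \<partial>N n)"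
    by (rule integral_norm_bound)
  then show ?thesis by (simp add: N.prob_space)
qed

text \<open>Characteristic functions are bounded by 1, so their pointwise convergence passes under
  the Gaussian mean by dominated convergence.\<close>

private lemma gauss_kernel_conv:
  assumes e: "\<epsilon> > 0"
  shows "(\<lambda>n. \<integral>x. exp (- (norm ((a - x) /\<^sub>R \<epsilon>))\<^sup>2 / 2) \<partial>N n) \<longlonglongrightarrow>
     (\<integral>x. exp (- (norm ((a - x) /\<^sub>R \<epsilon>))\<^sup>2 / 2) \<partial>Q)"
proof -
  have "(\<lambda>n. complex_of_real (\<integral>x. exp (- (norm ((a - x) /\<^sub>R \<epsilon>))\<^sup>2 / 2) \<partial>N n)) \<longlonglongrightarrow>
     complex_of_real (\<integral>x. exp (- (norm ((a - x) /\<^sub>R \<epsilon>))\<^sup>2 / 2) \<partial>Q)"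
    unfolding gauss_kernel_char[OF N sets_N e] gauss_kernel_char[OF Q sets_Q e]
  proof (rule integral_dominated_convergence[where w="\<lambda>_. 1"])
    show "AE w in std_mvnormal. (\<lambda>n. iexp (a \<bullet> (w /\<^sub>R \<epsilon>)) * (\<integral>x. iexp (- (w /\<^sub>R \<epsilon>) \<bullet> x) \<partial>N n)) \<longlonglongrightarrow>
        iexp (a \<bullet> (w /\<^sub>R \<epsilon>)) * (\<integral>x. iexp (- (w /\<^sub>R \<epsilon>) \<bullet> x) \<partial>Q)"
      by (intro AE_I2 tendsto_mult tendsto_const char_conv)
    show "AE w in std_mvnormal. norm (iexp (a \<bullet> (w /\<^sub>R \<epsilon>)) * (\<integral>x. iexp (- (w /\<^sub>R \<epsilon>) \<bullet> x) \<partial>N n)) \<le> 1" for n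
      by (intro AE_I2) (simp only: norm_mult norm_exp_i_times mult_1_left norm_char_le_1)
  qed auto
  then show ?thesis by (simp only: tendsto_of_real_iff)
qed

text \<open>Compact support makes g Lebesgue integrable. As the kernel is at most 1, |g| serves both
  as the bound for exchanging the integrals and as the dominating function in n.\<close>

private lemma smooth_conv:
  fixes g :: "real^'p \<Rightarrow> real"
  assumes e: "\<epsilon> > 0" and g: "continuous_on UNIV g" and supp: "\<And>x. norm x > L \<Longrightarrow> g x = 0"
  shows "(\<lambda>n. \<integral>y. (\<integral>w. g (y + \<epsilon> *\<^sub>R w) \<partial>std_mvnormal) \<partial>N n) \<longlonglongrightarrow>
     (\<integral>y. (\<integral>w. g (y + \<epsilon> *\<^sub>R w) \<partial>std_mvnormal) \<partial>Q)"
proof -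
  let ?K = "\<lambda>a x :: real^'p. exp (- (norm ((a - x) /\<^sub>R \<epsilon>))\<^sup>2 / 2)"
  have [measurable]: "g \<in> borel_measurable borel" using g by (rule borel_measurable_continuous_onI)
  have int: "integrable lborel g"
    by (rule continuous_compact_support_imp_integrable_lborel[OF g]) (use supp in auto)
  have swap: "(\<integral>y. (\<integral>a. g a * ?K a y \<partial>lborel) \<partial>R) = (\<integral>a. g a * (\<integral>y. ?K a y \<partial>R) \<partial>lborel)"
    if "prob_space R" and [measurable_cong]: "sets R = sets borel" for R
  proof -
    interpret R: prob_space R by fact
    interpret pair_sigma_finite R "lborel :: (real^'p) measure" ..
    have g2: "integrable (R \<Otimes>\<^sub>M lborel) (\<lambda>(y, a). g a)"
      by (rule Fubini_integrable) (use int in auto)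
    have "integrable (R \<Otimes>\<^sub>M lborel) (\<lambda>(y, a). g a * ?K a y)"
      by (rule Bochner_Integration.integrable_bound[OF g2], measurable)
        (intro AE_I2, clarsimp simp: abs_mult mult_left_le)
    from Fubini_integral[OF this] show ?thesis by simp
  qed
  have "(\<lambda>n. \<integral>a. g a * (\<integral>y. ?K a y \<partial>N n) \<partial>lborel) \<longlonglongrightarrow> (\<integral>a. g a * (\<integral>y. ?K a y \<partial>Q) \<partial>lborel)"
  proof (rule integral_dominated_convergence[where w="\<lambda>a. \<bar>g a\<bar>"])
    show "AE a in lborel. (\<lambda>n. g a * (\<integral>y. ?K a y \<partial>N n)) \<longlonglongrightarrow> g a * (\<integral>y. ?K a y \<partial>Q)"
      by (intro AE_I2 tendsto_mult tendsto_const gauss_kernel_conv e)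
    show "AE a in lborel. norm (g a * (\<integral>y. ?K a y \<partial>N n)) \<le> \<bar>g a\<bar>" for n
    proof (rule AE_I2)
      fix a
      have "(\<integral>y. ?K a y \<partial>N n) \<le> 1"
        by (rule N.integral_le_const) (auto intro!: N.integrable_const_bound[where B=1])
      moreover have "(\<integral>y. ?K a y \<partial>N n) \<ge> 0" by simp
      ultimately show "norm (g a * (\<integral>y. ?K a y \<partial>N n)) \<le> \<bar>g a\<bar>"
        by (simp add: abs_mult mult_left_le)
    qed
  qed (use int in auto)
  from tendsto_mult[OF tendsto_const this, of "(1 / sqrt (2 * pi)) ^ CARD('p) / \<epsilon> ^ CARD('p)"]
  show ?thesis
    by (simp only: gauss_smooth_eq[OF \<open>g \<in> borel_measurable borel\<close> e] integral_mult_right_zero swap[OF N sets_N] swap[OF Q sets_Q])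
qed

text \<open>Uniform continuity of g bounds the change under smoothing by e at every point, hence
  under \<open>Q\<close> and under all \<open>N n\<close> alike; the smoothed integrals converge by
  \<open>smooth_conv\<close>.\<close>

private lemma compact_support_conv:
  fixes g :: "real^'p \<Rightarrow> real"
  assumes g: "continuous_on UNIV g" and supp: "\<And>x. norm x > L \<Longrightarrow> g x = 0"
  shows "(\<lambda>n. \<integral>y. g y \<partial>N n) \<longlonglongrightarrow> (\<integral>y. g y \<partial>Q)"
proof (rule LIMSEQ_approx)
  fix e :: real assume "e > 0"
  have [measurable]: "g \<in> borel_measurable borel" using g by (rule borel_measurable_continuous_onI)
  have "bounded (g ` cball 0 L)"
    by (intro compact_imp_bounded compact_continuous_image continuous_on_subset[OF g]) auto
  then obtain B0 where "\<forall>y\<in>g ` cball 0 L. norm y \<le> B0" unfolding bounded_iff by blast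
  then have B0: "\<bar>g x\<bar> \<le> B0" if "norm x \<le> L" for x using that by auto
  define B where "B = max B0 1"
  have B: "\<bar>g x\<bar> \<le> B" "B > 0" for x
    using B0[of x] supp[of x] by (cases "norm x \<le> L"; simp add: B_def)+
  have "uniformly_continuous_on (cball 0 (L + 1)) g"
    by (intro compact_uniformly_continuous continuous_on_subset[OF g]) auto
  then obtain d0 where d0: "d0 > 0"
    "\<forall>x\<in>cball 0 (L+1). \<forall>y\<in>cball 0 (L+1). dist y x < d0 \<longrightarrow> dist (g y) (g x) < e / 2"
    unfolding uniformly_continuous_on_def using half_gt_zero[OF \<open>e > 0\<close>] by blast
  \<comment> \<open>The cap 1 handles points beyond radius L + 1: if y or y + h lies there, both lie
    beyond radius L, where g vanishes.\<close>
  define d where "d = min d0 1"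
  have d: "d > 0" using d0 by (simp add: d_def)
  have dg: "\<bar>g (y + h) - g y\<bar> \<le> e / 2" if "norm h < d" for y h
  proof (cases "norm y \<le> L + 1 \<and> norm (y + h) \<le> L + 1")
    case True
    then have "y \<in> cball 0 (L+1)" "y + h \<in> cball 0 (L+1)" by (simp_all only: mem_cball_0)
    moreover have "dist (y + h) y < d0" using that by (simp add: d_def dist_norm)
    ultimately have "dist (g (y + h)) (g y) < e / 2" using d0(2) by blast
    then show ?thesis by (simp add: dist_real_def)
  next
    case False
    then have "norm y > L" "norm (y + h) > L"
      using that norm_triangle_ineq[of y h] norm_triangle_ineq4[of "y + h" h] by (auto simp: d_def)
    then show ?thesis using supp \<open>e > 0\<close> by simp
  qed
  \<comment> \<open>Beyond K the change of g is at most 2B, and a tail mass below e / (4B)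
    contributes at most e / 2. Within K the scale chosen next keeps the shift below d.\<close>
  obtain K where K: "K > 0" "W.prob {w. norm (w :: real^'p) > K} < e / (4 * B)"
    using W.tight_norm[of "\<lambda>w. w" "e / (4 * B)"] \<open>e > 0\<close> B(2) by (auto)
  define \<epsilon> where "\<epsilon> = d / (2 * K)"
  have eps: "\<epsilon> > 0" using d K by (simp add: \<epsilon>_def)
  have int_W: "integrable std_mvnormal (\<lambda>w. g (y + \<epsilon> *\<^sub>R w))" for y
    by (rule W.integrable_const_bound[where B=B]) (auto simp: B)
  have [simp]: "W.prob UNIV = 1" using W.prob_space by simp
  have close: "\<bar>g y - (\<integral>w. g (y + \<epsilon> *\<^sub>R w) \<partial>std_mvnormal)\<bar> \<le> e" for y
  proof -
    have "(\<integral>w. g (y + \<epsilon> *\<^sub>R w) \<partial>std_mvnormal) - g y = (\<integral>w. g (y + \<epsilon> *\<^sub>R w) - g y \<partial>std_mvnormal)"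
      using int_W by (subst Bochner_Integration.integral_diff) (auto simp: W.prob_space)
    also have "\<bar>\<dots>\<bar> \<le> (\<integral>w. \<bar>g (y + \<epsilon> *\<^sub>R w) - g y\<bar> \<partial>std_mvnormal)"
      by (rule integral_abs_bound)
    also have "\<dots> \<le> (\<integral>w. e / 2 + 2 * B * indicator {w :: real^'p. norm w > K} w \<partial>std_mvnormal)"
    proof (rule integral_mono)
      show "integrable std_mvnormal (\<lambda>w. \<bar>g (y + \<epsilon> *\<^sub>R w) - g y\<bar>)" using int_W by auto
      show "integrable std_mvnormal (\<lambda>w. e / 2 + 2 * B * indicator {w::real^'p. norm w > K} w)"
        using B(2) \<open>e > 0\<close> by (intro W.integrable_const_bound[where B="e / 2 + 2 * B"]) (auto simp: indicator_def)
      fix w :: "real^'p"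
      show "\<bar>g (y + \<epsilon> *\<^sub>R w) - g y\<bar> \<le> e / 2 + 2 * B * indicator {w. norm w > K} w"
      proof (cases "norm w > K")
        case True
        then show ?thesis using B(1)[of y] B(1)[of "y + \<epsilon> *\<^sub>R w"] \<open>e > 0\<close> by (simp add: abs_le_iff)
      next
        case False
        then have "\<epsilon> * norm w \<le> d / 2" using K(1) d by (simp add: \<epsilon>_def field_simps)
        then have "norm (\<epsilon> *\<^sub>R w) < d" using d eps by simp
        then show ?thesis using dg[of "\<epsilon> *\<^sub>R w" y] B by (simp add: indicator_def)
      qed
    qed
    also have "\<dots> = e / 2 + 2 * B * W.prob {w. norm w > K}"
      by (subst Bochner_Integration.integral_add) (auto simp: W.prob_space intro!: W.integrable_const_bound[where B="1"])
    also have "\<dots> \<le> e" using K(2) B(2) by (simp add: field_simps)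
    finally show ?thesis by (simp add: abs_minus_commute)
  qed
  let ?T = "\<lambda>y. (\<integral>w. g (y + \<epsilon> *\<^sub>R w) \<partial>std_mvnormal)"
  have close_int: "\<bar>(\<integral>y. g y \<partial>R) - (\<integral>y. ?T y \<partial>R)\<bar> \<le> e"
    if "prob_space R" and [measurable_cong]: "sets R = sets borel" for R
  proof -
    interpret R: prob_space R by fact
    have ig: "integrable R g" by (rule R.integrable_const_bound[where B=B]) (auto simp: B)
    have iT: "integrable R ?T"
    proof (rule R.integrable_const_bound[where B="B + e"])
      show "AE y in R. norm (?T y) \<le> B + e"
        using close B(1) by (intro AE_I2) (smt (verit) real_norm_def)
    qed measurable
    have "\<bar>(\<integral>y. g y \<partial>R) - (\<integral>y. ?T y \<partial>R)\<bar> = \<bar>\<integral>y. g y - ?T y \<partial>R\<bar>"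
      using ig iT by simp
    also have "\<dots> \<le> (\<integral>y. \<bar>g y - ?T y\<bar> \<partial>R)" by (rule integral_abs_bound)
    also have "\<dots> \<le> e"
      by (rule R.integral_le_const) (use ig iT close in auto)
    finally show ?thesis .
  qed
  show "\<exists>b c. b \<longlonglongrightarrow> c \<and> (\<forall>\<^sub>F n in sequentially. \<bar>(\<integral>y. g y \<partial>N n) - b n\<bar> \<le> e) \<and> \<bar>(\<integral>y. g y \<partial>Q) - c\<bar> \<le> e"
    using smooth_conv[OF eps g supp] close_int[OF N sets_N] close_int[OF Q sets_Q]
    by (intro exI[of _ "\<lambda>n. \<integral>y. ?T y \<partial>N n"] exI[of _ "\<integral>y. ?T y \<partial>Q"]) auto
qed

text \<open>Tightness of the \<open>N n\<close> is derived by testing against a continuous cut-off: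
  its mean under \<open>N n\<close> tends to its mean under \<open>Q\<close>, which is close to 1,
  so \<open>N n\<close> puts little mass far out.\<close>

theorem char_conv_imp_integral_conv:
  fixes g :: "real^'p \<Rightarrow> real"
  assumes g: "continuous_on UNIV g" and bdd: "bounded (range g)"
  shows "(\<lambda>n. \<integral>y. g y \<partial>N n) \<longlonglongrightarrow> (\<integral>y. g y \<partial>Q)"
proof (rule LIMSEQ_approx)
  fix e :: real assume "e > 0"
  have [measurable]: "g \<in> borel_measurable borel" using g by (rule borel_measurable_continuous_onI)
  obtain B0 where B0: "\<And>x. \<bar>g x\<bar> \<le> B0" using bdd by (auto simp: bounded_iff)
  define B where "B = max B0 1"
  have B: "\<bar>g x\<bar> \<le> B" "B > 0" for x using B0[of x] by (auto simp: B_def)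
  obtain K where K: "K > 0" "Q.prob {w\<in>space Q. norm (w :: real^'p) > K} < e / (2 * B)"
    using Q.tight_norm[of "\<lambda>w. w" "e / (2 * B)"] \<open>e > 0\<close> B(2) by auto
  define cu where "cu x = max 0 (min 1 (K + 1 - norm x))" for x :: "real^'p"
  have cont_chi: "continuous_on UNIV cu" unfolding cu_def by (intro continuous_intros)
  have [measurable]: "cu \<in> borel_measurable borel" using cont_chi by (rule borel_measurable_continuous_onI)
  have chi01: "0 \<le> cu x" "cu x \<le> 1" for x by (auto simp: cu_def)
  have chi_conv: "(\<lambda>n. \<integral>y. cu y \<partial>N n) \<longlonglongrightarrow> (\<integral>y. cu y \<partial>Q)"
    by (rule compact_support_conv[OF cont_chi, of "K + 1"]) (auto simp: cu_def)
  have gchi_conv: "(\<lambda>n. \<integral>y. g y * cu y \<partial>N n) \<longlonglongrightarrow> (\<integral>y. g y * cu y \<partial>Q)"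
    by (rule compact_support_conv[of _ "K + 1"]) (auto simp: cu_def intro!: continuous_intros g)
  have cut: "\<bar>(\<integral>y. g y \<partial>R) - (\<integral>y. g y * cu y \<partial>R)\<bar> \<le> B * (1 - (\<integral>y. cu y \<partial>R))"
    if "prob_space R" and [measurable_cong]: "sets R = sets borel" for R
  proof -
    interpret R: prob_space R by fact
    have ig: "integrable R g" by (rule R.integrable_const_bound[where B=B]) (auto simp: B)
    have ichi: "integrable R cu" by (rule R.integrable_const_bound[where B=1]) (auto simp: chi01)
    have igc: "integrable R (\<lambda>y. g y * cu y)"
    proof (intro R.integrable_const_bound[where B="B * 1"] AE_I2)
      fix y show "norm (g y * cu y) \<le> B * 1"
        unfolding real_norm_def abs_mult using B(1)[of y] B(2) chi01[of y] by (intro mult_mono) auto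
    qed measurable
    have "\<bar>(\<integral>y. g y \<partial>R) - (\<integral>y. g y * cu y \<partial>R)\<bar> = \<bar>\<integral>y. g y - g y * cu y \<partial>R\<bar>"
      using ig igc by simp
    also have "\<dots> \<le> (\<integral>y. \<bar>g y - g y * cu y\<bar> \<partial>R)" by (rule integral_abs_bound)
    also have "\<dots> \<le> (\<integral>y. B * (1 - cu y) \<partial>R)"
    proof (rule integral_mono)
      fix y
      have "g y - g y * cu y = g y * (1 - cu y)" by (simp add: algebra_simps)
      then have "\<bar>g y - g y * cu y\<bar> = \<bar>g y\<bar> * (1 - cu y)"
        using chi01(2)[of y] by (simp add: abs_mult)
      then show "\<bar>g y - g y * cu y\<bar> \<le> B * (1 - cu y)"
        using B(1)[of y] chi01(2)[of y] by (simp add: mult_right_mono)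
    qed (use ig igc ichi in auto)
    also have "\<dots> = B * (1 - (\<integral>y. cu y \<partial>R))" using ichi by (simp add: R.prob_space)
    finally show ?thesis .
  qed
  have "1 - (\<integral>y. cu y \<partial>Q) \<le> Q.prob {w\<in>space Q. norm w > K}"
  proof -
    have ichi: "integrable Q cu" by (rule Q.integrable_const_bound[where B=1]) (auto simp: chi01)
    have "1 - (\<integral>y. cu y \<partial>Q) = (\<integral>y. 1 - cu y \<partial>Q)" using ichi by (simp add: Q.prob_space)
    also have "\<dots> \<le> (\<integral>y. indicator {w\<in>space Q. norm w > K} y \<partial>Q)"
    proof (rule integral_mono)
      show "integrable Q (indicator {w \<in> space Q. norm w > K} :: _ \<Rightarrow> real)"
        by (rule Q.integrable_const_bound[where B=1]) auto
      show "integrable Q (\<lambda>y. 1 - cu y)" using ichi by simp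
    qed (auto simp: cu_def indicator_def)
    finally show ?thesis by simp
  qed
  with K(2) have Qchi: "1 - (\<integral>y. cu y \<partial>Q) < e / (2 * B)" by simp
  have Bmul: "B * (1 - r) \<le> e" if "1 - r < e / B" for r
    using that B(2) by (simp add: field_simps)
  have half: "e / (2 * B) \<le> e / B" using \<open>e > 0\<close> B(2) by (simp add: field_simps)
  have "\<forall>\<^sub>F n in sequentially. (\<integral>y. cu y \<partial>N n) > 1 - e / (2 * B)"
    using Qchi by (intro order_tendstoD(1)[OF chi_conv]) auto
  then have ev: "\<forall>\<^sub>F n in sequentially. \<bar>(\<integral>y. g y \<partial>N n) - (\<integral>y. g y * cu y \<partial>N n)\<bar> \<le> e"
  proof eventually_elim
    case (elim n)
    then show ?case using cut[OF N[of n] sets_N[of n]] Bmul[of "\<integral>y. cu y \<partial>N n"] half by linarith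
  qed
  show "\<exists>b c. b \<longlonglongrightarrow> c \<and> (\<forall>\<^sub>F n in sequentially. \<bar>(\<integral>y. g y \<partial>N n) - b n\<bar> \<le> e) \<and> \<bar>(\<integral>y. g y \<partial>Q) - c\<bar> \<le> e"
    using gchi_conv ev cut[OF Q sets_Q] Bmul[of "\<integral>y. cu y \<partial>Q"] half Qchi
    by (intro exI[of _ "\<lambda>n. \<integral>y. g y * cu y \<partial>N n"] exI[of _ "\<integral>y. g y * cu y \<partial>Q"]) auto
qed

end

text \<open>The indicator of a nonempty closed set is the decreasing limit of the functions max(0, 1
  - n dist), and the closed sets generate the Borel sets and are stable under intersection.\<close>

lemma measure_eqI_integral_continuous:
  fixes A B :: "'a::euclidean_space measure"
  assumes A: "prob_space A" "sets A = sets borel" and B: "prob_space B" "sets B = sets borel"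
    and eq: "\<And>g :: 'a \<Rightarrow> real. continuous_on UNIV g \<Longrightarrow> bounded (range g) \<Longrightarrow> (\<integral>x. g x \<partial>A) = (\<integral>x. g x \<partial>B)"
  shows "A = B"
proof (rule measure_eqI_generator_eq[where E="Collect closed" and \<Omega>=UNIV and A="\<lambda>_. UNIV"])
  interpret A: prob_space A by fact
  interpret B: prob_space B by fact
  note [measurable_cong] = A(2) B(2)
  fix C :: "'a set" assume "C \<in> Collect closed"
  then have C: "closed C" by simp
  show "emeasure A C = emeasure B C"
  \<comment> \<open>\<open>infdist\<close> from the empty set is 0 by convention, which would make
    \<open>g\<close> constantly 1; the empty set is treated apart.\<close>
  proof (cases "C = {}")
    case False
    define g where "g n x = max 0 (1 - real n * infdist x C)" for n x
    have [measurable]: "C \<in> sets borel" using C by simp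
    have cont: "continuous_on UNIV (g n)" for n unfolding g_def by (intro continuous_intros)
    have [measurable]: "g n \<in> borel_measurable borel" for n using cont by (rule borel_measurable_continuous_onI)
    have g01: "0 \<le> g n x" "g n x \<le> 1" for n x by (auto simp: g_def infdist_nonneg)
    have lim: "(\<lambda>n. g n x) \<longlonglongrightarrow> indicator C x" for x
    proof (cases "x \<in> C")
      case True then show ?thesis by (simp add: g_def)
    next
      case False
      then have pos: "infdist x C > 0"
        using C \<open>C \<noteq> {}\<close> by (simp add: infdist_pos_not_in_closed)
      obtain n0 :: nat where n0: "real n0 > 1 / infdist x C" using reals_Archimedean2 by blast
      have "\<forall>\<^sub>F n in sequentially. g n x = 0"
      proof (rule eventually_sequentiallyI)
        fix n assume "n0 \<le> n"
        then have "real n > 1 / infdist x C" using n0 by (smt (verit) of_nat_mono)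
        then show "g n x = 0" using pos by (simp add: g_def field_simps)
      qed
      then show ?thesis using False by (simp add: tendsto_eventually)
    qed
    have convg: "(\<lambda>n. \<integral>x. g n x \<partial>R) \<longlonglongrightarrow> measure R C" if "prob_space R" and s[measurable_cong]: "sets R = sets borel" for R
    proof -
      interpret R: prob_space R by fact
      have "(\<lambda>n. \<integral>x. g n x \<partial>R) \<longlonglongrightarrow> (\<integral>x. indicator C x \<partial>R)"
        by (rule integral_dominated_convergence[where w="\<lambda>_. 1"]) (auto simp: g01 lim)
      then show ?thesis using sets_eq_imp_space_eq[OF s] by simp
    qed
    have "bounded (range (g n))" for n using g01 by (auto simp: bounded_iff intro!: exI[of _ 1])
    then have "(\<integral>x. g n x \<partial>A) = (\<integral>x. g n x \<partial>B)" for n by (intro eq cont)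
    then have "measure A C = measure B C"
      using convg[OF A] convg[OF B] LIMSEQ_unique by fastforce
    then show ?thesis by (simp add: A.emeasure_eq_measure B.emeasure_eq_measure)
  qed simp
qed (use A B in \<open>auto simp: Int_stable_def borel_eq_closed prob_space.emeasure_space_1 sets_eq_imp_space_eq[OF A(2)] prob_space_def finite_measure.emeasure_finite\<close>)

text \<open>The continuity theorem applied to a constant sequence.\<close>

theorem char_eq_imp_measure_eq:
  fixes A B :: "(real^'p) measure"
  assumes A: "prob_space A" "sets A = sets borel" and B: "prob_space B" "sets B = sets borel"
    and eq: "\<And>t. (\<integral>x. iexp (t \<bullet> x) \<partial>A) = (\<integral>x. iexp (t \<bullet> x) \<partial>B)"
  shows "A = B"
proof (rule measure_eqI_integral_continuous[OF A B])
  fix g :: "real^'p \<Rightarrow> real" assume g: "continuous_on UNIV g" "bounded (range g)"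
  have "(\<lambda>n::nat. \<integral>y. g y \<partial>A) \<longlonglongrightarrow> (\<integral>y. g y \<partial>B)"
    by (rule char_conv_imp_integral_conv[OF A B _ g]) (simp add: eq)
  then show "(\<integral>y. g y \<partial>A) = (\<integral>y. g y \<partial>B)" by (simp add: LIMSEQ_const_iff)
qed

theorem conv_in_distr_charI:
  fixes Y :: "nat \<Rightarrow> 'a \<Rightarrow> real^'p"
  assumes M: "prob_space M" and Y [measurable]: "\<And>n. Y n \<in> borel_measurable M"
    and Q: "prob_space Q" "sets Q = sets borel"
    and conv: "\<And>t. (\<lambda>n. \<integral>\<omega>. iexp (t \<bullet> Y n \<omega>) \<partial>M) \<longlonglongrightarrow> (\<integral>x. iexp (t \<bullet> x) \<partial>Q)"
  shows "conv_in_distr M Y Q"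
  unfolding conv_in_distr_def
proof (intro conjI allI impI)
  fix g :: "real^'p \<Rightarrow> real" assume g: "continuous_on UNIV g \<and> bounded (range g)"
  have [measurable]: "g \<in> borel_measurable borel" using g by (auto intro: borel_measurable_continuous_onI)
  have "(\<lambda>n. \<integral>y. g y \<partial>distr M borel (Y n)) \<longlonglongrightarrow> (\<integral>y. g y \<partial>Q)"
    by (rule char_conv_imp_integral_conv)
      (use g conv in \<open>auto simp: integral_distr intro!: prob_space.prob_space_distr[OF M] Q\<close>)
  then show "(\<lambda>n. \<integral>\<omega>. g (Y n \<omega>) \<partial>M) \<longlonglongrightarrow> (\<integral>x. g x \<partial>Q)" by (simp add: integral_distr)
qed (rule Y)

subsection \<open>Spherical laws\<close>

text \<open>The Householder reflection along u. The vector need not be normalized, and u = 0 gives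
  the identity because division by 0 yields 0.\<close>

definition reflection :: "'a::real_inner \<Rightarrow> 'a \<Rightarrow> 'a" where
  "reflection u x = x - (2 * (x \<bullet> u) / (u \<bullet> u)) *\<^sub>R u"

lemma orthogonal_transformation_reflection: "orthogonal_transformation (reflection u)"
  unfolding orthogonal_transformation_def
proof (intro conjI allI)
  show "linear (reflection u)"
    by (rule linearI) (auto simp: reflection_def inner_add_left algebra_simps add_divide_distrib)
  fix x y
  show "reflection u x \<bullet> reflection u y = x \<bullet> y"
    by (cases "u = 0") (auto simp: reflection_def inner_diff_left inner_diff_right field_simps inner_commute)
qed

text \<open>Reflection in the bisector of a and b. This is the transitivity of the orthogonal group
  on spheres, with an explicit map.\<close>

lemma reflection_swap:
  assumes "norm a = norm b" shows "reflection (a - b) a = b"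
proof (cases "a = b")
  case False
  have "2 * (a \<bullet> (a - b)) = (a - b) \<bullet> (a - b)"
    using assms by (simp add: norm_eq inner_diff_left inner_diff_right inner_commute)
  moreover have "(a - b) \<bullet> (a - b) \<noteq> 0" using False by simp
  ultimately show ?thesis by (simp add: reflection_def)
qed (simp add: reflection_def)

lemma norm_reflection [simp]: "norm (reflection u x) = norm x"
  using orthogonal_transformation_reflection by (rule orthogonal_transformation_norm)

lemma borel_measurable_orthogonal_transformation:
  fixes T :: "'a::euclidean_space \<Rightarrow> 'a"
  shows "orthogonal_transformation T \<Longrightarrow> T \<in> borel_measurable borel"
  by (intro borel_measurable_continuous_onI linear_continuous_on)
    (metis linear_conv_bounded_linear orthogonal_transformation_linear)

definition orthogonal_invariant :: "(real^'p) measure \<Rightarrow> bool" where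
  "orthogonal_invariant A \<longleftrightarrow> (\<forall>T. orthogonal_transformation T \<longrightarrow> distr A borel T = A)"

text \<open>The characteristic function depends on t through its norm only, and t . T x = s . x for
  the preimage s of t, which has the same norm.\<close>

lemma orthogonal_invariant_std_mvnormal: "orthogonal_invariant (std_mvnormal :: (real^'p) measure)"
  unfolding orthogonal_invariant_def
proof (intro allI impI char_eq_imp_measure_eq)
  fix T :: "real^'p \<Rightarrow> real^'p" and t :: "real^'p"
  assume T: "orthogonal_transformation T"
  note [measurable] = borel_measurable_orthogonal_transformation[OF T]
  show "prob_space (distr std_mvnormal borel T)"
    by (rule prob_space.prob_space_distr[OF prob_space_std_mvnormal]) measurable
  obtain s where s: "T s = t" using orthogonal_transformation_surj[OF T] by (metis surjD)
  have "t \<bullet> T x = s \<bullet> x" for x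
    using T s unfolding orthogonal_transformation_def by metis
  moreover have "norm t = norm s" using T s orthogonal_transformation_norm by metis
  ultimately show "(\<integral>x. iexp (t \<bullet> x) \<partial>distr std_mvnormal borel T) = (\<integral>x. iexp (t \<bullet> x) \<partial>std_mvnormal)"
    by (simp add: integral_distr char_std_mvnormal)
qed (auto intro: prob_space_std_mvnormal)

lemma orthogonal_invariant_nn_integral:
  assumes "orthogonal_invariant A" "sets A = sets borel" "orthogonal_transformation T"
    and "h \<in> borel_measurable borel"
  shows "(\<integral>\<^sup>+x. h (T x) \<partial>A) = (\<integral>\<^sup>+x. h x \<partial>A)"
proof -
  note [measurable] = borel_measurable_orthogonal_transformation[OF assms(3)] assms(4)
  note [measurable_cong] = assms(2)
  have "(\<integral>\<^sup>+x. h x \<partial>A) = (\<integral>\<^sup>+x. h x \<partial>distr A borel T)"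
    using assms by (simp add: orthogonal_invariant_def)
  also have "\<dots> = (\<integral>\<^sup>+x. h (T x) \<partial>A)" by (rule nn_integral_distr) auto
  finally show ?thesis ..
qed

lemma orthogonal_invariant_density:
  assumes A: "orthogonal_invariant A" "sets A = sets borel" and [measurable]: "k \<in> borel_measurable borel"
  shows "orthogonal_invariant (density A (\<lambda>x. k (norm x)))"
  unfolding orthogonal_invariant_def
proof (intro allI impI measure_eqI)
  fix T :: "real^'a \<Rightarrow> real^'a" and S
  assume T: "orthogonal_transformation T" and "S \<in> sets (distr (density A (\<lambda>x. k (norm x))) borel T)"
  then have [measurable]: "S \<in> sets borel" by simp
  note [measurable] = borel_measurable_orthogonal_transformation[OF T]
  note [measurable_cong] = A(2)
  have TS: "T -` S \<inter> space A \<in> sets A" by measurable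
  have "emeasure (distr (density A (\<lambda>x. k (norm x))) borel T) S =
      (\<integral>\<^sup>+x. k (norm x) * indicator (T -` S \<inter> space A) x \<partial>A)"
    by (subst emeasure_distr, measurable) (simp add: emeasure_density TS space_density)
  also have "\<dots> = (\<integral>\<^sup>+x. k (norm (T x)) * indicator S (T x) \<partial>A)"
    using orthogonal_transformation_norm[OF T]
    by (intro nn_integral_cong) (auto simp: indicator_def)
  also have "\<dots> = (\<integral>\<^sup>+x. k (norm x) * indicator S x \<partial>A)"
    by (rule orthogonal_invariant_nn_integral[OF A T, of "\<lambda>x. k (norm x) * indicator S x"]) measurable
  also have "\<dots> = emeasure (density A (\<lambda>x. k (norm x))) S"
    by (simp add: emeasure_density A(2))
  finally show "emeasure (distr (density A (\<lambda>x. k (norm x))) borel T) S = emeasure (density A (\<lambda>x. k (norm x))) S" .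
qed (simp add: A(2))

text \<open>Lebesgue measure inherits its invariance from the Gaussian measure, whose density is radial and positive.\<close>

lemma orthogonal_invariant_lborel: "orthogonal_invariant (lborel :: (real^'p) measure)"
proof -
  define c where "c = (1 / sqrt (2 * pi)) ^ CARD('p)"
  have c: "c > 0" by (simp add: c_def)
  define k where "k r = ennreal (1 / (c * exp (- r\<^sup>2 / 2)))" for r :: real
  have [measurable]: "k \<in> borel_measurable borel" unfolding k_def by measurable
  have "orthogonal_invariant (density (std_mvnormal :: (real^'p) measure) (\<lambda>x. k (norm x)))"
    by (rule orthogonal_invariant_density[OF orthogonal_invariant_std_mvnormal]) auto
  also have "density (std_mvnormal :: (real^'p) measure) (\<lambda>x. k (norm x)) = lborel"
  proof -
    have "ennreal (c * exp (- r\<^sup>2 / 2)) * k r = 1" for r :: real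
      using c unfolding k_def by (subst ennreal_mult[symmetric]) (auto simp: field_simps)
    then show ?thesis
      unfolding std_mvnormal_def std_mvnormal_density_eq c_def[symmetric]
      by (subst density_density_eq) (auto simp: density_1)
  qed
  finally show ?thesis .
qed

section \<open>Spherical laws are determined by their radial part\<close>

text \<open>The random direction is y / |y| with y drawn from \<open>B\<close> itself, so no uniform
  law on the sphere has to be constructed. That \<open>B\<close> has no atom at 0 makes the
  normalization valid almost surely.\<close>

lemma spherical_measure_unique:
  fixes A B :: "(real^'p) measure"
  assumes A: "prob_space A" "sets A = sets borel" "orthogonal_invariant A" "emeasure A {0} = 0"
    and B: "prob_space B" "sets B = sets borel" "orthogonal_invariant B" "emeasure B {0} = 0"
    and radial: "distr A borel norm = distr B borel norm"
  shows "A = B"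
proof (rule char_eq_imp_measure_eq[OF A(1,2) B(1,2)])
  fix t :: "real^'p"
  obtain i :: 'p where True by simp
  define e where "e = (axis i 1 :: real^'p)"
  have e: "norm e = 1" by (simp add: e_def)
  interpret B: prob_space B by fact
  note [measurable_cong] = B(2)
  have inv: "(\<integral>z. iexp (s \<bullet> z) \<partial>R) = (\<integral>z. iexp (s' \<bullet> z) \<partial>R)"
    if R: "orthogonal_invariant R" and [measurable_cong]: "sets R = sets borel" and "norm s = norm s'"
    for R :: "(real^'p) measure" and s s'
  proof -
    let ?T = "reflection (s' - s)"
    have T: "orthogonal_transformation ?T" by (rule orthogonal_transformation_reflection)
    note [measurable] = borel_measurable_orthogonal_transformation[OF T]
    have "s' \<bullet> z = s \<bullet> ?T z" for z
      using T reflection_swap[of s' s] that(3) unfolding orthogonal_transformation_def by metis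
    then have "(\<integral>z. iexp (s' \<bullet> z) \<partial>R) = (\<integral>z. iexp (s \<bullet> ?T z) \<partial>R)" by simp
    also have "\<dots> = (\<integral>z. iexp (s \<bullet> z) \<partial>distr R borel ?T)" by (subst integral_distr) auto
    finally show ?thesis using R T by (simp add: orthogonal_invariant_def)
  qed
  \<comment> \<open>The characteristic function at r e of the random direction scaled to length |t|.
    The unit vector e is arbitrary because \<open>B\<close> is invariant.\<close>
  define \<kappa> where "\<kappa> r = (\<integral>y. iexp ((r *\<^sub>R e) \<bullet> ((norm t / norm y) *\<^sub>R y)) \<partial>B)" for r :: real
  have *: "(\<integral>z. iexp (t \<bullet> z) \<partial>R) = (\<integral>r. \<kappa> r \<partial>distr R borel norm)"
    if R: "prob_space R" "orthogonal_invariant R" and sR[measurable_cong]: "sets R = sets borel"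
    for R :: "(real^'p) measure"
  proof -
    interpret R: prob_space R by fact
    interpret pair_prob_space R B ..
    have [measurable]: "\<kappa> \<in> borel_measurable borel" unfolding \<kappa>_def by measurable
    have "AE y in B. y \<noteq> 0"
      using B(2,4) by (intro AE_I[of _ _ "{0}"]) (auto)
    \<comment> \<open>Every vector of length |t| gives the same value, so t may be replaced by a
      random one; the order of integration is then exchanged.\<close>
    then have "AE y in B. (\<integral>z. iexp (((norm t / norm y) *\<^sub>R y) \<bullet> z) \<partial>R) = (\<integral>z. iexp (t \<bullet> z) \<partial>R)"
      by eventually_elim (intro inv R sR, auto)
    then have "(\<integral>y. (\<integral>z. iexp (((norm t / norm y) *\<^sub>R y) \<bullet> z) \<partial>R) \<partial>B) = (\<integral>y. (\<integral>z. iexp (t \<bullet> z) \<partial>R) \<partial>B)"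
      by (intro integral_cong_AE) auto
    also have "\<dots> = (\<integral>z. iexp (t \<bullet> z) \<partial>R)" by (simp add: B.prob_space)
    finally have "(\<integral>z. iexp (t \<bullet> z) \<partial>R) = (\<integral>y. (\<integral>z. iexp (((norm t / norm y) *\<^sub>R y) \<bullet> z) \<partial>R) \<partial>B)" ..
    also have "\<dots> = (\<integral>z. (\<integral>y. iexp (((norm t / norm y) *\<^sub>R y) \<bullet> z) \<partial>B) \<partial>R)"
      by (rule Fubini_integral) (rule integrable_const_bound[where B=1], auto simp: case_prod_beta)
    also have "\<dots> = (\<integral>z. \<kappa> (norm z) \<partial>R)"
    proof (intro Bochner_Integration.integral_cong refl)
      fix z :: "real^'p"
      \<comment> \<open>For fixed z, the reflection taking |z| e to z leaves \<open>B\<close>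
        unchanged, so the inner integral depends on |z| only.\<close>
      let ?T = "reflection (norm z *\<^sub>R e - z)"
      have T: "orthogonal_transformation ?T" by (rule orthogonal_transformation_reflection)
      note [measurable] = borel_measurable_orthogonal_transformation[OF T]
      have "z \<bullet> ?T y = (norm z *\<^sub>R e) \<bullet> y" for y
      proof -
        have "?T (norm z *\<^sub>R e) = z" by (rule reflection_swap) (simp add: e)
        then show ?thesis using T unfolding orthogonal_transformation_def by metis
      qed
      then have "\<kappa> (norm z) = (\<integral>y. iexp (z \<bullet> ((norm t / norm (?T y)) *\<^sub>R ?T y)) \<partial>B)"
        by (simp add: \<kappa>_def)
      also have "\<dots> = (\<integral>y. iexp (z \<bullet> ((norm t / norm y) *\<^sub>R y)) \<partial>distr B borel ?T)"
        by (subst integral_distr) auto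
      also have "distr B borel ?T = B" using B(3) T by (simp add: orthogonal_invariant_def)
      finally show "(\<integral>y. iexp (((norm t / norm y) *\<^sub>R y) \<bullet> z) \<partial>B) = \<kappa> (norm z)"
        by (simp add: inner_commute)
    qed
    also have "\<dots> = (\<integral>r. \<kappa> r \<partial>distr R borel norm)" by (subst integral_distr) auto
    finally show ?thesis .
  qed
  show "(\<integral>z. iexp (t \<bullet> z) \<partial>A) = (\<integral>z. iexp (t \<bullet> z) \<partial>B)"
    using *[OF A(1,3,2)] *[OF B(1,3,2)] radial by simp
qed

text \<open>Both measures give \<open>{..t}\<close> the volume of the ball of radius t, on the right
  by the fundamental theorem of calculus, and half-lines determine a measure. This replaces polar
  coordinates for radial integrands.\<close>

lemma distr_norm_lborel:
  "distr (lborel :: (real^'p) measure) borel norm =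
     density lborel (\<lambda>r. ennreal (real CARD('p) * unit_ball_vol (real CARD('p)) * r ^ (CARD('p) - 1)) * indicator {0<..} r)"
  (is "?A = ?B")
proof (rule measure_eqI_generator_eq[where E="range atMost" and \<Omega>=UNIV and A="\<lambda>n. {.. real n}"])
  let ?n = "CARD('p)"
  define \<omega> where "\<omega> = unit_ball_vol (real ?n)"
  have w: "\<omega> \<ge> 0" by (simp add: \<omega>_def)
  have A: "emeasure ?A {..t} = (if t \<ge> 0 then ennreal (\<omega> * t ^ ?n) else 0)" for t
  proof -
    have "emeasure ?A {..t} = emeasure lborel (cball (0 :: real^'p) t)"
      by (subst emeasure_distr) (auto intro!: arg_cong[where f="emeasure lborel"])
    then show ?thesis by (cases "t \<ge> 0") (auto simp: emeasure_cball \<omega>_def)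
  qed
  have B: "emeasure ?B {..t} = (if t \<ge> 0 then ennreal (\<omega> * t ^ ?n) else 0)" for t
  proof (cases "t \<ge> 0")
    case True
    have "emeasure ?B {..t} = (\<integral>\<^sup>+r. ennreal (real ?n * \<omega> * r ^ (?n - 1)) * indicator {0<..} r * indicator {..t} r \<partial>lborel)"
      by (simp add: emeasure_density \<omega>_def)
    also have "\<dots> = (\<integral>\<^sup>+r. ennreal (real ?n * \<omega> * r ^ (?n - 1)) * indicator {0..t} r \<partial>lborel)"
      using AE_lborel_singleton[of "0::real"]
      by (intro nn_integral_cong_AE) (auto elim!: eventually_mono simp: indicator_def)
    also have "\<dots> = ennreal (\<omega> * t ^ ?n - \<omega> * 0 ^ ?n)"
      using True w
      by (intro nn_integral_FTC_Icc[where F="\<lambda>r. \<omega> * r ^ ?n"]) (auto intro!: derivative_eq_intros)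
    finally show ?thesis using True by (simp add: power_0_left)
  next
    case False
    have "emeasure ?B {..t} = (\<integral>\<^sup>+r. ennreal (real ?n * \<omega> * r ^ (?n - 1)) * indicator {0<..} r * indicator {..t} r \<partial>lborel)"
      by (simp add: emeasure_density \<omega>_def)
    also have "\<dots> = (\<integral>\<^sup>+r. 0 \<partial>(lborel :: real measure))"
      by (intro nn_integral_cong) (use False in \<open>auto simp: indicator_def\<close>)
    finally have "emeasure ?B {..t} = (\<integral>\<^sup>+r. 0 \<partial>(lborel :: real measure))" .
    then show ?thesis using False by simp
  qed
  show "emeasure ?A X = emeasure ?B X" if X: "X \<in> range atMost" for X
  proof -
    obtain t where "X = {..t}" using X by auto
    then show ?thesis by (simp only: A B)
  qed
  show "(\<Union>n. {.. real n}) = UNIV" by (auto simp: real_arch_simple)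
  show "emeasure ?A {.. real n} \<noteq> \<infinity>" for n by (simp add: A)
qed (auto simp: Int_stable_def borel_eq_atMost)

lemma nn_integral_radial:
  assumes [measurable]: "h \<in> borel_measurable borel"
  shows "(\<integral>\<^sup>+x. h (norm x) \<partial>(lborel :: (real^'p) measure)) =
    (\<integral>\<^sup>+r. ennreal (real CARD('p) * unit_ball_vol (real CARD('p)) * r ^ (CARD('p) - 1)) * indicator {0<..} r * h r \<partial>lborel)"
proof -
  have "(\<integral>\<^sup>+x. h (norm x) \<partial>(lborel :: (real^'p) measure)) = (\<integral>\<^sup>+r. h r \<partial>distr (lborel :: (real^'p) measure) borel norm)"
    by (simp add: nn_integral_distr)
  then show ?thesis by (simp add: distr_norm_lborel nn_integral_density)
qed

text \<open>The density of the norm divided by the area of the sphere of radius r, as a function of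
  the norm, defines a spherical law with the same radial part;
  \<open>spherical_measure_unique\<close> identifies the two.\<close>

lemma spherical_imp_density:
  fixes Z :: "'a \<Rightarrow> real^'p"
  assumes M: "prob_space M" and Z: "spherical M Z"
    and f: "distributed M lborel (\<lambda>\<omega>. norm (Z \<omega>)) (\<lambda>r. ennreal (f r) * indicator {0<..} r)"
    and pos: "\<And>r. r > 0 \<Longrightarrow> f r > 0"
  shows "(\<lambda>r. f r * indicator {0<..} r) \<in> borel_measurable borel"
    and "distr M borel Z = density lborel (\<lambda>z. ennreal (f (norm z) * indicator {0<..} (norm z) /
       (real CARD('p) * unit_ball_vol (real CARD('p)) * norm z ^ (CARD('p) - 1))))"
proof -
  let ?n = "CARD('p)"
  interpret M: prob_space M by fact
  define F where "F r = f r * indicator {0<..} r" for r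
  have F: "F r \<ge> 0" for r using pos[of r] by (auto simp: F_def indicator_def)
  have eF: "ennreal (f r) * indicator {0<..} r = ennreal (F r)" for r by (auto simp: F_def indicator_def)
  have "(\<lambda>r. ennreal (F r)) \<in> borel_measurable borel"
    using distributed_borel_measurable[OF f] by (simp add: eF)
  \<comment> \<open>The assumption gives measurability of f times the indicator as an extended
    nonnegative function only; \<open>enn2real\<close> recovers the real one.\<close>
  then have "(\<lambda>r. enn2real (ennreal (F r))) \<in> borel_measurable borel" by measurable
  then have [measurable]: "F \<in> borel_measurable borel" using F by simp
  then show "(\<lambda>r. f r * indicator {0<..} r) \<in> borel_measurable borel" by (simp add: F_def[abs_def])
  have [measurable]: "Z \<in> borel_measurable M" using Z by (simp add: spherical_def)
  \<comment> \<open>The surface area of the unit sphere.\<close>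
  define c where "c = real ?n * unit_ball_vol (real ?n)"
  have c: "c > 0" by (simp add: c_def unit_ball_vol_def)
  define k where "k r = ennreal (F r / (c * r ^ (?n - 1)))" for r
  have [measurable]: "k \<in> borel_measurable borel" unfolding k_def by measurable
  let ?B = "density (lborel :: (real^'p) measure) (\<lambda>z. k (norm z))"
  have k_eq: "ennreal (c * r ^ (?n - 1)) * indicator {0<..} r * (k r * g) = ennreal (F r) * g" for r g
  proof (cases "r > 0")
    case True
    then have "ennreal (c * r ^ (?n - 1)) * k r = ennreal (F r)"
      unfolding k_def using c F by (subst ennreal_mult[symmetric]) auto
    then show ?thesis using True by (simp add: mult.assoc[symmetric])
  qed (simp add: F_def)
  have radA: "distr (distr M borel Z) borel norm = density lborel (\<lambda>r. ennreal (F r))"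
    using distributed_distr_eq_density[OF f] by (simp add: distr_distr comp_def eF) (metis distr_cong sets_lborel)
  have radB: "distr ?B borel norm = density lborel (\<lambda>r. ennreal (F r))"
  proof (rule measure_eqI)
    fix S assume "S \<in> sets (distr ?B borel norm)"
    then have [measurable]: "S \<in> sets borel" by simp
    have "emeasure (distr ?B borel norm) S = (\<integral>\<^sup>+r. indicator S r \<partial>distr ?B borel norm)" by simp
    also have "\<dots> = (\<integral>\<^sup>+x. indicator S (norm x) \<partial>?B)" by (rule nn_integral_distr) auto
    also have "\<dots> = (\<integral>\<^sup>+x. k (norm x) * indicator S (norm x) \<partial>(lborel :: (real^'p) measure))"
      by (rule nn_integral_density) auto
    also have "\<dots> = (\<integral>\<^sup>+r. ennreal (F r) * indicator S r \<partial>lborel)"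
      by (subst nn_integral_radial[of "\<lambda>r. k r * indicator S r"], measurable)
        (simp only: c_def[symmetric] k_eq)
    finally show "emeasure (distr ?B borel norm) S = emeasure (density lborel (\<lambda>r. ennreal (F r))) S"
      by (simp add: emeasure_density)
  qed simp
  have "distr M borel Z = ?B"
  proof (rule spherical_measure_unique)
    show pA: "prob_space (distr M borel Z)" by (rule M.prob_space_distr) measurable
    interpret A: prob_space "distr M borel Z" by fact
    have "prob_space (distr ?B borel norm)"
      unfolding radB radA[symmetric] by (rule A.prob_space_distr) measurable
    then show "prob_space ?B" by (rule prob_space_distrD[rotated]) measurable
    show "orthogonal_invariant (distr M borel Z)"
      unfolding orthogonal_invariant_def
    proof (intro allI impI)
      fix T :: "real^'p \<Rightarrow> real^'p" assume T: "orthogonal_transformation T"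
      note [measurable] = borel_measurable_orthogonal_transformation[OF T]
      have "distr M borel (\<lambda>\<omega>. matrix T *v Z \<omega>) = distr M borel Z"
        using Z T by (auto simp: spherical_def orthogonal_transformation_matrix)
      moreover have "matrix T *v z = T z" for z
        using T by (simp add: orthogonal_transformation_linear)
      ultimately show "distr (distr M borel Z) borel T = distr M borel Z"
        by (simp add: distr_distr comp_def)
    qed
    show "orthogonal_invariant ?B" by (rule orthogonal_invariant_density[OF orthogonal_invariant_lborel]) auto
    have "emeasure (distr (distr M borel Z) borel norm) {0} = 0"
    proof -
      have "emeasure (density lborel (\<lambda>r. ennreal (F r))) {0} = (\<integral>\<^sup>+r. ennreal (F r) * indicator {0} r \<partial>lborel)"
        by (simp add: emeasure_density)
      also have "\<dots> = (\<integral>\<^sup>+r. 0 \<partial>(lborel :: real measure))"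
        by (intro nn_integral_cong) (auto simp: F_def indicator_def)
      finally show ?thesis unfolding radA by simp
    qed
    also have "emeasure (distr (distr M borel Z) borel norm) {0} = emeasure (distr M borel Z) {0}"
      by (subst emeasure_distr) (auto intro!: arg_cong[where f="emeasure (distr M borel Z)"])
    finally show "emeasure (distr M borel Z) {0} = 0" .
    have "emeasure ?B {0} = (\<integral>\<^sup>+z. k (norm z) * indicator {0} z \<partial>(lborel :: (real^'p) measure))"
      by (simp add: emeasure_density)
    also have "\<dots> = (\<integral>\<^sup>+z. 0 \<partial>(lborel :: (real^'p) measure))"
      by (intro nn_integral_cong) (auto simp: k_def F_def indicator_def)
    finally show "emeasure ?B {0} = 0" by simp
  qed (auto simp: radA radB)
  then show "distr M borel Z = density lborel (\<lambda>z. ennreal (f (norm z) * indicator {0<..} (norm z) /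
       (real CARD('p) * unit_ball_vol (real CARD('p)) * norm z ^ (CARD('p) - 1))))"
    by (simp add: k_def F_def c_def)
qed

subsection \<open>Elliptical laws\<close>

lemma D1_mult_nth:
  assumes "\<Lambda> = \<sigma> *\<^sub>R (\<chi> i j. if i = j then (if i = k1 then l else 1) else 0)"
  shows "(\<Lambda> *v z) $ i = \<sigma> * (if i = k1 then l else 1) * z $ i"
proof -
  have "(\<Lambda> *v z) $ i = (\<Sum>j\<in>UNIV. \<sigma> * (if i = j then (if i = k1 then l else 1) else 0) * z $ j)"
    by (simp add: assms matrix_vector_mult_def)
  also have "\<dots> = (\<Sum>j\<in>UNIV. if i = j then \<sigma> * (if i = k1 then l else 1) * z $ j else 0)"
    by (rule sum.cong) auto
  finally show ?thesis by simp
qed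

lemma orthogonal_transformation_transpose_mult:
  "orthogonal_matrix U \<Longrightarrow> orthogonal_transformation (\<lambda>x. transpose U *v x)" for U :: "real^'p^'p"
  unfolding orthogonal_transformation_matrix
  by (metis matrix_of_matrix_vector_mul matrix_vector_mul_linear orthogonal_matrix_transpose)

lemma transpose_mult_nth: "(transpose U *v x) $ k = x \<bullet> column k U" for U :: "real^'p^'p"
  by (simp add: matrix_vector_mult_def transpose_def column_def inner_vec_def mult.commute)

text \<open>For x = U \<Lambda> z, \<sigma>^2 |z|^2 equals |x|^2 minus (1 - 1/l^2) times the squared
  component of x along the leading column. Hence a = 1 - 1/l^2, while scale and determinant go into
  \<kappa>. The later argument uses the law through this density and a second moment.\<close>

lemma elliptical_rep_density:
  fixes Z :: "'a \<Rightarrow> real^'p"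
  assumes rep: "elliptical_rep k1 U \<Lambda> P M Z f"
  obtains a \<kappa> where "0 < a" "a < 1" "\<kappa> \<in> borel_measurable borel" "\<And>r. r > 0 \<Longrightarrow> \<kappa> r > 0"
    "strict_antimono_on {0<..} \<kappa>"
    "P = density lborel (\<lambda>x. ennreal (\<kappa> (sqrt ((norm x)\<^sup>2 - a * (x \<bullet> column k1 U)\<^sup>2))))"
proof -
  let ?n = "CARD('p)"
  have U: "orthogonal_matrix U" and "\<Lambda> \<in> D1 k1" and M: "prob_space M" and Z: "spherical M Z"
    and f: "distributed M lborel (\<lambda>\<omega>. norm (Z \<omega>)) (\<lambda>r. ennreal (f r) * indicator {0<..} r)"
    and pos: "\<And>r. r > 0 \<Longrightarrow> f r > 0"
    and anti: "strict_antimono_on {0<..} (\<lambda>r. f r / r ^ (?n - 1))"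
    and P: "P = distr M borel (\<lambda>\<omega>. (U ** \<Lambda>) *v Z \<omega>)"
    using rep by (auto simp: elliptical_rep_def)
  then obtain \<sigma> l where sl: "\<sigma> > 0" "l > 1"
    and L: "\<Lambda> = \<sigma> *\<^sub>R (\<chi> i j. if i = j then (if i = k1 then l else 1) else 0)"
    by (auto simp: D1_def)
  have [measurable]: "Z \<in> borel_measurable M" using Z by (simp add: spherical_def)
  define a where "a = 1 - 1 / l\<^sup>2"
  have "l\<^sup>2 > 1" using sl by simp
  then have "1 / l\<^sup>2 < 1" using sl by (subst divide_less_eq_1_pos) simp_all
  moreover have "1 / l\<^sup>2 > 0" using sl by simp
  ultimately have a: "0 < a" "a < 1" by (simp_all add: a_def)
  define F where "F r = f r * indicator {0<..} r" for r
  define c where "c = real ?n * unit_ball_vol (real ?n)"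
  have c: "c > 0" by (simp add: c_def unit_ball_vol_def)
  define K where "K r = F r / (c * r ^ (?n - 1))" for r
  have [measurable]: "F \<in> borel_measurable borel"
    unfolding F_def[abs_def] by (rule spherical_imp_density(1)[OF M Z f pos])
  have [measurable]: "K \<in> borel_measurable borel" unfolding K_def by measurable
  have distrZ: "distr M borel Z = density lborel (\<lambda>z. ennreal (K (norm z)))"
    using spherical_imp_density(2)[OF M Z f pos] by (simp add: K_def F_def c_def)
  \<comment> \<open>The diagonal entry of \<Lambda> along the basis vector j, in the coordinatewise
    form in which Lebesgue measure is transformed; \<open>C\<close> is the determinant.\<close>
  define cc where "cc j = \<sigma> * (if j = axis k1 1 then l else 1)" for j :: "real^'p"
  define C where "C = (\<Prod>j\<in>Basis. \<bar>cc j\<bar>)"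
  have cc: "cc j > 0" for j using sl by (simp add: cc_def)
  have C: "C > 0" unfolding C_def by (intro prod_pos) (use cc in \<open>auto simp: less_imp_neq[symmetric]\<close>)
  have T_eq: "0 + (\<Sum>j\<in>Basis. (cc j * (x \<bullet> j)) *\<^sub>R j) = \<Lambda> *v x" for x
  proof (rule euclidean_eqI)
    fix b :: "real^'p" assume b: "b \<in> Basis"
    then obtain i where bi: "b = axis i 1" by (auto simp: Basis_vec_def)
    have "(\<Lambda> *v x) \<bullet> b = cc b * (x \<bullet> b)"
      by (simp add: bi D1_mult_nth[OF L] cc_def inner_axis axis_eq_axis)
    then show "(0 + (\<Sum>j\<in>Basis. (cc j * (x \<bullet> j)) *\<^sub>R j)) \<bullet> b = (\<Lambda> *v x) \<bullet> b"
      using b by (simp only: add_0 inner_sum_left_Basis)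
  qed
  have lam: "lborel = density (distr lborel borel (\<lambda>x. \<Lambda> *v x)) (\<lambda>_. ennreal C)"
  proof -
    have "lborel = density (distr lborel borel (\<lambda>x. 0 + (\<Sum>j\<in>Basis. (cc j * (x \<bullet> j)) *\<^sub>R j))) (\<lambda>_. \<Prod>j\<in>Basis. \<bar>cc j\<bar>)"
      by (rule lborel_affine_euclidean) (use cc in \<open>simp add: less_imp_neq[symmetric]\<close>)
    then show ?thesis unfolding T_eq C_def .
  qed
  have [measurable]: "(\<lambda>x. \<Lambda> *v x) \<in> borel_measurable borel" "(\<lambda>x. U *v x) \<in> borel_measurable borel"
    by (auto intro!: borel_measurable_continuous_onI linear_continuous_on)
  have nn: "(\<integral>\<^sup>+z. h (\<Lambda> *v z) \<partial>lborel) = ennreal (1 / C) * (\<integral>\<^sup>+y. h y \<partial>lborel)"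
    if [measurable]: "h \<in> borel_measurable borel" for h :: "real^'p \<Rightarrow> ennreal"
  proof -
    have "(\<integral>\<^sup>+y. h y \<partial>lborel) = (\<integral>\<^sup>+y. h y \<partial>density (distr lborel borel (\<lambda>x. \<Lambda> *v x)) (\<lambda>_. ennreal C))"
      using lam by simp
    also have "\<dots> = ennreal C * (\<integral>\<^sup>+z. h (\<Lambda> *v z) \<partial>lborel)"
      by (simp add: nn_integral_density nn_integral_distr nn_integral_cmult)
    finally have "ennreal (1 / C) * (\<integral>\<^sup>+y. h y \<partial>lborel) = (ennreal (1 / C) * ennreal C) * (\<integral>\<^sup>+z. h (\<Lambda> *v z) \<partial>lborel)"
      by (simp add: mult.assoc)
    also have "ennreal (1 / C) * ennreal C = 1" using C by (simp add: ennreal_mult[symmetric])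
    finally show ?thesis by simp
  qed
  define W where "W y = sqrt ((norm y)\<^sup>2 - a * (y $ k1)\<^sup>2)" for y :: "real^'p"
  have norm_z: "norm z = W (\<Lambda> *v z) / \<sigma>" for z
  proof -
    have sq: "(norm y)\<^sup>2 = (\<Sum>i\<in>UNIV. (y $ i)\<^sup>2)" for y :: "real^'p"
      by (simp add: norm_vec_def L2_set_def sum_nonneg)
    have "(norm (\<Lambda> *v z))\<^sup>2 - a * ((\<Lambda> *v z) $ k1)\<^sup>2 =
        (\<Sum>i\<in>UNIV. ((\<Lambda> *v z) $ i)\<^sup>2 - (if i = k1 then a * ((\<Lambda> *v z) $ i)\<^sup>2 else 0))"
      by (simp add: sq sum_subtractf)
    also have "\<dots> = (\<Sum>i\<in>UNIV. \<sigma>\<^sup>2 * (z $ i)\<^sup>2)"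
      using sl by (intro sum.cong refl) (simp add: D1_mult_nth[OF L] a_def power_mult_distrib field_simps)
    also have "\<dots> = (\<sigma> * norm z)\<^sup>2" by (simp add: sq power_mult_distrib sum_distrib_left)
    finally show ?thesis using sl by (simp add: W_def)
  qed
  define \<kappa> where "\<kappa> s = 1 / C * K (s / \<sigma>)" for s
  have [measurable]: "\<kappa> \<in> borel_measurable borel" unfolding \<kappa>_def by measurable
  have UT: "orthogonal_transformation (\<lambda>x. transpose U *v x)"
    by (rule orthogonal_transformation_transpose_mult[OF U])
  have U_inv: "U *v (transpose U *v x) = x" for x
    using U unfolding orthogonal_matrix_def matrix_vector_mul_assoc by simp
  let ?D = "density lborel (\<lambda>x. ennreal (\<kappa> (sqrt ((norm x)\<^sup>2 - a * (x \<bullet> column k1 U)\<^sup>2))))"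
  have P_eq: "P = ?D"
  proof (rule measure_eqI)
    fix S assume "S \<in> sets P"
    then have [measurable]: "S \<in> sets borel" by (simp add: P)
    have [measurable]: "W \<in> borel_measurable borel" unfolding W_def by measurable
    have "P = distr (distr M borel Z) borel (\<lambda>z. U *v (\<Lambda> *v z))"
      unfolding P by (subst distr_distr, measurable) (simp add: comp_def matrix_vector_mul_assoc)
    then have "emeasure P S = (\<integral>\<^sup>+x. indicator S x \<partial>distr (density lborel (\<lambda>z. ennreal (K (norm z)))) borel (\<lambda>z. U *v (\<Lambda> *v z)))"
      by (simp add: distrZ)
    also have "\<dots> = (\<integral>\<^sup>+z. ennreal (K (norm z)) * indicator S (U *v (\<Lambda> *v z)) \<partial>lborel)"
      by (subst nn_integral_distr, measurable) (simp add: nn_integral_density)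
    also have "\<dots> = (\<integral>\<^sup>+z. ennreal (K (W (\<Lambda> *v z) / \<sigma>)) * indicator S (U *v (\<Lambda> *v z)) \<partial>lborel)"
      by (simp only: norm_z[symmetric])
    also have "\<dots> = ennreal (1 / C) * (\<integral>\<^sup>+y. ennreal (K (W y / \<sigma>)) * indicator S (U *v y) \<partial>lborel)"
      by (rule nn[of "\<lambda>y. ennreal (K (W y / \<sigma>)) * indicator S (U *v y)"]) measurable
    also have "(\<integral>\<^sup>+y. ennreal (K (W y / \<sigma>)) * indicator S (U *v y) \<partial>lborel) =
        (\<integral>\<^sup>+x. ennreal (K (W (transpose U *v x) / \<sigma>)) * indicator S (U *v (transpose U *v x)) \<partial>lborel)"
      by (rule orthogonal_invariant_nn_integral[OF orthogonal_invariant_lborel _ UT, symmetric]) auto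
    also have "ennreal (1 / C) * \<dots> = (\<integral>\<^sup>+x. ennreal (1 / C) * (ennreal (K (W (transpose U *v x) / \<sigma>)) * indicator S x) \<partial>lborel)"
      unfolding U_inv using borel_measurable_orthogonal_transformation[OF UT]
      by (subst nn_integral_cmult) auto
    also have "\<dots> = (\<integral>\<^sup>+x. ennreal (\<kappa> (sqrt ((norm x)\<^sup>2 - a * (x \<bullet> column k1 U)\<^sup>2))) * indicator S x \<partial>lborel)"
    proof (intro nn_integral_cong)
      fix x
      have "W (transpose U *v x) = sqrt ((norm x)\<^sup>2 - a * (x \<bullet> column k1 U)\<^sup>2)"
        unfolding W_def transpose_mult_nth orthogonal_transformation_norm[OF UT] ..
      moreover have "ennreal (1 / C) * ennreal t = ennreal (1 / C * t)" for t
        using C by (simp add: ennreal_mult'[symmetric])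
      ultimately show "ennreal (1 / C) * (ennreal (K (W (transpose U *v x) / \<sigma>)) * indicator S x) =
          ennreal (\<kappa> (sqrt ((norm x)\<^sup>2 - a * (x \<bullet> column k1 U)\<^sup>2))) * indicator S x"
        by (simp only: \<kappa>_def mult.assoc[symmetric])
    qed
    finally show "emeasure P S = emeasure ?D S" by (simp add: emeasure_density)
  qed (simp add: P)
  have \<kappa>_pos: "\<kappa> r > 0" if "r > 0" for r
    using that C sl c pos[of "r / \<sigma>"] by (simp add: \<kappa>_def K_def F_def)
  have \<kappa>_anti: "strict_antimono_on {0<..} \<kappa>"
  proof (rule monotone_onI)
    fix r s :: real assume rs: "r \<in> {0<..}" "s \<in> {0<..}" "r < s"
    have K: "K r = f r / r ^ (?n - 1) / c" if "r > 0" for r using that by (simp add: K_def F_def)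
    have "r / \<sigma> > 0" "s / \<sigma> > 0" "r / \<sigma> < s / \<sigma>" using rs sl by (auto simp: divide_strict_right_mono)
    moreover from this have "f (s / \<sigma>) / (s / \<sigma>) ^ (?n - 1) < f (r / \<sigma>) / (r / \<sigma>) ^ (?n - 1)"
      using monotone_onD[OF anti, of "r / \<sigma>" "s / \<sigma>"] by simp
    ultimately have "K (r / \<sigma>) > K (s / \<sigma>)"
      using c by (simp only: K divide_strict_right_mono)
    then show "\<kappa> r > \<kappa> s" using C by (simp add: \<kappa>_def divide_strict_right_mono)
  qed
  show thesis by (rule that[OF a _ \<kappa>_pos \<kappa>_anti P_eq]) measurable
qed

text \<open>Reflections exchanging two axes show that all coordinates of Z have the same law, so the
  second moment of one coordinate gives that of |Z|, and a linear map preserves it.\<close>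

lemma elliptical_rep_second_moment:
  fixes Z :: "'a \<Rightarrow> real^'p"
  assumes rep: "elliptical_rep k1 U \<Lambda> P M Z f" and int: "integrable M (\<lambda>\<omega>. (Z \<omega> $ k1)\<^sup>2)"
  shows "integrable P (\<lambda>x. (norm x)\<^sup>2)"
proof -
  have U: "orthogonal_matrix U" and "\<Lambda> \<in> D1 k1" and Z: "spherical M Z"
    and P: "P = distr M borel (\<lambda>\<omega>. (U ** \<Lambda>) *v Z \<omega>)"
    using rep by (auto simp: elliptical_rep_def)
  have [measurable]: "Z \<in> borel_measurable M" using Z by (simp add: spherical_def)
  have Zi: "integrable M (\<lambda>\<omega>. (Z \<omega> $ i)\<^sup>2)" for i
  proof -
    let ?T = "reflection (axis i 1 - axis k1 1) :: real^'p \<Rightarrow> real^'p"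
    have T: "orthogonal_transformation ?T" by (rule orthogonal_transformation_reflection)
    note [measurable] = borel_measurable_orthogonal_transformation[OF T]
    have mT: "matrix ?T *v z = ?T z" for z using T by (simp add: orthogonal_transformation_linear)
    have "distr M borel (\<lambda>\<omega>. matrix ?T *v Z \<omega>) = distr M borel Z"
      using Z T by (auto simp: spherical_def orthogonal_transformation_matrix)
    then have d: "distr M borel (\<lambda>\<omega>. ?T (Z \<omega>)) = distr M borel Z" by (simp add: mT)
    have "?T (axis i 1) = axis k1 1" by (rule reflection_swap) simp
    then have "axis i 1 \<bullet> z = axis k1 1 \<bullet> ?T z" for z
      using T unfolding orthogonal_transformation_def by metis
    then have Tz: "z $ i = ?T z $ k1" for z unfolding inner_axis' by simp
    have "integrable M (\<lambda>\<omega>. (Z \<omega> $ i)\<^sup>2) \<longleftrightarrow> integrable (distr M borel (\<lambda>\<omega>. ?T (Z \<omega>))) (\<lambda>z. (z $ k1)\<^sup>2)"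
      by (subst integrable_distr_eq) (auto simp: Tz[symmetric])
    also have "\<dots> \<longleftrightarrow> integrable M (\<lambda>\<omega>. (Z \<omega> $ k1)\<^sup>2)"
      unfolding d by (subst integrable_distr_eq) auto
    finally show ?thesis using int by simp
  qed
  have sq: "(norm y)\<^sup>2 = (\<Sum>i\<in>UNIV. (y $ i)\<^sup>2)" for y :: "real^'p"
    by (simp add: norm_vec_def L2_set_def sum_nonneg)
  have Z2: "integrable M (\<lambda>\<omega>. (norm (Z \<omega>))\<^sup>2)" unfolding sq by (intro Bochner_Integration.integrable_sum Zi)
  obtain B where B: "\<And>z. norm ((U ** \<Lambda>) *v z) \<le> norm z * B" "B > 0"
    using bounded_linear.pos_bounded[OF matrix_vector_mul_bounded_linear] by blast
  have [measurable]: "(\<lambda>x. (U ** \<Lambda>) *v x) \<in> borel_measurable borel"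
    by (auto intro!: borel_measurable_continuous_onI linear_continuous_on)
  have "integrable M (\<lambda>\<omega>. (norm ((U ** \<Lambda>) *v Z \<omega>))\<^sup>2)"
  proof (rule Bochner_Integration.integrable_bound)
    show "integrable M (\<lambda>\<omega>. B\<^sup>2 * (norm (Z \<omega>))\<^sup>2)" using Z2 by simp
    show "AE \<omega> in M. norm ((norm ((U ** \<Lambda>) *v Z \<omega>))\<^sup>2) \<le> norm (B\<^sup>2 * (norm (Z \<omega>))\<^sup>2)"
    proof (rule AE_I2)
      fix \<omega>
      have "(norm ((U ** \<Lambda>) *v Z \<omega>))\<^sup>2 \<le> (norm (Z \<omega>) * B)\<^sup>2" by (intro power_mono B) auto
      then show "norm ((norm ((U ** \<Lambda>) *v Z \<omega>))\<^sup>2) \<le> norm (B\<^sup>2 * (norm (Z \<omega>))\<^sup>2)"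
        by (simp add: power_mult_distrib mult.commute)
    qed
  qed measurable
  then show ?thesis unfolding P by (subst integrable_distr_eq) auto
qed

subsection \<open>The loss function\<close>

text \<open>As a function of x, its level sets in the plane are the Cassini ovals with foci v and
  -v.\<close>

definition nprod :: "'a::real_inner \<Rightarrow> 'a \<Rightarrow> real" where
  "nprod v x = norm (x - v) * norm (x + v)"

text \<open>The gradient of the loss in v away from x = v and x = -v. At those two points
  \<open>nprod\<close> is 0 and the division makes the score 0, an arbitrary value on a null
  set.\<close>

definition score :: "'a::real_inner \<Rightarrow> 'a \<Rightarrow> 'a" where
  "score v x = (1 / nprod v x) *\<^sub>R (2 *\<^sub>R (((norm x)\<^sup>2 + (norm v)\<^sup>2) *\<^sub>R v - (2 * (x \<bullet> v)) *\<^sub>R x))"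

text \<open>The second derivative of the loss in v as a bilinear form. With s for
  \<open>nprod\<close>, s times the second derivative of s is half that of s^2 minus the product of
  the first derivatives, and s^2 is a polynomial.\<close>

definition hess :: "'a::real_inner \<Rightarrow> 'a \<Rightarrow> 'a \<Rightarrow> 'a \<Rightarrow> real" where
  "hess v x u w = (4 * (v \<bullet> u) * (v \<bullet> w) + 2 * ((norm x)\<^sup>2 + (norm v)\<^sup>2) * (u \<bullet> w)
     - 4 * (x \<bullet> u) * (x \<bullet> w) - (score v x \<bullet> u) * (score v x \<bullet> w)) / nprod v x"

lemma nprod_nonneg [simp]: "nprod v x \<ge> 0"
  by (simp add: nprod_def)

lemma nprod_pos_iff: "nprod v x > 0 \<longleftrightarrow> x \<noteq> v \<and> x \<noteq> - v"
  by (auto simp: nprod_def zero_less_mult_iff add_eq_0_iff)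

lemma loss_nprod: "loss v x = nprod v x - (norm x)\<^sup>2"
  by (simp add: loss_def nprod_def)

lemma nprod_sq: "(nprod v x)\<^sup>2 = ((norm x)\<^sup>2 + (norm v)\<^sup>2)\<^sup>2 - 4 * (x \<bullet> v)\<^sup>2"
proof -
  have "(norm (x - v))\<^sup>2 = (norm x)\<^sup>2 + (norm v)\<^sup>2 - 2 * (x \<bullet> v)"
    by (simp add: power2_norm_eq_inner inner_diff_left inner_diff_right inner_commute)
  moreover have "(norm (x + v))\<^sup>2 = (norm x)\<^sup>2 + (norm v)\<^sup>2 + 2 * (x \<bullet> v)"
    by (simp add: power2_norm_eq_inner inner_add_left inner_add_right inner_commute)
  moreover have "(nprod v x)\<^sup>2 = (norm (x - v))\<^sup>2 * (norm (x + v))\<^sup>2"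
    by (simp add: nprod_def power_mult_distrib)
  ultimately have "(nprod v x)\<^sup>2 = ((norm x)\<^sup>2 + (norm v)\<^sup>2 - 2 * (x \<bullet> v)) * ((norm x)\<^sup>2 + (norm v)\<^sup>2 + 2 * (x \<bullet> v))"
    by simp
  then show ?thesis by (simp add: power2_eq_square algebra_simps)
qed

lemma nprod_minus [simp]: "nprod (- v) x = nprod v x" "nprod v (- x) = nprod v x"
  by (auto simp: nprod_def norm_minus_commute mult.commute)
     (metis add.commute minus_diff_eq minus_minus diff_minus_eq_add norm_minus_cancel)

lemma loss_minus [simp]: "loss (- v) x = loss v x"
  by (simp add: loss_nprod)

text \<open>The square of \<open>nprod\<close> lies between (|x|^2 - |v|^2)^2, by Cauchy-Schwarz,
  and (|x|^2 + |v|^2)^2. The bound does not depend on x.\<close>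

lemma abs_loss_le: "\<bar>loss v x\<bar> \<le> (norm v)\<^sup>2"
proof -
  have "nprod v x \<le> (norm x)\<^sup>2 + (norm v)\<^sup>2"
    by (rule power2_le_imp_le) (simp_all add: nprod_sq)
  moreover have "\<bar>(norm x)\<^sup>2 - (norm v)\<^sup>2\<bar> \<le> nprod v x"
  proof (rule power2_le_imp_le)
    have "(x \<bullet> v)\<^sup>2 \<le> (norm x)\<^sup>2 * (norm v)\<^sup>2"
      using Cauchy_Schwarz_ineq[of x v] by (simp add: power2_norm_eq_inner)
    moreover have "\<bar>A - B\<bar>\<^sup>2 = (A + B)\<^sup>2 - 4 * (A * B)" for A B :: real
      by (simp add: power2_eq_square algebra_simps)
    ultimately show "\<bar>(norm x)\<^sup>2 - (norm v)\<^sup>2\<bar>\<^sup>2 \<le> (nprod v x)\<^sup>2"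
      unfolding nprod_sq by simp
  qed simp
  ultimately show ?thesis by (simp add: loss_nprod)
qed

text \<open>For x in a fixed ball the loss grows like |v|^2. Against it stands the bound -|v|^2 for
  the other observations, hence the need for a majority inside the ball.\<close>

lemma loss_lower: "loss v x \<ge> (norm v)\<^sup>2 - 2 * norm v * norm x"
proof -
  have a: "norm (x - v) \<ge> \<bar>norm x - norm v\<bar>" by (rule norm_triangle_ineq3)
  have b: "norm (x + v) \<ge> \<bar>norm x - norm v\<bar>" using norm_triangle_ineq3[of x "- v"] by simp
  have "nprod v x \<ge> \<bar>norm x - norm v\<bar> * \<bar>norm x - norm v\<bar>"
    unfolding nprod_def using a b by (intro mult_mono) auto
  also have "\<bar>norm x - norm v\<bar> * \<bar>norm x - norm v\<bar> = (norm x)\<^sup>2 + (norm v)\<^sup>2 - 2 * norm v * norm x"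
    by (simp add: power2_eq_square algebra_simps)
  finally show ?thesis by (simp add: loss_nprod)
qed

lemma nprod_lipschitz: "\<bar>nprod (v + h) x - nprod v x\<bar> \<le> norm h * (2 * norm x + 2 * norm v + norm h)"
proof -
  let ?a = "norm (x - v)" and ?b = "norm (x + v)" and ?a' = "norm (x - (v + h))" and ?b' = "norm (x + (v + h))"
  have "\<bar>?a' - ?a\<bar> \<le> norm h" using norm_triangle_ineq3[of "x - (v + h)" "x - v"] by simp
  moreover have "\<bar>?b' - ?b\<bar> \<le> norm h" using norm_triangle_ineq3[of "x + (v + h)" "x + v"] by simp
  moreover have "?b' \<le> norm x + norm v + norm h"
    by (metis add.assoc norm_triangle_le order_refl add_mono)
  moreover have "?a \<le> norm x + norm v" by (rule norm_triangle_ineq4)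
  moreover have "nprod (v + h) x - nprod v x = (?a' - ?a) * ?b' + ?a * (?b' - ?b)"
    by (simp add: nprod_def algebra_simps)
  ultimately have "\<bar>nprod (v + h) x - nprod v x\<bar> \<le> norm h * (norm x + norm v + norm h) + (norm x + norm v) * norm h"
    by (auto intro!: order_trans[OF abs_triangle_ineq] add_mono mult_mono simp: abs_mult)
  then show ?thesis by (simp add: algebra_simps)
qed

lemma loss_lipschitz: "\<bar>loss w x - loss v x\<bar> \<le> norm (w - v) * (2 * norm x + 2 * norm v + norm (w - v))"
  using nprod_lipschitz[of v "w - v" x] by (simp add: loss_nprod)

lemma score_inner_mult: "nprod v x > 0 \<Longrightarrow>
   nprod v x * (score v x \<bullet> h) = 2 * (((norm x)\<^sup>2 + (norm v)\<^sup>2) * (v \<bullet> h) - 2 * (x \<bullet> v) * (x \<bullet> h))"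
  by (simp add: score_def inner_diff_left)

text \<open>Up to the factor 2 the numerator of the score has length \<open>nprod\<close> times |v|,
  so the singular denominator cancels exactly and the score stays bounded across the kinks.\<close>

lemma norm_score: "nprod v x > 0 \<Longrightarrow> norm (score v x) = 2 * norm v"
proof -
  assume s: "nprod v x > 0"
  let ?N = "(norm x)\<^sup>2 + (norm v)\<^sup>2" and ?y = "x \<bullet> v"
  have gen: "(norm (\<alpha> *\<^sub>R v - \<beta> *\<^sub>R x))\<^sup>2 = \<alpha>\<^sup>2 * (norm v)\<^sup>2 - 2 * \<alpha> * \<beta> * (x \<bullet> v) + \<beta>\<^sup>2 * (norm x)\<^sup>2" for \<alpha> \<beta>
    unfolding power2_norm_eq_inner
    by (simp add: inner_diff_left inner_diff_right inner_commute power2_eq_square algebra_simps)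
  have "(norm (?N *\<^sub>R v - (2 * ?y) *\<^sub>R x))\<^sup>2 = (nprod v x * norm v)\<^sup>2"
    unfolding power_mult_distrib nprod_sq gen by (simp add: power2_eq_square algebra_simps)
  then have "norm (?N *\<^sub>R v - (2 * ?y) *\<^sub>R x) = nprod v x * norm v"
    using s by (simp add: power2_eq_iff_nonneg)
  then show ?thesis using s by (simp add: score_def)
qed

lemma norm_score_le: "norm (score v x) \<le> 2 * norm v"
proof (cases "nprod v x > 0")
  case False
  then have "nprod v x = 0" by (simp add: not_less antisym)
  then show ?thesis by (simp add: score_def)
qed (simp add: norm_score)

text \<open>Exact, because the square of \<open>nprod\<close> is a polynomial in v. The terms are
  grouped by degree in h, and the linear one is expressed by the score.\<close>

lemma nprod_increment_sq:
  assumes "nprod v x > 0"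
  shows "(nprod (v + h) x)\<^sup>2 = (nprod v x)\<^sup>2 + 2 * nprod v x * (score v x \<bullet> h)
     + (4 * (v \<bullet> h)\<^sup>2 + 2 * ((norm x)\<^sup>2 + (norm v)\<^sup>2) * (norm h)\<^sup>2 - 4 * (x \<bullet> h)\<^sup>2)
     + (4 * (v \<bullet> h) * (norm h)\<^sup>2 + (norm h)^4)"
proof -
  have "(norm (v + h))\<^sup>2 = (norm v)\<^sup>2 + 2 * (v \<bullet> h) + (norm h)\<^sup>2"
    by (simp add: power2_norm_eq_inner inner_add_left inner_add_right inner_commute)
  moreover have "2 * nprod v x * (score v x \<bullet> h) =
      4 * (((norm x)\<^sup>2 + (norm v)\<^sup>2) * (v \<bullet> h) - 2 * (x \<bullet> v) * (x \<bullet> h))"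
    using score_inner_mult[OF assms, of h] by simp
  ultimately show ?thesis
    unfolding nprod_sq by (simp add: inner_add_right power2_eq_square power4_eq_xxxx algebra_simps)
qed

text \<open>Writing \<open>s'\<close> and \<open>s\<close> for the two values of \<^const>\<open>nprod\<close> and \<open>\<delta> = s' - s\<close>, the identity
  \<open>\<delta> (2 s + \<delta>) = s'\<^sup>2 - s\<^sup>2\<close>, whose right-hand side is a polynomial in \<open>h\<close>, replaces the
  differential calculus.\<close>

lemma
  fixes h :: "real^'p"
  assumes s: "nprod v x > 0" and h: "norm h \<le> 1"
  defines "T \<equiv> 2 * norm x + 2 * norm v + 1"
  shows loss_remainder_bound:
      "\<bar>loss (v + h) x - loss v x - score v x \<bullet> h\<bar> \<le> (norm h)\<^sup>2 * (2 * T\<^sup>2 / nprod v x)" (is ?A)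
    and hess_bound: "\<bar>hess v x h h / 2\<bar> \<le> (norm h)\<^sup>2 * (2 * T\<^sup>2 / nprod v x)" (is ?B)
    and loss_remainder_cubic: "\<bar>loss (v + h) x - loss v x - score v x \<bullet> h - hess v x h h / 2\<bar> \<le>
        (norm h)^3 * (T\<^sup>2 / nprod v x + 2 * T^3 / (nprod v x)\<^sup>2)" (is ?C)
proof -
  let ?s = "nprod v x" and ?\<delta> = "nprod (v + h) x - nprod v x" and ?g = "score v x \<bullet> h"
  define D2 where "D2 = 4 * (v \<bullet> h)\<^sup>2 + 2 * ((norm x)\<^sup>2 + (norm v)\<^sup>2) * (norm h)\<^sup>2 - 4 * (x \<bullet> h)\<^sup>2"
  define D3 where "D3 = 4 * (v \<bullet> h) * (norm h)\<^sup>2 + (norm h)^4"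
  define H where "H = norm h"
  define r where "r = ?\<delta> - ?g"
  have H: "0 \<le> H" "H \<le> 1" using h by (auto simp: H_def)
  have T: "T \<ge> 1" by (simp add: T_def)
  \<comment> \<open>The identity is solved for the remainder r: moving \<delta>^2 to the right
    leaves 2 s r = D2 + D3 - \<delta>^2.\<close>
  have r_eq: "r = (D2 + D3 - ?\<delta>\<^sup>2) / (2 * ?s)"
  proof -
    have "?\<delta> * (2 * ?s + ?\<delta>) = 2 * ?s * ?g + D2 + D3"
      using nprod_increment_sq[OF s, of h] by (simp add: D2_def D3_def power2_eq_square algebra_simps)
    then have "2 * ?s * r = D2 + D3 - ?\<delta>\<^sup>2"
      by (simp add: r_def power2_eq_square algebra_simps)
    then show ?thesis using s by (simp add: field_simps)
  qed
  have hess_eq: "hess v x h h / 2 = (D2 - ?g\<^sup>2) / (2 * ?s)"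
    using s by (simp add: hess_def D2_def dot_square_norm power2_eq_square mult_ac)
  have vh: "\<bar>v \<bullet> h\<bar> \<le> norm v * H" and xh: "\<bar>x \<bullet> h\<bar> \<le> norm x * H"
    by (simp_all add: H_def Cauchy_Schwarz_ineq2)
  have vh2: "(v \<bullet> h)\<^sup>2 \<le> (norm v)\<^sup>2 * H\<^sup>2" and xh2: "(x \<bullet> h)\<^sup>2 \<le> (norm x)\<^sup>2 * H\<^sup>2"
    using power_mono[OF vh, of 2] power_mono[OF xh, of 2] by (simp_all add: power_mult_distrib)
  have g: "\<bar>?g\<bar> \<le> 2 * norm v * H"
    using Cauchy_Schwarz_ineq2[of "score v x" h] norm_score[OF s] by (simp add: H_def)
  have g2: "?g\<^sup>2 \<le> 4 * (norm v)\<^sup>2 * H\<^sup>2"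
    using power_mono[OF g, of 2] by (simp add: power_mult_distrib)
  have d: "\<bar>?\<delta>\<bar> \<le> T * H"
  proof -
    have "\<bar>?\<delta>\<bar> \<le> H * (2 * norm x + 2 * norm v + H)" using nprod_lipschitz[of v h x] by (simp add: H_def)
    also have "\<dots> \<le> H * T" using H by (intro mult_left_mono) (auto simp: T_def)
    finally show ?thesis by (simp add: mult.commute)
  qed
  have d2: "?\<delta>\<^sup>2 \<le> T\<^sup>2 * H\<^sup>2" using power_mono[OF d, of 2] by (simp add: power_mult_distrib)
  \<comment> \<open>T is made large enough for multiples of its square to absorb every polynomial in
    |x| and |v| that occurs below.\<close>
  have T2: "T\<^sup>2 \<ge> 4 * (norm x)\<^sup>2 + 4 * (norm v)\<^sup>2 + 4 * norm v + 1"
    by (simp add: T_def power2_eq_square algebra_simps)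
  have nn: "(norm x)\<^sup>2 \<ge> 0" "(norm v)\<^sup>2 \<ge> 0" "norm v \<ge> 0" by auto
  have D2: "\<bar>D2\<bar> \<le> (6 * (norm x)\<^sup>2 + 6 * (norm v)\<^sup>2) * H\<^sup>2"
    using vh2 xh2 zero_le_power2[of "v \<bullet> h"] zero_le_power2[of "x \<bullet> h"]
      mult_nonneg_nonneg[OF zero_le_power2[of "norm v"] zero_le_power2[of H]]
      mult_nonneg_nonneg[OF zero_le_power2[of "norm x"] zero_le_power2[of H]]
    unfolding D2_def H_def abs_le_iff distrib_right distrib_left minus_diff_eq by (intro conjI) linarith+
  have D3: "\<bar>D3\<bar> \<le> (4 * norm v + 1) * H^3"
  proof -
    have "\<bar>D3\<bar> \<le> 4 * \<bar>v \<bullet> h\<bar> * H\<^sup>2 + H^4"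
      unfolding D3_def H_def by (rule order_trans[OF abs_triangle_ineq]) (simp add: abs_mult)
    also have "\<dots> \<le> 4 * (norm v * H) * H\<^sup>2 + H^3"
      using vh H by (intro add_mono mult_right_mono power_decreasing) auto
    finally show ?thesis by (simp add: power2_eq_square power3_eq_cube algebra_simps)
  qed
  have H32: "H^3 \<le> H\<^sup>2" using H by (intro power_decreasing) auto
  have D3': "\<bar>D3\<bar> \<le> (4 * norm v + 1) * H\<^sup>2"
    using D3 mult_left_mono[OF H32, of "4 * norm v + 1"] by simp
  have "\<bar>D2 + D3 - ?\<delta>\<^sup>2\<bar> \<le> (6 * (norm x)\<^sup>2 + 6 * (norm v)\<^sup>2 + (4 * norm v + 1) + T\<^sup>2) * H\<^sup>2"
    using D2 D3' d2 zero_le_power2[of ?\<delta>] unfolding distrib_right by linarith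
  also have "\<dots> \<le> (4 * T\<^sup>2) * H\<^sup>2"
    by (intro mult_right_mono zero_le_power2) (use T2 nn in linarith)
  finally have num: "\<bar>D2 + D3 - ?\<delta>\<^sup>2\<bar> \<le> 4 * T\<^sup>2 * H\<^sup>2" .
  have r_bd: "\<bar>r\<bar> \<le> H\<^sup>2 * (2 * T\<^sup>2 / ?s)"
  proof -
    have "\<bar>r\<bar> = \<bar>D2 + D3 - ?\<delta>\<^sup>2\<bar> / (2 * ?s)" using s by (simp add: r_eq abs_divide)
    also have "\<dots> \<le> (4 * T\<^sup>2 * H\<^sup>2) / (2 * ?s)" using num s by (intro divide_right_mono) auto
    finally show ?thesis by (simp add: mult_ac)
  qed
  then show ?A by (simp add: loss_nprod r_def H_def algebra_simps)
  have "\<bar>D2 - ?g\<^sup>2\<bar> \<le> (6 * (norm x)\<^sup>2 + 10 * (norm v)\<^sup>2) * H\<^sup>2"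
    using D2 g2 zero_le_power2[of ?g] unfolding distrib_right by linarith
  also have "\<dots> \<le> (4 * T\<^sup>2) * H\<^sup>2" 
    by (intro mult_right_mono zero_le_power2) (use T2 nn in linarith)
  finally have "\<bar>D2 - ?g\<^sup>2\<bar> / (2 * ?s) \<le> (4 * T\<^sup>2 * H\<^sup>2) / (2 * ?s)"
    using s by (intro divide_right_mono) auto
  then show ?B unfolding hess_eq using s by (simp add: abs_divide H_def mult_ac)
  \<comment> \<open>The Hessian term has the square of the first-order term g where r has
    \<delta>^2. These squares differ by r (\<delta> + g), with r of order 2 and \<delta> + g of
    order 1, so the error is cubic.\<close>
  have "r - hess v x h h / 2 = (D3 - r * (?\<delta> + ?g)) / (2 * ?s)"
    unfolding hess_eq by (subst r_eq) (simp add: r_def power2_eq_square diff_divide_distrib add_divide_distrib algebra_simps)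
  then have "\<bar>r - hess v x h h / 2\<bar> = \<bar>D3 - r * (?\<delta> + ?g)\<bar> / (2 * ?s)" using s by (simp add: abs_divide)
  also have "\<dots> \<le> (2 * T\<^sup>2 * H^3 + (H\<^sup>2 * (2 * T\<^sup>2 / ?s)) * (2 * T * H)) / (2 * ?s)"
  proof (rule divide_right_mono)
    have "\<bar>D3\<bar> \<le> 2 * T\<^sup>2 * H^3"
    proof -
      have "(4 * norm v + 1) * H^3 \<le> 2 * T\<^sup>2 * H^3"
        by (intro mult_right_mono zero_le_power H(1)) (use T2 nn in linarith)
      then show ?thesis using D3 by linarith
    qed
    moreover have "\<bar>r * (?\<delta> + ?g)\<bar> \<le> (H\<^sup>2 * (2 * T\<^sup>2 / ?s)) * (2 * T * H)"
    proof -
      have "2 * norm v * H \<le> T * H" using H by (intro mult_right_mono) (auto simp: T_def)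
      then have "\<bar>?\<delta> + ?g\<bar> \<le> 2 * T * H" using d g by (simp add: abs_le_iff)
      then show ?thesis unfolding abs_mult using r_bd by (intro mult_mono) auto
    qed
    ultimately show "\<bar>D3 - r * (?\<delta> + ?g)\<bar> \<le> 2 * T\<^sup>2 * H^3 + (H\<^sup>2 * (2 * T\<^sup>2 / ?s)) * (2 * T * H)" by linarith
  qed (use s in auto)
  also have "\<dots> = H^3 * (T\<^sup>2 / ?s + 2 * T^3 / ?s\<^sup>2)"
    using s by (simp add: field_simps power2_eq_square power3_eq_cube)
  finally show ?C by (simp add: loss_nprod r_def H_def algebra_simps)
qed

text \<open>The score is (b/a)(v - x) + (a/b)(v + x), with a and b the distances of x from v and -v.
  The two parts are exchanged by x -> -x, and their cross term is a polynomial in the squared score;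
  the constants of the limit are stated in these terms.\<close>

lemma score_inner_sq:
  assumes "nprod v x > 0"
  shows "(score v x \<bullet> u)\<^sup>2 = ((norm (v + x))\<^sup>2 / (norm (v - x))\<^sup>2) * (u \<bullet> (v - x))\<^sup>2
     + ((norm (v - x))\<^sup>2 / (norm (v + x))\<^sup>2) * (u \<bullet> (v + x))\<^sup>2 + 2 * (v \<bullet> u)\<^sup>2 - 2 * (x \<bullet> u)\<^sup>2"
    and "hess v x u u = (norm (v + x) / norm (v - x) + norm (v - x) / norm (v + x)) * (u \<bullet> u)
     + 2 * ((u \<bullet> (v + x)) * (u \<bullet> (v - x))) / (norm (v + x) * norm (v - x))
     - norm (v + x) / norm (v - x) ^ 3 * (u \<bullet> (v - x))\<^sup>2 - norm (v - x) / norm (v + x) ^ 3 * (u \<bullet> (v + x))\<^sup>2"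
proof -
  define a b p q where "a = norm (v - x)" and "b = norm (v + x)" and "p = u \<bullet> (v - x)" and "q = u \<bullet> (v + x)"
  have ab: "a > 0" "b > 0" using assms by (auto simp: nprod_pos_iff a_def b_def eq_neg_iff_add_eq_0 add.commute)
  have s: "nprod v x = a * b" by (simp add: nprod_def a_def b_def norm_minus_commute add.commute)
  have a2: "a\<^sup>2 = (norm x)\<^sup>2 + (norm v)\<^sup>2 - 2 * (x \<bullet> v)"
    by (simp add: a_def power2_norm_eq_inner inner_diff_left inner_diff_right inner_commute)
  have b2: "b\<^sup>2 = (norm x)\<^sup>2 + (norm v)\<^sup>2 + 2 * (x \<bullet> v)"
    by (simp add: b_def power2_norm_eq_inner inner_add_left inner_add_right inner_commute)
  have p: "p = v \<bullet> u - x \<bullet> u" and q: "q = v \<bullet> u + x \<bullet> u"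
    by (auto simp: p_def q_def inner_diff_right inner_add_right inner_commute)
  have g: "a * b * (score v x \<bullet> u) = b\<^sup>2 * p + a\<^sup>2 * q"
    using score_inner_mult[OF assms, of u] unfolding s a2 b2 p q by (simp add: algebra_simps)
  then have g': "score v x \<bullet> u = b / a * p + a / b * q"
    using ab by (simp add: field_simps power2_eq_square)
  have pq: "p * q = (v \<bullet> u)\<^sup>2 - (x \<bullet> u)\<^sup>2" by (simp add: p q power2_eq_square algebra_simps)
  have gg: "(score v x \<bullet> u)\<^sup>2 = b\<^sup>2 / a\<^sup>2 * p\<^sup>2 + a\<^sup>2 / b\<^sup>2 * q\<^sup>2 + 2 * (p * q)"
    unfolding g' using ab by (simp add: field_simps power2_eq_square)
  then show "(score v x \<bullet> u)\<^sup>2 = ((norm (v + x))\<^sup>2 / (norm (v - x))\<^sup>2) * (u \<bullet> (v - x))\<^sup>2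
     + ((norm (v - x))\<^sup>2 / (norm (v + x))\<^sup>2) * (u \<bullet> (v + x))\<^sup>2 + 2 * (v \<bullet> u)\<^sup>2 - 2 * (x \<bullet> u)\<^sup>2"
    unfolding pq by (simp add: a_def b_def p_def q_def right_diff_distrib)
  have N: "2 * ((norm x)\<^sup>2 + (norm v)\<^sup>2) = a\<^sup>2 + b\<^sup>2" by (simp add: a2 b2)
  have "hess v x u u = (4 * (p * q) + (a\<^sup>2 + b\<^sup>2) * (u \<bullet> u) - (score v x \<bullet> u)\<^sup>2) / (a * b)"
    unfolding hess_def s N[symmetric] pq by (simp add: power2_eq_square)
  also have "\<dots> = (b / a + a / b) * (u \<bullet> u) + 2 * (q * p) / (b * a) - b / a ^ 3 * p\<^sup>2 - a / b ^ 3 * q\<^sup>2"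
    unfolding gg using ab by (simp add: field_simps power2_eq_square power3_eq_cube)
  finally show "hess v x u u = (norm (v + x) / norm (v - x) + norm (v - x) / norm (v + x)) * (u \<bullet> u)
     + 2 * ((u \<bullet> (v + x)) * (u \<bullet> (v - x))) / (norm (v + x) * norm (v - x))
     - norm (v + x) / norm (v - x) ^ 3 * (u \<bullet> (v - x))\<^sup>2 - norm (v - x) / norm (v + x) ^ 3 * (u \<bullet> (v + x))\<^sup>2"
    by (simp add: a_def b_def p_def q_def)
qed

subsection \<open>Elliptical laws with a radially decreasing density\<close>

text \<open>The columns of the orthogonal matrix enter as an orthonormal frame with its expansion,
  and p >= 2 as the existence of two distinct indices.\<close>

locale elliptical =
  fixes P :: "(real^'p) measure" and e :: "'p \<Rightarrow> real^'p" and k1 k2 :: 'p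
    and a :: real and \<kappa> :: "real \<Rightarrow> real"
  assumes ks: "k1 \<noteq> k2" and prob_space_P: "prob_space P"
    and P_eq: "P = density lborel (\<lambda>x. ennreal (\<kappa> (sqrt ((norm x)\<^sup>2 - a * (x \<bullet> e k1)\<^sup>2))))"
    and a: "0 < a" "a < 1"
    and \<kappa>_meas [measurable]: "\<kappa> \<in> borel_measurable borel"
    and \<kappa>_pos: "\<And>r. r > 0 \<Longrightarrow> \<kappa> r > 0"
    and \<kappa>_anti: "strict_antimono_on {0<..} \<kappa>"
    and ortho: "\<And>i j. e i \<bullet> e j = (if i = j then 1 else 0)"
    and expand: "\<And>x. x = (\<Sum>i\<in>UNIV. (x \<bullet> e i) *\<^sub>R e i)"
    and second_moment: "integrable P (\<lambda>x. (norm x)\<^sup>2)"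
begin

sublocale prob_space P by (rule prob_space_P)

lemma sets_P [simp, measurable_cong]: "sets P = sets borel" and space_P [simp]: "space P = UNIV"
  by (auto simp: P_eq)

definition dens :: "real^'p \<Rightarrow> real" where
  "dens x = \<kappa> (sqrt ((norm x)\<^sup>2 - a * (x \<bullet> e k1)\<^sup>2))"

lemma dens_meas [measurable]: "dens \<in> borel_measurable borel"
  unfolding dens_def by measurable

lemma P_dens: "P = density lborel (\<lambda>x. ennreal (dens x))"
  by (simp add: P_eq dens_def)

lemma norm_e [simp]: "norm (e i) = 1"
  by (simp add: norm_eq_sqrt_inner ortho)

lemma e_neq_0 [simp]: "e i \<noteq> 0"
  using norm_e[of i] by force

lemma inner_eq_sum: "x \<bullet> y = (\<Sum>i\<in>UNIV. (x \<bullet> e i) * (y \<bullet> e i))"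
proof -
  have "x \<bullet> y = (\<Sum>i\<in>UNIV. (x \<bullet> e i) *\<^sub>R e i) \<bullet> y"
    by (rule arg_cong[where f="\<lambda>z. z \<bullet> y", OF expand])
  also have "\<dots> = (\<Sum>i\<in>UNIV. (x \<bullet> e i) * (e i \<bullet> y))" by (simp add: inner_sum_left)
  finally show ?thesis by (simp add: inner_commute)
qed

lemma norm_sq_eq_sum: "(norm x)\<^sup>2 = (\<Sum>i\<in>UNIV. (x \<bullet> e i)\<^sup>2)"
  unfolding power2_norm_eq_inner inner_eq_sum[of x x] by (simp add: power2_eq_square)

lemma abs_inner_e_le: "\<bar>x \<bullet> e i\<bar> \<le> norm x"
  using Cauchy_Schwarz_ineq2[of x "e i"] by simp

lemma inner_e_sq_le: "(x \<bullet> e i)\<^sup>2 \<le> (norm x)\<^sup>2"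
  using power_mono[OF abs_inner_e_le[of x i], of 2] by simp

lemma sum_two_sq_le: "(x \<bullet> e k1)\<^sup>2 + (x \<bullet> e k2)\<^sup>2 \<le> (norm x)\<^sup>2"
proof -
  have "(\<Sum>i\<in>{k1, k2}. (x \<bullet> e i)\<^sup>2) \<le> (\<Sum>i\<in>UNIV. (x \<bullet> e i)\<^sup>2)"
    by (intro sum_mono2) auto
  then show ?thesis using ks by (simp add: norm_sq_eq_sum)
qed

text \<open>As a < 1, the argument of \<kappa> is at least a fixed positive multiple of |x|.\<close>

lemma radicand_bounds:
  "(1 - a) * (norm x)\<^sup>2 \<le> (norm x)\<^sup>2 - a * (x \<bullet> e k1)\<^sup>2"
  using mult_left_mono[OF inner_e_sq_le[of x k1], of a] a by (simp add: algebra_simps)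

lemma radicand_pos: "x \<noteq> 0 \<Longrightarrow> (norm x)\<^sup>2 - a * (x \<bullet> e k1)\<^sup>2 > 0"
proof -
  assume "x \<noteq> 0"
  then have "(1 - a) * (norm x)\<^sup>2 > 0" using a by simp
  then show ?thesis using radicand_bounds[of x] by linarith
qed

lemma dens_pos: "x \<noteq> 0 \<Longrightarrow> dens x > 0"
  unfolding dens_def by (intro \<kappa>_pos real_sqrt_gt_zero radicand_pos)

lemma AE_lborel_neq_0: "AE x in (lborel :: (real^'p) measure). x \<noteq> 0"
  by (rule AE_lborel_singleton)

lemma AE_P_I: "AE x in lborel. Q x \<Longrightarrow> AE x in P. Q x"
  unfolding P_dens by (subst AE_density) (auto elim!: eventually_mono)

lemma AE_P_neq: "AE x in P. x \<noteq> c"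
  by (rule AE_P_I) (rule AE_lborel_singleton)

lemma
  fixes f :: "real^'p \<Rightarrow> real"
  assumes [measurable]: "f \<in> borel_measurable borel"
  shows integral_P: "(\<integral>x. f x \<partial>P) = (\<integral>x. dens x * f x \<partial>lborel)"
    and integrable_P: "integrable P f \<longleftrightarrow> integrable lborel (\<lambda>x. dens x * f x)"
proof -
  have ae: "AE x in lborel. 0 \<le> dens x"
    using AE_lborel_neq_0 by eventually_elim (use dens_pos less_imp_le in blast)
  show "(\<integral>x. f x \<partial>P) = (\<integral>x. dens x * f x \<partial>lborel)"
    unfolding P_dens using ae by (subst integral_density) auto
  show "integrable P f \<longleftrightarrow> integrable lborel (\<lambda>x. dens x * f x)"
    unfolding P_dens using ae by (subst integrable_density) auto
qed

text \<open>The density sees x only through |x| and the squared component along \<open>e k1\<close>,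
  and Lebesgue measure is invariant.\<close>

lemma distr_P_orthogonal:
  assumes T: "orthogonal_transformation T" and T1: "\<And>x. (T x \<bullet> e k1)\<^sup>2 = (x \<bullet> e k1)\<^sup>2"
  shows "distr P borel T = P"
proof (rule measure_eqI)
  note [measurable] = borel_measurable_orthogonal_transformation[OF T]
  fix S assume "S \<in> sets (distr P borel T)"
  then have [measurable]: "S \<in> sets borel" by simp
  have dT: "dens (T x) = dens x" for x
    by (simp add: dens_def T1 orthogonal_transformation_norm[OF T])
  have "emeasure (distr P borel T) S = (\<integral>\<^sup>+x. indicator S x \<partial>distr P borel T)" by simp
  also have "\<dots> = (\<integral>\<^sup>+x. indicator S (T x) \<partial>P)"
    by (rule nn_integral_distr) auto
  also have "\<dots> = (\<integral>\<^sup>+x. ennreal (dens (T x)) * indicator S (T x) \<partial>lborel)"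
    unfolding P_dens by (subst nn_integral_density) (auto simp: dT)
  also have "\<dots> = (\<integral>\<^sup>+x. ennreal (dens x) * indicator S x \<partial>lborel)"
    by (rule orthogonal_invariant_nn_integral[OF orthogonal_invariant_lborel _ T, of "\<lambda>x. ennreal (dens x) * indicator S x"]) auto
  also have "\<dots> = emeasure P S" unfolding P_dens by (simp add: emeasure_density)
  finally show "emeasure (distr P borel T) S = emeasure P S" .
qed simp

lemma integral_P_orthogonal:
  fixes f :: "real^'p \<Rightarrow> real"
  assumes "orthogonal_transformation T" "\<And>x. (T x \<bullet> e k1)\<^sup>2 = (x \<bullet> e k1)\<^sup>2" and [measurable]: "f \<in> borel_measurable borel"
  shows "(\<integral>x. f (T x) \<partial>P) = (\<integral>x. f x \<partial>P)"
proof -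
  note [measurable] = borel_measurable_orthogonal_transformation[OF assms(1)]
  have "(\<integral>x. f x \<partial>P) = (\<integral>x. f x \<partial>distr P borel T)" using distr_P_orthogonal[OF assms(1,2)] by simp
  then show ?thesis by (subst (asm) integral_distr) auto
qed

lemma integrable_P_orthogonal:
  fixes f :: "real^'p \<Rightarrow> real"
  assumes "orthogonal_transformation T" "\<And>x. (T x \<bullet> e k1)\<^sup>2 = (x \<bullet> e k1)\<^sup>2" and "integrable P f"
  shows "integrable P (\<lambda>x. f (T x))"
proof -
  note [measurable] = borel_measurable_orthogonal_transformation[OF assms(1)] borel_measurable_integrable[OF assms(3)]
  have "integrable (distr P borel T) f" using distr_P_orthogonal[OF assms(1,2)] assms(3) by simp
  then show ?thesis by (subst (asm) integrable_distr_eq) auto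
qed

lemma orthogonal_transformation_uminus: "orthogonal_transformation (uminus :: real^'p \<Rightarrow> real^'p)"
  by (auto simp: orthogonal_transformation_def linear_uminus)

lemmas integral_P_uminus = integral_P_orthogonal[OF orthogonal_transformation_uminus, simplified]
lemmas integrable_P_uminus = integrable_P_orthogonal[OF orthogonal_transformation_uminus, simplified]

lemma card_ge_2: "CARD('p) \<ge> 2"
  using card_mono[of UNIV "{k1, k2}"] ks by simp

text \<open>In polar form the integrand is c t^(p-1) / t = c t^(p-2), which stays bounded near 0
  because p >= 2.\<close>

lemma nn_integral_inverse_norm_finite:
  "(\<integral>\<^sup>+x. ennreal (1 / norm x) * indicator (cball 0 r) x \<partial>(lborel :: (real^'p) measure)) < \<infinity>"
proof -
  let ?n = "CARD('p)"
  define c where "c = real ?n * unit_ball_vol (real ?n)"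
  have c: "c \<ge> 0" by (simp add: c_def)
  have "(\<integral>\<^sup>+x. ennreal (1 / norm x) * indicator (cball 0 r) x \<partial>(lborel :: (real^'p) measure)) =
      (\<integral>\<^sup>+x. ennreal (1 / norm x) * indicator {..r} (norm x) \<partial>(lborel :: (real^'p) measure))"
    by (intro nn_integral_cong) (auto simp: indicator_def)
  also have "\<dots> = (\<integral>\<^sup>+t. ennreal (c * t ^ (?n - 1)) * indicator {0<..} t * (ennreal (1 / t) * indicator {..r} t) \<partial>lborel)"
    unfolding c_def by (rule nn_integral_radial[of "\<lambda>t. ennreal (1 / t) * indicator {..r} t"]) measurable
  also have "\<dots> \<le> (\<integral>\<^sup>+t. ennreal (c * \<bar>r\<bar> ^ (?n - 2)) * indicator {0..\<bar>r\<bar>} t \<partial>lborel)"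
  proof (rule nn_integral_mono)
    fix t :: real
    show "ennreal (c * t ^ (?n - 1)) * indicator {0<..} t * (ennreal (1 / t) * indicator {..r} t)
        \<le> ennreal (c * \<bar>r\<bar> ^ (?n - 2)) * indicator {0..\<bar>r\<bar>} t"
    proof (cases "0 < t \<and> t \<le> r")
      case True
      have "?n - 1 = Suc (?n - 2)" using card_ge_2 by simp
      then have "c * t ^ (?n - 1) * (1 / t) = c * t ^ (?n - 2)" using True by simp
      also have "\<dots> \<le> c * \<bar>r\<bar> ^ (?n - 2)" using True c by (intro mult_left_mono power_mono) auto
      finally have "ennreal (c * t ^ (?n - 1)) * ennreal (1 / t) \<le> ennreal (c * \<bar>r\<bar> ^ (?n - 2))"
        using True c by (subst ennreal_mult[symmetric]) (auto intro: ennreal_leI)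
      then show ?thesis using True by simp
    qed (auto simp: indicator_def)
  qed
  also have "\<dots> = ennreal (c * \<bar>r\<bar> ^ (?n - 2)) * ennreal \<bar>r\<bar>"
    by (subst nn_integral_cmult) auto
  also have "\<dots> < \<infinity>" by (simp add: ennreal_mult_less_top)
  finally show ?thesis .
qed

text \<open>Near v the density is bounded, because \<kappa> decreases and its argument stays away
  from 0, and the singularity is the integrable one of
  \<open>nn_integral_inverse_norm_finite\<close>. Elsewhere the integrand is bounded.\<close>

lemma integrable_inverse_norm:
  assumes v: "v \<noteq> 0"
  shows "integrable P (\<lambda>x. 1 / norm (x - v))"
proof (rule integrableI_bounded)
  \<comment> \<open>Half the distance keeps the ball around v away from the origin, where \<kappa>
    may be unbounded.\<close>
  define r where "r = norm v / 2"
  have r: "r > 0" using v by (simp add: r_def)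
  define B where "B = \<kappa> (sqrt (1 - a) * r)"
  have sr: "sqrt (1 - a) * r > 0" using a r by simp
  have dens_le: "dens x \<le> B" if "norm (x - v) \<le> r" for x
  proof -
    have "norm v \<le> norm x + norm (x - v)" by (metis norm_minus_commute norm_triangle_sub)
    then have xr: "norm x \<ge> r" using that by (simp add: r_def)
    have "(sqrt (1 - a) * r)\<^sup>2 \<le> (1 - a) * (norm x)\<^sup>2"
      using a r xr by (simp add: power_mult_distrib mult_left_mono power_mono)
    then have "sqrt (1 - a) * r \<le> sqrt ((norm x)\<^sup>2 - a * (x \<bullet> e k1)\<^sup>2)"
      using radicand_bounds[of x] by (intro real_le_rsqrt) linarith
    then consider "sqrt (1 - a) * r = sqrt ((norm x)\<^sup>2 - a * (x \<bullet> e k1)\<^sup>2)"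
      | "sqrt (1 - a) * r < sqrt ((norm x)\<^sup>2 - a * (x \<bullet> e k1)\<^sup>2)" by linarith
    then show ?thesis
    proof cases
      case 2
      moreover from this have "sqrt ((norm x)\<^sup>2 - a * (x \<bullet> e k1)\<^sup>2) > 0" using sr by linarith
      ultimately show ?thesis
        using monotone_onD[OF \<kappa>_anti, of "sqrt (1 - a) * r" "sqrt ((norm x)\<^sup>2 - a * (x \<bullet> e k1)\<^sup>2)"] sr
        unfolding dens_def B_def greaterThan_iff by linarith
    qed (simp add: dens_def B_def)
  qed
  have [measurable]: "cball v r \<in> sets borel" "cball (0 :: real^'p) r \<in> sets borel" by auto
  have [measurable]: "(\<lambda>x. ennreal (1 / norm (x - v)) * indicator (cball v r) x) \<in> borel_measurable borel"
    by measurable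
  have "(\<integral>\<^sup>+x. ennreal (norm (1 / norm (x - v))) \<partial>P) \<le>
      (\<integral>\<^sup>+x. ennreal (1 / norm (x - v)) * indicator (cball v r) x + ennreal (1 / r) \<partial>P)"
  proof (rule nn_integral_mono)
    fix x show "ennreal (norm (1 / norm (x - v))) \<le> ennreal (1 / norm (x - v)) * indicator (cball v r) x + ennreal (1 / r)"
    proof (cases "norm (x - v) \<le> r")
      case False
      then have "1 / norm (x - v) \<le> 1 / r" using r by (intro divide_left_mono mult_pos_pos) auto
      then show ?thesis using False by (auto simp: indicator_def dist_norm norm_minus_commute intro: ennreal_leI)
    qed (simp add: dist_norm norm_minus_commute)
  qed
  also have "\<dots> = (\<integral>\<^sup>+x. ennreal (1 / norm (x - v)) * indicator (cball v r) x \<partial>P) + ennreal (1 / r)"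
    by (subst nn_integral_add) (use r in \<open>auto simp: emeasure_space_1[simplified]\<close>)
  also have "(\<integral>\<^sup>+x. ennreal (1 / norm (x - v)) * indicator (cball v r) x \<partial>P) =
      (\<integral>\<^sup>+x. ennreal (dens x) * (ennreal (1 / norm (x - v)) * indicator (cball v r) x) \<partial>lborel)"
    unfolding P_dens by (rule nn_integral_density) measurable
  also have "\<dots> \<le> (\<integral>\<^sup>+x. ennreal B * (ennreal (1 / norm (x - v)) * indicator (cball 0 r) (x - v)) \<partial>lborel)"
    using dens_le by (intro nn_integral_mono) (auto simp: indicator_def dist_norm norm_minus_commute intro!: mult_right_mono ennreal_leI)
  also have "\<dots> = (\<integral>\<^sup>+x. ennreal B * (ennreal (1 / norm (x - v)) * indicator (cball 0 r) (x - v)) \<partial>distr lborel borel (\<lambda>y. v + y))"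
    using lborel_affine[of 1 v] by (simp add: density_1)
  also have "\<dots> = (\<integral>\<^sup>+y. ennreal B * (ennreal (1 / norm y) * indicator (cball 0 r) y) \<partial>(lborel :: (real^'p) measure))"
    by (subst nn_integral_distr, measurable)
  also have "\<dots> = ennreal B * (\<integral>\<^sup>+y. ennreal (1 / norm y) * indicator (cball 0 r) y \<partial>(lborel :: (real^'p) measure))"
    by (rule nn_integral_cmult) measurable
  finally have "(\<integral>\<^sup>+x. ennreal (norm (1 / norm (x - v))) \<partial>P) \<le>
      ennreal B * (\<integral>\<^sup>+y. ennreal (1 / norm y) * indicator (cball 0 r) y \<partial>(lborel :: (real^'p) measure)) + ennreal (1 / r)"
    by (simp add: add_right_mono)
  also have "\<dots> < \<infinity>"
    using nn_integral_inverse_norm_finite[of r] by (simp add: ennreal_mult_less_top)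
  finally show "(\<integral>\<^sup>+x. ennreal (norm (1 / norm (x - v))) \<partial>P) < \<infinity>" .
qed measurable

lemma integrable_norm: "integrable P norm"
  by (rule square_integrable_imp_integrable[OF _ second_moment]) simp

lemma nprod_meas [measurable]: "(\<lambda>x. nprod v x) \<in> borel_measurable borel" for v :: "real^'p"
  unfolding nprod_def by measurable

lemma score_meas [measurable]: "(\<lambda>x. score v x) \<in> borel_measurable borel" for v :: "real^'p"
  unfolding score_def by measurable

lemma hess_meas [measurable]: "(\<lambda>x. hess v x u w) \<in> borel_measurable borel" for v :: "real^'p"
  unfolding hess_def by measurable

lemma loss_meas [measurable]: "(\<lambda>x. loss v x) \<in> borel_measurable borel" for v :: "real^'p"
  unfolding loss_def by measurable

text \<open>With T = 2|x| + 2|v| + 1, the larger of the two distances is at least T / c and cancels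
  one factor T. The smaller distance m satisfies T <= 2 m + d, so the other factor leaves a single
  reciprocal distance.\<close>

lemma integrable_envelope:
  assumes v: "v \<noteq> 0"
  shows "integrable P (\<lambda>x. (2 * norm x + 2 * norm v + 1)\<^sup>2 / nprod v x)"
proof -
  \<comment> \<open>For M at least |x| and |v|, the estimate 1 <= M / |v| gives T <= (2 + 2 + 1/|v|)
    M.\<close>
  define c where "c = 4 + 1 / norm v"
  define d where "d = 4 * norm v + 1"
  have nv: "norm v > 0" using v by simp
  have c: "c > 0" using nv by (simp add: c_def add_pos_nonneg)
  have int: "integrable P (\<lambda>x. c * (2 + d * (1 / norm (x - v) + 1 / norm (x - - v))))"
    using integrable_inverse_norm[OF v] integrable_inverse_norm[of "- v"] v by auto
  show ?thesis
  proof (rule Bochner_Integration.integrable_bound[OF int], measurable)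
    have "AE x in P. x \<noteq> v \<and> x \<noteq> - v" using AE_P_neq by auto
    then show "AE x in P. norm ((2 * norm x + 2 * norm v + 1)\<^sup>2 / nprod v x) \<le> norm (c * (2 + d * (1 / norm (x - v) + 1 / norm (x - - v))))"
    proof eventually_elim
      case (elim x)
      define A where "A = norm (x - v)"
      define B where "B = norm (x + v)"
      have AB: "A > 0" "B > 0" using elim by (auto simp: A_def B_def add_eq_0_iff)
      define T where "T = 2 * norm x + 2 * norm v + 1"
      have T: "T > 0" by (simp add: T_def add_nonneg_pos)
      have key: "T\<^sup>2 / (M * m) \<le> c * (2 + d / m)" if M: "M \<ge> norm x" "M \<ge> norm v" and m: "m > 0" "norm x \<le> m + norm v" for M m
      proof -
        have Mp: "M > 0" using M nv by linarith
        have "1 \<le> M / norm v" using M nv by (simp add: field_simps)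
        then have "T \<le> c * M" using M by (simp add: T_def c_def algebra_simps)
        moreover have "T \<le> 2 * m + d" using m by (simp add: T_def d_def)
        ultimately have "T * T \<le> (c * M) * (2 * m + d)" using T c Mp by (intro mult_mono) auto
        then have "T\<^sup>2 / (M * m) \<le> ((c * M) * (2 * m + d)) / (M * m)"
          using m Mp by (intro divide_right_mono) (auto simp: power2_eq_square)
        also have "\<dots> = c * (2 + d / m)" using m Mp by (simp add: field_simps)
        finally show ?thesis .
      qed
      have "x - v + (x + v) = 2 *\<^sub>R x" "x + v - (x - v) = 2 *\<^sub>R v" by (simp_all add: scaleR_2)
      then have x2: "2 * norm x \<le> A + B" and v2: "2 * norm v \<le> A + B"
        using norm_triangle_ineq[of "x - v" "x + v"] norm_triangle_ineq4[of "x + v" "x - v"]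
        by (simp_all add: A_def B_def)
      have xA: "norm x \<le> A + norm v" using norm_triangle_ineq[of "x - v" v] by (simp add: A_def)
      have xB: "norm x \<le> B + norm v" using norm_triangle_ineq4[of "x + v" v] by (simp add: B_def)
      have d: "d > 0" using nv unfolding d_def by linarith
      have "T\<^sup>2 / (A * B) \<le> c * (2 + d * (1 / A + 1 / B))"
      proof (cases "A \<le> B")
        case True
        then have "T\<^sup>2 / (B * A) \<le> c * (2 + d / A)" using x2 v2 xA AB by (intro key) auto
        also have "\<dots> \<le> c * (2 + d * (1 / A + 1 / B))" using c d AB by (intro mult_left_mono) (auto simp: algebra_simps)
        finally show ?thesis by (simp add: mult.commute)
      next
        case False
        then have "T\<^sup>2 / (A * B) \<le> c * (2 + d / B)" using x2 v2 xB AB by (intro key) auto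
        also have "\<dots> \<le> c * (2 + d * (1 / A + 1 / B))" using c d AB by (intro mult_left_mono) (auto simp: algebra_simps)
        finally show ?thesis .
      qed
      moreover have "T\<^sup>2 / (A * B) \<ge> 0" using AB by simp
      ultimately show ?case by (simp add: nprod_def A_def B_def T_def)
    qed
  qed
qed

lemma AE_nprod_pos: "AE x in P. nprod v x > 0"
  using AE_P_neq[of v] AE_P_neq[of "- v"] by (auto simp: nprod_pos_iff)

lemma abs_hess_le:
  fixes v :: "real^'p"
  assumes "nprod v x > 0"
  shows "\<bar>hess v x u w\<bar> \<le> 3 * norm u * norm w * ((2 * norm x + 2 * norm v + 1)\<^sup>2 / nprod v x)"
proof -
  define C where "C = norm u * norm w"
  have C: "C \<ge> 0" by (simp add: C_def)
  have cs: "\<bar>(y \<bullet> u) * (y \<bullet> w)\<bar> \<le> (norm y)\<^sup>2 * C" for y :: "real^'p"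
    using mult_mono[OF Cauchy_Schwarz_ineq2[of y u] Cauchy_Schwarz_ineq2[of y w]]
    by (simp add: abs_mult C_def power2_eq_square mult_ac)
  have uw: "\<bar>u \<bullet> w\<bar> \<le> C" unfolding C_def by (rule Cauchy_Schwarz_ineq2)
  have uw': "\<bar>((norm x)\<^sup>2 + (norm v)\<^sup>2) * (u \<bullet> w)\<bar> \<le> ((norm x)\<^sup>2 + (norm v)\<^sup>2) * C"
    unfolding abs_mult using uw by (intro mult_mono) auto
  have sc: "\<bar>(score v x \<bullet> u) * (score v x \<bullet> w)\<bar> \<le> 4 * ((norm v)\<^sup>2 * C)"
    using cs[of "score v x"] norm_score[OF assms] by (simp add: power_mult_distrib)
  have "\<bar>4 * (v \<bullet> u) * (v \<bullet> w) + 2 * ((norm x)\<^sup>2 + (norm v)\<^sup>2) * (u \<bullet> w)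
     - 4 * (x \<bullet> u) * (x \<bullet> w) - (score v x \<bullet> u) * (score v x \<bullet> w)\<bar> \<le>
     4 * ((norm v)\<^sup>2 * C) + 2 * (((norm x)\<^sup>2 + (norm v)\<^sup>2) * C) + 4 * ((norm x)\<^sup>2 * C) + 4 * ((norm v)\<^sup>2 * C)"
    using cs[of v] cs[of x] uw' sc unfolding mult.assoc by linarith
  also have "\<dots> = (6 * (norm x)\<^sup>2 + 10 * (norm v)\<^sup>2) * C" by (simp add: algebra_simps)
  also have "\<dots> \<le> (3 * (2 * norm x + 2 * norm v + 1)\<^sup>2) * C"
    using C by (intro mult_right_mono) (auto simp: power2_eq_square algebra_simps)
  finally show ?thesis
    using assms unfolding hess_def by (simp add: abs_divide C_def divide_right_mono mult_ac)
qed

lemma integrable_hess: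
  assumes "v \<noteq> 0"
  shows "integrable P (\<lambda>x. hess v x u w)"
proof (rule Bochner_Integration.integrable_bound)
  show "integrable P (\<lambda>x. 3 * norm u * norm w * ((2 * norm x + 2 * norm v + 1)\<^sup>2 / nprod v x))"
    by (intro integrable_mult_right integrable_envelope assms)
  show "AE x in P. norm (hess v x u w) \<le> norm (3 * norm u * norm w * ((2 * norm x + 2 * norm v + 1)\<^sup>2 / nprod v x))"
    using AE_nprod_pos[of v] by eventually_elim (use abs_hess_le in \<open>force simp: abs_mult\<close>)
qed measurable

lemma integrable_score: "integrable P (\<lambda>x. score v x \<bullet> u)"
proof (rule integrable_const_bound[where B="2 * norm v * norm u"])
  show "AE x in P. norm (score v x \<bullet> u) \<le> 2 * norm v * norm u"
    using norm_score_le[of v]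
    by (intro AE_I2) (metis Cauchy_Schwarz_ineq2 mult_right_mono norm_ge_zero order_trans real_norm_def)
qed measurable

lemma integrable_score_mult: "integrable P (\<lambda>x. (score v x \<bullet> u) * (score v x \<bullet> w))"
proof (rule integrable_const_bound[where B="(2 * norm v * norm u) * (2 * norm v * norm w)"])
  have *: "\<bar>score v x \<bullet> u\<bar> \<le> 2 * norm v * norm u" for x u
    using norm_score_le[of v]
    by (metis Cauchy_Schwarz_ineq2 mult_right_mono norm_ge_zero order_trans)
  show "AE x in P. norm ((score v x \<bullet> u) * (score v x \<bullet> w)) \<le> (2 * norm v * norm u) * (2 * norm v * norm w)"
    unfolding real_norm_def abs_mult by (intro AE_I2 mult_mono *) auto
qed measurable

lemma integrable_loss: "integrable P (loss v)"
  using abs_loss_le[of v] by (intro integrable_const_bound[where B="(norm v)\<^sup>2"]) auto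

end

subsection \<open>Positive curvature at the minimizer\<close>

lemma (in prob_space) integral_pos_AE:
  fixes f :: "'a \<Rightarrow> real"
  assumes "integrable M f" "AE x in M. f x > 0"
  shows "(\<integral>x. f x \<partial>M) > 0"
proof -
  have nn: "AE x in M. 0 \<le> f x" using assms(2) by eventually_elim simp
  have "(\<integral>x. f x \<partial>M) \<noteq> 0"
  proof
    assume "(\<integral>x. f x \<partial>M) = 0"
    then have "AE x in M. f x = 0" using integral_nonneg_eq_0_iff_AE[OF assms(1) nn] by simp
    with assms(2) have "AE x in M. False" by eventually_elim simp
    then show False by (simp add: AE_False)
  qed
  then show ?thesis using integral_nonneg_AE[OF nn] by linarith
qed

text \<open>Fermat's principle for a function bounded above by a line plus a parabola; it takes the
  place of differentiating the objective under the integral.\<close>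

lemma linear_term_zero:
  fixes A C t0 :: real
  assumes t0: "t0 > 0" and C: "C \<ge> 0" and le: "\<And>t. \<bar>t\<bar> \<le> t0 \<Longrightarrow> 0 \<le> t * A + t\<^sup>2 * C"
  shows "A = 0"
proof (rule ccontr)
  assume "A \<noteq> 0"
  \<comment> \<open>A step this short makes the quadratic part smaller than s |A|; C + 1 instead of
    C avoids a zero denominator.\<close>
  define s where "s = min t0 (\<bar>A\<bar> / (2 * (C + 1)))"
  have s: "s > 0" using \<open>A \<noteq> 0\<close> t0 C by (simp add: s_def)
  have "s \<le> \<bar>A\<bar> / (2 * (C + 1))" by (simp add: s_def)
  then have "s * (2 * (C + 1)) \<le> \<bar>A\<bar>" using C by (simp add: pos_le_divide_eq)
  then have "s * C < \<bar>A\<bar>" using s C by (simp add: algebra_simps)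
  then have "s * (s * C) < s * \<bar>A\<bar>" using s by simp
  moreover have "0 \<le> (- s * sgn A) * A + (- s * sgn A)\<^sup>2 * C"
    using s by (intro le) (auto simp: abs_mult abs_sgn_eq s_def)
  moreover have "(- s * sgn A) * A + (- s * sgn A)\<^sup>2 * C = s * (s * C) - s * \<bar>A\<bar>"
    using \<open>A \<noteq> 0\<close> by (cases "A > 0") (auto simp: power2_eq_square)
  ultimately show False by simp
qed

section \<open>Symmetries of the law\<close>

context elliptical
begin

lemma AE_inner_neq_0: "AE x in P. x \<bullet> e i \<noteq> 0"
proof (rule AE_P_I)
  have "negligible {x. e i \<bullet> x = 0}" by (rule negligible_hyperplane) simp
  moreover have "{x. e i \<bullet> x = 0} \<in> sets borel" by (intro borel_closed closed_hyperplane)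
  ultimately have "{x. e i \<bullet> x = 0} \<in> null_sets lborel"
    by (simp add: negligible_iff_null_sets null_sets_completion_iff)
  then show "AE x in lborel. x \<bullet> e i \<noteq> 0"
    by (rule AE_I') (auto simp: inner_commute)
qed

lemma reflection_e: "reflection (e m) (e l) = (if l = m then - e m else e l)"
  by (auto simp: reflection_def ortho scaleR_2)

lemma reflection_involution: "reflection u (reflection u x) = x" for u x :: "real^'p"
  by (cases "u = 0") (auto simp: reflection_def inner_diff_left)

lemma fix_e1_inner:
  assumes "orthogonal_transformation T" "T (e k1) = e k1"
  shows "(T x \<bullet> e k1)\<^sup>2 = (x \<bullet> e k1)\<^sup>2"
  using assms unfolding orthogonal_transformation_def by metis

text \<open>Since i and j differ, one of them is not k1. Reflecting that axis preserves the law and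
  changes the sign of the kernel. It is applied to the Hessian, to products of scores and to second
  moments.\<close>

lemma kernel_offdiag:
  fixes K :: "real^'p \<Rightarrow> real^'p \<Rightarrow> real^'p \<Rightarrow> real"
  assumes meas [measurable]: "\<And>u w. (\<lambda>x. K x u w) \<in> borel_measurable borel"
    and inv: "\<And>T x u w. orthogonal_transformation T \<Longrightarrow> T (e k1) = e k1 \<Longrightarrow> K (T x) (T u) (T w) = K x u w"
    and neg: "\<And>x u w. K x (- u) w = - K x u w" "\<And>x u w. K x u (- w) = - K x u w"
    and ij: "i \<noteq> j"
  shows "(\<integral>x. K x (e i) (e j) \<partial>P) = 0"
proof -
  obtain m where m: "m \<in> {i, j}" "m \<noteq> k1" using ij by blast
  let ?T = "reflection (e m)"
  have T: "orthogonal_transformation ?T" "?T (e k1) = e k1"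
    using m by (auto simp: orthogonal_transformation_reflection reflection_e)
  have [simp]: "reflection (e l) (- e l) = e l" for l
    using reflection_involution[of "e l" "e l"] by (simp add: reflection_e)
  have "K (?T x) (e i) (e j) = - K x (e i) (e j)" for x
    using inv[OF T, of x "?T (e i)" "?T (e j)"] m ij
    by (auto simp: reflection_involution reflection_e neg)
  then have "(\<integral>x. K (?T x) (e i) (e j) \<partial>P) = - (\<integral>x. K x (e i) (e j) \<partial>P)" by simp
  moreover have "(\<integral>x. K (?T x) (e i) (e j) \<partial>P) = (\<integral>x. K x (e i) (e j) \<partial>P)"
    by (rule integral_P_orthogonal[OF T(1) fix_e1_inner[OF T]]) measurable
  ultimately show ?thesis by simp
qed

text \<open>The reflection exchanging the two axes fixes \<open>e k1\<close>, hence preserves the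
  law.\<close>

lemma kernel_diag:
  fixes K :: "real^'p \<Rightarrow> real^'p \<Rightarrow> real^'p \<Rightarrow> real"
  assumes meas [measurable]: "\<And>u w. (\<lambda>x. K x u w) \<in> borel_measurable borel"
    and inv: "\<And>T x u w. orthogonal_transformation T \<Longrightarrow> T (e k1) = e k1 \<Longrightarrow> K (T x) (T u) (T w) = K x u w"
    and ij: "i \<noteq> k1" "j \<noteq> k1"
  shows "(\<integral>x. K x (e i) (e i) \<partial>P) = (\<integral>x. K x (e j) (e j) \<partial>P)"
proof -
  let ?T = "reflection (e i - e j)"
  have T: "orthogonal_transformation ?T" "?T (e k1) = e k1"
    using ij by (auto simp: orthogonal_transformation_reflection reflection_def inner_diff_right ortho)
  have "?T (e i) = e j" by (rule reflection_swap) simp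
  then have "K (?T x) (e j) (e j) = K x (e i) (e i)" for x using inv[OF T, of x "e i" "e i"] by simp
  moreover have "(\<integral>x. K (?T x) (e j) (e j) \<partial>P) = (\<integral>x. K x (e j) (e j) \<partial>P)"
    by (rule integral_P_orthogonal[OF T(1) fix_e1_inner[OF T]]) measurable
  ultimately show ?thesis by simp
qed

end

section \<open>Score and Hessian at the minimizer\<close>

locale elliptical_min = elliptical P e k1 k2 a \<kappa>
    for P :: "(real^'p) measure" and e k1 k2 a \<kappa> +
  fixes \<psi> :: real
  assumes psi: "\<psi> > 0" and min: "\<And>w. obj P (\<psi> *\<^sub>R e k1) \<le> obj P w"
begin

abbreviation "v0 \<equiv> \<psi> *\<^sub>R e k1"

lemma v0_neq_0: "v0 \<noteq> 0" using psi by simp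

lemma norm_v0 [simp]: "norm v0 = \<psi>" using psi by simp

text \<open>The first-order condition, from the integrated quadratic remainder bound: along any line
  through the minimizer the increment of the objective is nonnegative and lies below a linear term
  plus a parabola.\<close>

lemma score_mean_zero: "(\<integral>x. score v0 x \<bullet> h \<partial>P) = 0"
proof -
  define A where "A = (\<integral>x. score v0 x \<bullet> h \<partial>P)"
  define E where "E x = 2 * ((2 * norm x + 2 * norm v0 + 1)\<^sup>2 / nprod v0 x)" for x
  have iE: "integrable P E" unfolding E_def by (intro integrable_mult_right integrable_envelope v0_neq_0)
  define C where "C = (norm h)\<^sup>2 * (\<integral>x. E x \<partial>P)"
  have "A = 0"
  proof (rule linear_term_zero)
    \<comment> \<open>This range of t keeps |t h| <= 1, as the remainder bound requires.\<close>
    show "1 / (norm h + 1) > 0" by (simp add: add_nonneg_pos)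
    have "E x \<ge> 0" for x by (simp add: E_def)
    then show "C \<ge> 0" by (simp add: C_def)
    fix t assume t: "\<bar>t\<bar> \<le> 1 / (norm h + 1)"
    then have "\<bar>t\<bar> * (norm h + 1) \<le> 1" by (simp add: pos_le_divide_eq add_nonneg_pos)
    then have th: "norm (t *\<^sub>R h) \<le> 1" by (simp add: algebra_simps)
    have "0 \<le> obj P (v0 + t *\<^sub>R h) - obj P v0" using min by simp
    also have "\<dots> = (\<integral>x. loss (v0 + t *\<^sub>R h) x - loss v0 x \<partial>P)"
      unfolding obj_def by (simp add: integrable_loss)
    also have "\<dots> \<le> (\<integral>x. score v0 x \<bullet> (t *\<^sub>R h) + (norm (t *\<^sub>R h))\<^sup>2 * E x \<partial>P)"
    proof (rule integral_mono_AE)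
      show "integrable P (\<lambda>x. score v0 x \<bullet> (t *\<^sub>R h) + (norm (t *\<^sub>R h))\<^sup>2 * E x)"
        using iE integrable_score by (intro Bochner_Integration.integrable_add integrable_mult_right)
      show "AE x in P. loss (v0 + t *\<^sub>R h) x - loss v0 x \<le> score v0 x \<bullet> (t *\<^sub>R h) + (norm (t *\<^sub>R h))\<^sup>2 * E x"
        using AE_nprod_pos[of v0]
      proof eventually_elim
        case (elim x)
        show ?case using loss_remainder_bound[OF elim th] unfolding E_def by (simp add: abs_le_iff)
      qed
    qed (simp add: integrable_loss)
    also have "\<dots> = (\<integral>x. score v0 x \<bullet> (t *\<^sub>R h) \<partial>P) + (\<integral>x. (norm (t *\<^sub>R h))\<^sup>2 * E x \<partial>P)"
      using iE integrable_score by (intro Bochner_Integration.integral_add integrable_mult_right)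
    also have "\<dots> = t * A + t\<^sup>2 * C"
      by (simp add: A_def C_def power_mult_distrib)
    finally show "0 \<le> t * A + t\<^sup>2 * C" .
  qed
  then show ?thesis by (simp add: A_def)
qed

lemma v0_invariant:
  assumes T: "orthogonal_transformation T" "T (e k1) = e k1"
  shows "T v0 = v0" "nprod v0 (T x) = nprod v0 x" "T x \<bullet> v0 = x \<bullet> v0" "v0 \<bullet> T x = v0 \<bullet> x"
    "norm (T x) = norm x" "T x \<bullet> T u = x \<bullet> u"
proof -
  have lin: "linear T" using T(1) by (rule orthogonal_transformation_linear)
  show Tv: "T v0 = v0" using T(2) lin by (simp add: linear_scale)
  show n: "norm (T y) = norm y" for y using T(1) by (rule orthogonal_transformation_norm)
  show i: "T x \<bullet> T u = x \<bullet> u" for x u using T by (simp add: orthogonal_transformation_def)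
  have "T x - v0 = T (x - v0)" "T x + v0 = T (x + v0)"
    using Tv lin by (simp_all add: linear_diff linear_add)
  then show "nprod v0 (T x) = nprod v0 x" by (simp only: nprod_def n)
  show *: "T x \<bullet> v0 = x \<bullet> v0" using i[of x v0] Tv by simp
  then show "v0 \<bullet> T x = v0 \<bullet> x" by (simp only: inner_commute)
qed

lemma score_inner:
  "score v x \<bullet> u = 2 * (((norm x)\<^sup>2 + (norm v)\<^sup>2) * (v \<bullet> u) - 2 * (x \<bullet> v) * (x \<bullet> u)) / nprod v x"
  for v :: "real^'p"
  by (simp add: score_def inner_diff_left)

lemma score_invariant:
  assumes T: "orthogonal_transformation T" "T (e k1) = e k1"
  shows "score v0 (T x) \<bullet> T u = score v0 x \<bullet> u"
  unfolding score_inner v0_invariant[OF T] ..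

lemma hess_invariant:
  assumes T: "orthogonal_transformation T" "T (e k1) = e k1"
  shows "hess v0 (T x) (T u) (T w) = hess v0 x u w"
  unfolding hess_def score_invariant[OF T] v0_invariant[OF T] ..

lemma
  shows score_v0_e1: "nprod v0 x > 0 \<Longrightarrow> score v0 x \<bullet> e k1 = 2 * \<psi> * ((norm x)\<^sup>2 + \<psi>\<^sup>2 - 2 * (x \<bullet> e k1)\<^sup>2) / nprod v0 x"
    and score_v0_e2: "nprod v0 x > 0 \<Longrightarrow> score v0 x \<bullet> e k2 = - 4 * \<psi> * (x \<bullet> e k1) * (x \<bullet> e k2) / nprod v0 x"
  using score_inner_mult[of v0 x "e k1"] score_inner_mult[of v0 x "e k2"] ks
  by (simp_all add: ortho norm_v0[simplified] field_simps power2_eq_square)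

lemma nprod_v0_sq: "(nprod v0 x)\<^sup>2 = ((norm x)\<^sup>2 + \<psi>\<^sup>2)\<^sup>2 - 4 * \<psi>\<^sup>2 * (x \<bullet> e k1)\<^sup>2"
  unfolding nprod_sq norm_v0 by (simp add: power_mult_distrib)

text \<open>The multiple of the score is split off because its mean is 0. What remains, 4 \<psi>^2
  minus the squared score component, over \<open>nprod\<close>, is nonnegative by the length of the
  score and factorizes explicitly.\<close>

lemma hess_v0_e1:
  assumes "nprod v0 x > 0"
  shows "hess v0 x (e k1) (e k1) = (score v0 x \<bullet> e k1) / \<psi> +
    16 * \<psi>\<^sup>2 * ((x \<bullet> e k1)\<^sup>2 * ((norm x)\<^sup>2 - (x \<bullet> e k1)\<^sup>2)) / (nprod v0 x) ^ 3"
proof -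
  define s where "s = nprod v0 x"
  define y where "y = x \<bullet> e k1"
  define N where "N = (norm x)\<^sup>2 + \<psi>\<^sup>2"
  have s: "s > 0" using assms by (simp add: s_def)
  define G where "G = 2 * \<psi> * (N - 2 * y\<^sup>2) / s"
  have G2: "G\<^sup>2 = 4 * \<psi>\<^sup>2 * (N - 2 * y\<^sup>2)\<^sup>2 / s\<^sup>2" by (simp add: G_def power_mult_distrib power_divide)
  have G: "score v0 x \<bullet> e k1 = G" by (simp add: G_def score_v0_e1[OF assms] N_def y_def s_def)
  have "hess v0 x (e k1) (e k1) = (4 * \<psi>\<^sup>2 + 2 * N - 4 * y\<^sup>2 - G\<^sup>2) / s"
    unfolding hess_def G s_def[symmetric] norm_v0
    by (simp add: ortho N_def y_def power2_eq_square)
  also have "\<dots> = G / \<psi> + (4 * \<psi>\<^sup>2 - G\<^sup>2) / s"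
    using s psi by (simp add: G_def field_simps)
  also have "(4 * \<psi>\<^sup>2 - G\<^sup>2) = 4 * \<psi>\<^sup>2 * (s\<^sup>2 - (N - 2 * y\<^sup>2)\<^sup>2) / s\<^sup>2"
    using s by (simp add: G2 right_diff_distrib diff_divide_distrib)
  also have "s\<^sup>2 - (N - 2 * y\<^sup>2)\<^sup>2 = 4 * (y\<^sup>2 * ((norm x)\<^sup>2 - y\<^sup>2))"
    unfolding s_def nprod_v0_sq N_def y_def by (simp add: power2_eq_square algebra_simps)
  finally show ?thesis using s by (simp add: G y_def s_def power2_eq_square power3_eq_cube)
qed

text \<open>A quarter of what the Hessian entry at \<open>e k2\<close> retains once the mean-zero
  multiple of the score is removed. Its sign varies with x, unlike the corresponding term at
  \<open>e k1\<close>.\<close>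

definition curv :: "real^'p \<Rightarrow> real" where
  "curv x = ((x \<bullet> e k1)\<^sup>2 - (x \<bullet> e k2)\<^sup>2) / nprod v0 x - 4 * \<psi>\<^sup>2 * (x \<bullet> e k1)\<^sup>2 * (x \<bullet> e k2)\<^sup>2 / nprod v0 x ^ 3"

lemma curv_meas [measurable]: "curv \<in> borel_measurable borel"
  unfolding curv_def by measurable

lemma hess_v0_e2:
  assumes "nprod v0 x > 0"
  shows "hess v0 x (e k2) (e k2) = (score v0 x \<bullet> e k1) / \<psi> + 4 * curv x"
proof -
  define s where "s = nprod v0 x"
  define y1 where "y1 = x \<bullet> e k1"
  define y2 where "y2 = x \<bullet> e k2"
  define N where "N = (norm x)\<^sup>2 + \<psi>\<^sup>2"
  have s: "s > 0" using assms by (simp add: s_def)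
  have "hess v0 x (e k2) (e k2) = (2 * N - 4 * y2\<^sup>2 - (- 4 * \<psi> * y1 * y2 / s)\<^sup>2) / s"
    unfolding hess_def score_v0_e2[OF assms] s_def[symmetric] norm_v0
    using ks by (simp add: ortho N_def y1_def y2_def power2_eq_square)
  also have "\<dots> = 2 * \<psi> * (N - 2 * y1\<^sup>2) / s / \<psi> + 4 * ((y1\<^sup>2 - y2\<^sup>2) / s - 4 * \<psi>\<^sup>2 * y1\<^sup>2 * y2\<^sup>2 / s ^ 3)"
    using s psi by (simp add: field_simps power2_eq_square power3_eq_cube)
  finally show ?thesis by (simp add: score_v0_e1[OF assms] curv_def s_def y1_def y2_def N_def)
qed

definition "curv1 = (\<integral>x. hess v0 x (e k1) (e k1) \<partial>P)"
definition "curv2 = (\<integral>x. hess v0 x (e k2) (e k2) \<partial>P)"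

text \<open>Since the score has mean zero, the multiple of it that occurs in the Hessian entry drops out, which leaves a positive integrand.\<close>

lemma curv1_pos: "curv1 > 0"
proof -
  let ?f = "\<lambda>x. hess v0 x (e k1) (e k1) - (score v0 x \<bullet> e k1) / \<psi>"
  have int: "integrable P ?f"
    using integrable_hess[OF v0_neq_0] integrable_score by (intro Bochner_Integration.integrable_diff integrable_divide_zero) auto
  have "AE x in P. ?f x > 0"
    using AE_nprod_pos[of v0] AE_inner_neq_0[of k1] AE_inner_neq_0[of k2]
  proof eventually_elim
    case (elim x)
    have "(norm x)\<^sup>2 - (x \<bullet> e k1)\<^sup>2 > 0"
      using sum_two_sq_le[of x] elim(3) zero_less_power2[of "x \<bullet> e k2"] by linarith
    then have "16 * \<psi>\<^sup>2 * ((x \<bullet> e k1)\<^sup>2 * ((norm x)\<^sup>2 - (x \<bullet> e k1)\<^sup>2)) / (nprod v0 x) ^ 3 > 0"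
      using elim psi by simp
    then show ?case using hess_v0_e1[OF elim(1)] by linarith
  qed
  from integral_pos_AE[OF int this] have "(\<integral>x. ?f x \<partial>P) > 0" .
  also have "(\<integral>x. ?f x \<partial>P) = curv1 - (\<integral>x. score v0 x \<bullet> e k1 \<partial>P) / \<psi>"
    unfolding curv1_def using integrable_hess[OF v0_neq_0] integrable_score
    by (subst Bochner_Integration.integral_diff) auto
  finally show ?thesis by (simp add: score_mean_zero)
qed

lemma integrable_curv: "integrable P curv"
  and curv2_eq: "curv2 = 4 * (\<integral>x. curv x \<partial>P)"
proof -
  let ?f = "\<lambda>x. (hess v0 x (e k2) (e k2) - (score v0 x \<bullet> e k1) / \<psi>) / 4"
  have int: "integrable P ?f"
    using integrable_hess[OF v0_neq_0] integrable_score by (intro Bochner_Integration.integrable_diff integrable_divide_zero) auto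
  have eq: "AE x in P. curv x = ?f x"
    using AE_nprod_pos[of v0] by eventually_elim (simp add: hess_v0_e2)
  show "integrable P curv" using int eq by (subst integrable_cong_AE) auto
  have "(\<integral>x. curv x \<partial>P) = (\<integral>x. ?f x \<partial>P)" using eq by (intro integral_cong_AE) auto
  also have "\<dots> = (curv2 - (\<integral>x. score v0 x \<bullet> e k1 \<partial>P) / \<psi>) / 4"
    unfolding curv2_def using integrable_hess[OF v0_neq_0] integrable_score
    by (subst integral_divide_zero, subst Bochner_Integration.integral_diff) auto
  finally show "curv2 = 4 * (\<integral>x. curv x \<partial>P)" by (simp add: score_mean_zero)
qed

end

section \<open>Rotations of the leading plane\<close>

context elliptical
begin

text \<open>The rotation by \<theta> in the plane of \<open>e k1\<close> and \<open>e k2\<close>, as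
  the identity plus a correction in that plane, so that the orthogonal complement needs no
  coordinates.\<close>

definition rot :: "real \<Rightarrow> real^'p \<Rightarrow> real^'p" where
  "rot \<theta> x = x + ((cos \<theta> - 1) * (x \<bullet> e k1) - sin \<theta> * (x \<bullet> e k2)) *\<^sub>R e k1
     + (sin \<theta> * (x \<bullet> e k1) + (cos \<theta> - 1) * (x \<bullet> e k2)) *\<^sub>R e k2"

lemma rot_e1: "rot \<theta> x \<bullet> e k1 = cos \<theta> * (x \<bullet> e k1) - sin \<theta> * (x \<bullet> e k2)"
  and rot_e2: "rot \<theta> x \<bullet> e k2 = sin \<theta> * (x \<bullet> e k1) + cos \<theta> * (x \<bullet> e k2)"
  using ks by (auto simp: rot_def inner_add_left ortho algebra_simps)

lemma orthogonal_transformation_rot: "orthogonal_transformation (rot \<theta>)"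
  unfolding orthogonal_transformation_def
proof (intro conjI allI)
  show "linear (rot \<theta>)"
    by (rule linearI) (auto simp: rot_def inner_add_left algebra_simps)
  fix x y
  define c s p q p' q' where "c = cos \<theta>" and "s = sin \<theta>" and "p = x \<bullet> e k1" and "q = x \<bullet> e k2"
    and "p' = y \<bullet> e k1" and "q' = y \<bullet> e k2"
  have cs: "c * c + s * s = 1" unfolding c_def s_def using sin_cos_squared_add3[of \<theta>] by simp
  have "rot \<theta> x \<bullet> rot \<theta> y = x \<bullet> y + ((c - 1) * p' - s * q') * p + (s * p' + (c - 1) * q') * q
      + ((c - 1) * p - s * q) * p' + (s * p + (c - 1) * q) * q'
      + ((c - 1) * p - s * q) * ((c - 1) * p' - s * q') + (s * p + (c - 1) * q) * (s * p' + (c - 1) * q')"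
    using ks by (simp add: rot_def inner_add_left inner_add_right ortho inner_commute c_def s_def p_def q_def p'_def q'_def)
  also have "\<dots> = x \<bullet> y + (c * c + s * s - 1) * (p * p' + q * q')"
    by (simp add: algebra_simps)
  finally show "rot \<theta> x \<bullet> rot \<theta> y = x \<bullet> y" by (simp add: cs)
qed

lemma rot_meas [measurable]: "(\<lambda>(\<theta>, x). rot \<theta> x) \<in> borel_measurable (borel \<Otimes>\<^sub>M borel)"
  unfolding rot_def by measurable

lemma rot_meas2 [measurable]: "rot \<theta> \<in> borel_measurable borel"
  by (rule borel_measurable_orthogonal_transformation[OF orthogonal_transformation_rot])

text \<open>Averaging over the rotations of the plane spanned by the first two axes replaces polar coordinates.\<close>

lemma integral_pos_by_rotation:
  fixes g :: "real^'p \<Rightarrow> real"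
  assumes g: "integrable lborel g"
    and pos: "AE x in lborel. set_integrable lborel {0..2*pi} (\<lambda>\<theta>. g (rot \<theta> x)) \<longrightarrow> (LBINT \<theta>:{0..2*pi}. g (rot \<theta> x)) > 0"
  shows "(\<integral>x. g x \<partial>lborel) > 0"
proof -
  have [measurable]: "g \<in> borel_measurable borel" using g by (simp add: borel_measurable_integrable)
  have dl: "distr lborel borel (rot \<theta>) = (lborel :: (real^'p) measure)" for \<theta>
    using orthogonal_invariant_lborel orthogonal_transformation_rot by (auto simp: orthogonal_invariant_def)
  have rot_int: "(\<integral>x. h (rot \<theta> x) \<partial>lborel) = (\<integral>x. h x \<partial>lborel)" if [measurable]: "h \<in> borel_measurable borel" for h :: "real^'p \<Rightarrow> real" and \<theta>
    by (subst (2) dl[of \<theta>, symmetric], subst integral_distr) auto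
  have rot_integrable: "integrable lborel (\<lambda>x. g (rot \<theta> x))" for \<theta>
  proof -
    have "integrable (distr lborel borel (rot \<theta>)) g" using g by (simp add: dl)
    then show ?thesis by (subst (asm) integrable_distr_eq) auto
  qed
  define f where "f \<theta> x = indicator {0..2*pi} \<theta> * g (rot \<theta> x)" for \<theta> x
  have [measurable]: "(\<lambda>(\<theta>, x). f \<theta> x) \<in> borel_measurable (borel \<Otimes>\<^sub>M borel)" unfolding f_def by measurable
  have ind: "integrable lborel (\<lambda>\<theta>. indicator {0..2*pi} \<theta> * (c::real))" for c
    by (intro integrable_mult_left integrable_real_indicator) auto
  have int: "integrable (lborel \<Otimes>\<^sub>M lborel) (\<lambda>(\<theta>, x). f \<theta> x)"
  proof (rule lborel_pair.Fubini_integrable)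
    have "(\<integral>x. norm (f \<theta> x) \<partial>lborel) = indicator {0..2*pi} \<theta> * (\<integral>x. \<bar>g x\<bar> \<partial>lborel)" for \<theta>
      by (simp add: f_def abs_mult rot_int[of "\<lambda>x. \<bar>g x\<bar>"])
    then show "integrable lborel (\<lambda>\<theta>. \<integral>x. norm (case (\<theta>, x) of (\<theta>, x) \<Rightarrow> f \<theta> x) \<partial>lborel)"
      using ind by simp
    show "AE \<theta> in lborel. integrable lborel (\<lambda>x. case (\<theta>, x) of (\<theta>, x) \<Rightarrow> f \<theta> x)"
      by (simp add: f_def rot_integrable)
  qed measurable
  \<comment> \<open>Integrability along the orbit is known for almost every x only, which is why the
    hypothesis asks for positivity under that proviso.\<close>
  have aeint: "AE x in lborel. integrable lborel (\<lambda>\<theta>. f \<theta> x)"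
    using lborel_pair.AE_integrable_snd[OF int] by simp
  have J: "integrable lborel (\<lambda>x. \<integral>\<theta>. f \<theta> x \<partial>lborel)"
    using lborel_pair.integrable_snd[OF int] by simp
  have "AE x in lborel. (\<integral>\<theta>. f \<theta> x \<partial>lborel) > 0"
    using aeint pos by eventually_elim (auto simp: f_def set_integrable_def set_lebesgue_integral_def)
  note posJ = this
  have "(\<integral>x. (\<integral>\<theta>. f \<theta> x \<partial>lborel) \<partial>lborel) \<noteq> 0"
  proof
    assume "(\<integral>x. (\<integral>\<theta>. f \<theta> x \<partial>lborel) \<partial>lborel) = 0"
    moreover have "AE x in lborel. 0 \<le> (\<integral>\<theta>. f \<theta> x \<partial>lborel)" using posJ by eventually_elim simp
    ultimately have "AE x in lborel. (\<integral>\<theta>. f \<theta> x \<partial>lborel) = 0"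
      using integral_nonneg_eq_0_iff_AE[OF J] by simp
    with posJ have "AE x in (lborel :: (real^'p) measure). False" by eventually_elim simp
    from AE_P_I[OF this] show False by (simp add: AE_False)
  qed
  moreover have "(\<integral>x. (\<integral>\<theta>. f \<theta> x \<partial>lborel) \<partial>lborel) \<ge> 0"
    using posJ by (intro integral_nonneg_AE) (auto elim!: eventually_mono)
  ultimately have "0 < (\<integral>x. (\<integral>\<theta>. f \<theta> x \<partial>lborel) \<partial>lborel)" by linarith
  \<comment> \<open>After the exchange each inner integral is that of g, since rotations preserve
    Lebesgue measure; the full turn contributes the factor 2 pi.\<close>
  also have "\<dots> = (\<integral>\<theta>. (\<integral>x. f \<theta> x \<partial>lborel) \<partial>lborel)"
    by (rule lborel_pair.Fubini_integral[OF int])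
  also have "\<dots> = (\<integral>\<theta>. indicator {0..2*pi} \<theta> * (\<integral>x. g x \<partial>lborel) \<partial>lborel)"
    by (simp add: f_def rot_int)
  also have "\<dots> = 2 * pi * (\<integral>x. g x \<partial>lborel)" by simp
  finally show ?thesis by (simp add: zero_less_mult_iff)
qed

end

context elliptical_min
begin

text \<open>For fixed \<open>x\<close>, the curvature integrand is the derivative along the rotation of
  \<open>x\<^sub>1 x\<^sub>2 / nprod\<close>, so that it integrates to zero over a full turn; up to a positive factor
  it is an increasing function of \<open>x\<^sub>1\<^sup>2\<close>, and so is the density.\<close>

lemma rotation_average_pos:
  assumes rho: "x \<bullet> e k1 \<noteq> 0" and r: "norm x \<noteq> \<psi>"
    and int: "set_integrable lborel {0..2*pi} (\<lambda>\<theta>. dens (rot \<theta> x) * curv (rot \<theta> x))"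
  shows "(LBINT \<theta>:{0..2*pi}. dens (rot \<theta> x) * curv (rot \<theta> x)) > 0"
proof -
  define y1 where "y1 \<theta> = rot \<theta> x \<bullet> e k1" for \<theta>
  define y2 where "y2 \<theta> = rot \<theta> x \<bullet> e k2" for \<theta>
  define R where "R = (x \<bullet> e k1)\<^sup>2 + (x \<bullet> e k2)\<^sup>2"
  define N where "N = (norm x)\<^sup>2 + \<psi>\<^sup>2"
  define c where "c \<theta> = (y1 \<theta>)\<^sup>2" for \<theta>
  define s where "s \<theta> = nprod v0 (rot \<theta> x)" for \<theta>
  define K where "K t = 2 * N\<^sup>2 * t - 4 * \<psi>\<^sup>2 * t\<^sup>2 - R * N\<^sup>2" for t
  define D where "D t = \<kappa> (sqrt ((norm x)\<^sup>2 - a * t))" for t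
  have R: "R > 0" unfolding R_def using rho by (simp add: add_pos_nonneg)
  have Rx: "R \<le> (norm x)\<^sup>2" unfolding R_def by (rule sum_two_sq_le)
  have N: "N > 0" using psi by (simp add: N_def add_nonneg_pos)
  \<comment> \<open>Excluding |x| = \<psi> keeps the orbit away from \<open>v0\<close> and
    \<open>- v0\<close>, so that \<open>nprod\<close> never vanishes on it.\<close>
  have NR: "N\<^sup>2 > 4 * \<psi>\<^sup>2 * R"
  proof -
    have "\<psi> \<noteq> norm x" "(norm x)\<^sup>2 \<noteq> \<psi>\<^sup>2" using r psi by (auto simp: power2_eq_iff_nonneg)
    then have "((norm x)\<^sup>2 - \<psi>\<^sup>2)\<^sup>2 > 0" by simp
    also have "((norm x)\<^sup>2 - \<psi>\<^sup>2)\<^sup>2 = N\<^sup>2 - 4 * \<psi>\<^sup>2 * (norm x)\<^sup>2" by (simp add: N_def power2_eq_square algebra_simps)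
    finally show ?thesis using mult_left_mono[OF Rx, of "4 * \<psi>\<^sup>2"] by simp
  qed
  have nrot: "norm (rot \<theta> x) = norm x" for \<theta> by (rule orthogonal_transformation_norm[OF orthogonal_transformation_rot])
  have sumR: "(y1 \<theta>)\<^sup>2 + (y2 \<theta>)\<^sup>2 = R" for \<theta>
  proof -
    have "(c * p - s * q)\<^sup>2 + (s * p + c * q)\<^sup>2 = (s\<^sup>2 + c\<^sup>2) * (p\<^sup>2 + q\<^sup>2)" for c s p q :: real
      by (simp add: power2_eq_square algebra_simps)
    then have "(y1 \<theta>)\<^sup>2 + (y2 \<theta>)\<^sup>2 = ((sin \<theta>)\<^sup>2 + (cos \<theta>)\<^sup>2) * R"
      unfolding y1_def y2_def rot_e1 rot_e2 R_def .
    then show ?thesis by simp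
  qed
  have c_bd: "0 \<le> c \<theta>" "c \<theta> \<le> R" for \<theta>
    using sumR[of \<theta>] zero_le_power2[of "y2 \<theta>"] by (auto simp: c_def simp del: zero_le_power2)
  have s_sq: "(s \<theta>)\<^sup>2 = N\<^sup>2 - 4 * \<psi>\<^sup>2 * c \<theta>" for \<theta>
    unfolding s_def nprod_v0_sq nrot by (simp add: N_def c_def y1_def)
  have s_pos: "s \<theta> > 0" for \<theta>
  proof -
    have "4 * \<psi>\<^sup>2 * c \<theta> \<le> 4 * \<psi>\<^sup>2 * R" using c_bd by (intro mult_left_mono) auto
    then have "(s \<theta>)\<^sup>2 > 0" unfolding s_sq using NR by linarith
    then have "s \<theta> \<noteq> 0" by auto
    moreover have "s \<theta> \<ge> 0" by (simp add: s_def)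
    ultimately show ?thesis by linarith
  qed
  have s_eq: "s \<theta> = sqrt (N\<^sup>2 - 4 * \<psi>\<^sup>2 * c \<theta>)" for \<theta>
    using s_sq[of \<theta>] s_pos[of \<theta>] by (simp add: real_sqrt_unique)
  have curv_eq: "curv (rot \<theta> x) = K (c \<theta>) / s \<theta> ^ 3" for \<theta>
  proof -
    have y2: "(y2 \<theta>)\<^sup>2 = R - c \<theta>" using sumR[of \<theta>] by (simp add: c_def)
    have "curv (rot \<theta> x) = (c \<theta> - (y2 \<theta>)\<^sup>2) / s \<theta> - 4 * \<psi>\<^sup>2 * c \<theta> * (y2 \<theta>)\<^sup>2 / s \<theta> ^ 3"
      by (simp add: curv_def y1_def y2_def s_def c_def)
    also have "\<dots> = ((2 * c \<theta> - R) * (s \<theta>)\<^sup>2 - 4 * \<psi>\<^sup>2 * c \<theta> * (R - c \<theta>)) / s \<theta> ^ 3"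
      unfolding y2 using s_pos[of \<theta>] by (simp add: field_simps power2_eq_square power3_eq_cube)
    also have "(2 * c \<theta> - R) * (s \<theta>)\<^sup>2 - 4 * \<psi>\<^sup>2 * c \<theta> * (R - c \<theta>) = K (c \<theta>)"
      unfolding s_sq K_def by (simp add: power2_eq_square algebra_simps)
    finally show ?thesis .
  qed
  have dens_eq: "dens (rot \<theta> x) = D (c \<theta>)" for \<theta>
    by (simp add: dens_def nrot D_def c_def y1_def)
  have K_diff: "K t - K t' = (t - t') * (2 * N\<^sup>2 - 4 * \<psi>\<^sup>2 * (t + t'))" for t t'
    by (simp add: K_def power2_eq_square algebra_simps)
  \<comment> \<open>K is a concave parabola whose vertex lies beyond R, by
    \<open>NR\<close>.\<close>
  have K_mono: "K t' < K t" if "t' < t" "t \<le> R" "t' \<le> R" for t t'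
  proof -
    have "4 * \<psi>\<^sup>2 * (t + t') \<le> 4 * \<psi>\<^sup>2 * (R + R)" using that by (intro mult_left_mono) auto
    then have "2 * N\<^sup>2 - 4 * \<psi>\<^sup>2 * (t + t') > 0" using NR by (simp add: algebra_simps)
    then show ?thesis using K_diff[of t t'] that by (smt (verit) mult_pos_pos)
  qed
  have D_mono: "D t' < D t" if "t' < t" "t \<le> R" for t t'
  proof -
    have "a * t \<le> a * (norm x)\<^sup>2" using that Rx a by (intro mult_left_mono) auto
    also have "\<dots> < 1 * (norm x)\<^sup>2" using a R Rx by (intro mult_strict_right_mono) auto
    finally have "a * t < (norm x)\<^sup>2" by simp
    moreover have "a * t' < a * t" using a that by simp
    ultimately show ?thesis unfolding D_def
      by (intro monotone_onD[OF \<kappa>_anti]) auto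
  qed
  \<comment> \<open>At the zero t0 of K both K and D - D t0 change sign, and both increase, so their
    product is nonnegative. Subtracting the constant D t0 costs nothing because the curvature
    integrates to zero over a full turn.\<close>
  have "\<exists>t\<ge>0. t \<le> R \<and> K t = 0"
  proof (rule IVT')
    show "K 0 \<le> 0" using R by (simp add: K_def)
    have "K R = R * (N\<^sup>2 - 4 * \<psi>\<^sup>2 * R)" by (simp add: K_def power2_eq_square algebra_simps)
    then show "0 \<le> K R" using R NR by simp
    show "continuous_on {0..R} K" unfolding K_def by (intro continuous_intros)
  qed (use R in auto)
  then obtain t0 where t0: "0 \<le> t0" "t0 \<le> R" "K t0 = 0" by blast
  have sign: "(D t - D t0) * K t \<ge> 0" "(D t - D t0) * K t = 0 \<Longrightarrow> t = t0" if "t \<le> R" for t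
  proof -
    consider "t < t0" | "t = t0" | "t > t0" by linarith
    then have "(D t - D t0) * K t \<ge> 0 \<and> ((D t - D t0) * K t = 0 \<longrightarrow> t = t0)"
    proof cases
      case 1
      then have "(D t - D t0) * K t > 0"
        using D_mono[OF 1 t0(2)] K_mono[OF 1 t0(2) that] t0(3) by (intro mult_neg_neg) auto
      then show ?thesis by (intro conjI impI) linarith+
    next
      case 3
      then have "(D t - D t0) * K t > 0"
        using D_mono[OF 3 that] K_mono[OF 3 that t0(2)] t0(3) by (intro mult_pos_pos) auto
      then show ?thesis by (intro conjI impI) linarith+
    qed (use t0 in auto)
    then show "(D t - D t0) * K t \<ge> 0" "(D t - D t0) * K t = 0 \<Longrightarrow> t = t0" by auto
  qed
  have dy1: "(y1 has_real_derivative - y2 \<theta>) (at \<theta>)" for \<theta>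
    unfolding y1_def[abs_def] y2_def rot_e1 rot_e2 by (auto intro!: derivative_eq_intros)
  have dy2: "(y2 has_real_derivative y1 \<theta>) (at \<theta>)" for \<theta>
    unfolding y2_def[abs_def] y1_def rot_e1 rot_e2 by (auto intro!: derivative_eq_intros)
  have rad: "N\<^sup>2 - 4 * \<psi>\<^sup>2 * c \<theta> > 0" for \<theta> using s_sq[of \<theta>] s_pos[of \<theta>] by (metis zero_less_power)
  have ds: "(s has_real_derivative 4 * \<psi>\<^sup>2 * y1 \<theta> * y2 \<theta> / s \<theta>) (at \<theta>)" for \<theta>
    unfolding s_eq[abs_def] c_def using rad[of \<theta>] dy1
    by (auto intro!: derivative_eq_intros simp: c_def field_simps)
  have prim: "((\<lambda>\<theta>. y1 \<theta> * y2 \<theta> / s \<theta>) has_real_derivative curv (rot \<theta> x)) (at \<theta>)" for \<theta>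
  proof -
    have "((\<lambda>\<theta>. y1 \<theta> * y2 \<theta> / s \<theta>) has_real_derivative
        ((- y2 \<theta> * y2 \<theta> + y1 \<theta> * y1 \<theta>) * s \<theta> - (y1 \<theta> * y2 \<theta>) * (4 * \<psi>\<^sup>2 * y1 \<theta> * y2 \<theta> / s \<theta>)) / (s \<theta> * s \<theta>)) (at \<theta>)"
      using s_pos[of \<theta>] by (auto intro!: derivative_eq_intros dy1 dy2 ds)
    also have "((- y2 \<theta> * y2 \<theta> + y1 \<theta> * y1 \<theta>) * s \<theta> - (y1 \<theta> * y2 \<theta>) * (4 * \<psi>\<^sup>2 * y1 \<theta> * y2 \<theta> / s \<theta>)) / (s \<theta> * s \<theta>)
        = curv (rot \<theta> x)"
      unfolding curv_def y1_def[symmetric] y2_def[symmetric] s_def[symmetric]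
      using s_pos[of \<theta>] by (simp add: field_simps power2_eq_square power3_eq_cube)
    finally show ?thesis .
  qed
  have cont_c: "continuous_on A c" for A
    unfolding c_def by (intro continuous_intros DERIV_continuous_on[of _ y1 "\<lambda>\<theta>. - y2 \<theta>"]) (auto intro: DERIV_subset dy1)
  have cont_s: "continuous_on A s" for A
    by (intro DERIV_continuous_on[of _ s "\<lambda>\<theta>. 4 * \<psi>\<^sup>2 * y1 \<theta> * y2 \<theta> / s \<theta>"]) (auto intro: DERIV_subset ds)
  have cont_curv: "continuous_on A (\<lambda>\<theta>. curv (rot \<theta> x))" for A
    unfolding curv_eq K_def using s_pos
    by (intro continuous_intros cont_c cont_s) (auto simp: less_imp_neq[symmetric])
  have "has_bochner_integral lborel (\<lambda>\<theta>. indicator {0..2*pi} \<theta> *\<^sub>R curv (rot \<theta> x))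
      (y1 (2*pi) * y2 (2*pi) / s (2*pi) - y1 0 * y2 0 / s 0)"
    by (rule has_bochner_integral_FTC_Icc)
      (auto intro!: cont_curv has_field_derivative_at_within[OF prim] simp flip: has_real_derivative_iff_has_vector_derivative)
  moreover have "y1 (2*pi) = y1 0" "y2 (2*pi) = y2 0" by (simp_all add: y1_def y2_def rot_e1 rot_e2)
  moreover have "s (2*pi) = s 0" unfolding s_eq c_def using calculation by simp
  ultimately have intK: "set_integrable lborel {0..2*pi} (\<lambda>\<theta>. curv (rot \<theta> x))"
    and K0: "(LBINT \<theta>:{0..2*pi}. curv (rot \<theta> x)) = 0"
    unfolding set_integrable_def set_lebesgue_integral_def by (auto simp: has_bochner_integral_iff)
  define F where "F \<theta> = indicator {0..2*pi} \<theta> *\<^sub>R (dens (rot \<theta> x) * curv (rot \<theta> x) - D t0 * curv (rot \<theta> x))" for \<theta>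
  have F_eq: "F \<theta> = indicator {0..2*pi} \<theta> *\<^sub>R ((D (c \<theta>) - D t0) * K (c \<theta>) / s \<theta> ^ 3)" for \<theta>
    by (simp add: F_def dens_eq curv_eq left_diff_distrib diff_divide_distrib)
  have F_nn: "F \<theta> \<ge> 0" for \<theta>
    unfolding F_eq using sign(1)[OF c_bd(2)[of \<theta>]] s_pos[of \<theta>] by simp
  have F_int: "integrable lborel F"
    using set_integral_diff(1)[OF int set_integrable_mult_right[OF intK, of "D t0"]]
    by (simp add: set_integrable_def F_def[abs_def])
  have F_val: "(\<integral>\<theta>. F \<theta> \<partial>lborel) = (LBINT \<theta>:{0..2*pi}. dens (rot \<theta> x) * curv (rot \<theta> x))"
    using set_integral_diff(2)[OF int set_integrable_mult_right[OF intK, of "D t0"]] K0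
    by (simp add: set_lebesgue_integral_def F_def)
  have "(\<integral>\<theta>. F \<theta> \<partial>lborel) \<noteq> 0"
  proof
    assume "(\<integral>\<theta>. F \<theta> \<partial>lborel) = 0"
    then have "AE \<theta> in lborel. F \<theta> = 0"
      using integral_nonneg_eq_0_iff_AE[OF F_int] F_nn by simp
    then have ae: "AE \<theta> in lborel. \<theta> \<in> {0<..<2*pi} \<longrightarrow> c \<theta> = t0"
    proof eventually_elim
      case (elim \<theta>)
      then show ?case using sign(2)[OF c_bd(2)[of \<theta>]] s_pos[of \<theta>] by (auto simp: F_eq)
    qed
    \<comment> \<open>The set where c differs from t0 is open and null, hence empty, so c is
      constant on the whole open interval.\<close>
    define W where "W = {\<theta> \<in> {0<..<2*pi}. c \<theta> \<in> - {t0}}"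
    have "open W" unfolding W_def
      by (intro continuous_open_preimage[OF cont_c, unfolded vimage_def Int_def, simplified] | simp add: open_Compl)+
    moreover have "negligible W"
    proof -
      have "AE \<theta> in lborel. \<theta> \<notin> W" using ae by eventually_elim (auto simp: W_def)
      then have "W \<in> null_sets lborel"
        using \<open>open W\<close> by (subst (asm) AE_iff_null_sets[symmetric]) auto
      then show ?thesis by (simp add: negligible_iff_null_sets null_sets_completionI)
    qed
    ultimately have "W = {}" using open_not_negligible by blast
    then have all: "c \<theta> = t0" if "0 < \<theta>" "\<theta> < 2 * pi" for \<theta> using that by (auto simp: W_def)
    \<comment> \<open>Three angles refute constancy. With x1, x2 the two components of x, pi and
      pi/2 give x1^2 = x2^2 = t0, and pi/4 gives (x1 - x2)^2 / 2 = t0; hence x1 x2 = 0 and x1 =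
      0.\<close>
    have cpi: "(x \<bullet> e k1)\<^sup>2 = t0" using all[of pi] by (simp add: c_def y1_def rot_e1)
    have cpi2: "(x \<bullet> e k2)\<^sup>2 = t0" using all[of "pi / 2"] by (simp add: c_def y1_def rot_e1)
    have c4: "((x \<bullet> e k1) - (x \<bullet> e k2))\<^sup>2 / 2 = t0"
    proof -
      have "sqrt 2 / 2 * p - sqrt 2 / 2 * q = sqrt 2 / 2 * (p - q)" for p q :: real by (simp add: algebra_simps)
      then have "y1 (pi / 4) = sqrt 2 / 2 * (x \<bullet> e k1 - x \<bullet> e k2)"
        unfolding y1_def rot_e1 cos_45 sin_45 .
      then have "c (pi / 4) = (sqrt 2 / 2 * (x \<bullet> e k1 - x \<bullet> e k2))\<^sup>2" by (simp only: c_def)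
      also have "\<dots> = (x \<bullet> e k1 - x \<bullet> e k2)\<^sup>2 / 2" by (simp add: power_mult_distrib power_divide)
      finally have "c (pi / 4) = (x \<bullet> e k1 - x \<bullet> e k2)\<^sup>2 / 2" .
      then show ?thesis using all[of "pi / 4"] by simp
    qed
    have "(x \<bullet> e k1) * (x \<bullet> e k2) = 0" using cpi cpi2 c4 by (simp add: power2_diff)
    then show False using cpi cpi2 rho by auto
  qed
  moreover have "(\<integral>\<theta>. F \<theta> \<partial>lborel) \<ge> 0" using F_nn by simp
  ultimately show ?thesis using F_val by simp
qed

lemma AE_lborel_norm_neq: "AE x in (lborel :: (real^'p) measure). norm x \<noteq> \<psi>"
proof -
  have "negligible (sphere (0 :: real^'p) \<psi>)" by (rule negligible_sphere)
  moreover have "sphere (0 :: real^'p) \<psi> \<in> sets borel" by simp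
  ultimately have "sphere (0 :: real^'p) \<psi> \<in> null_sets lborel"
    by (simp add: negligible_iff_null_sets null_sets_completion_iff)
  then show ?thesis by (rule AE_I') auto
qed

text \<open>The points excluded in \<open>rotation_average_pos\<close> form a hyperplane and a
  sphere, both null sets.\<close>

lemma curv2_pos: "curv2 > 0"
proof -
  have "(\<integral>x. dens x * curv x \<partial>lborel) > 0"
  proof (rule integral_pos_by_rotation)
    show "integrable lborel (\<lambda>x. dens x * curv x)" using integrable_curv by (simp add: integrable_P)
    have "negligible {x. e k1 \<bullet> x = 0}" by (rule negligible_hyperplane) simp
    moreover have "{x. e k1 \<bullet> x = 0} \<in> sets borel" by (intro borel_closed closed_hyperplane)
    ultimately have "{x. e k1 \<bullet> x = 0} \<in> null_sets lborel"
      by (simp add: negligible_iff_null_sets null_sets_completion_iff)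
    then have "AE x in lborel. x \<bullet> e k1 \<noteq> 0" by (rule AE_I') (auto simp: inner_commute)
    then show "AE x in lborel. set_integrable lborel {0..2*pi} (\<lambda>\<theta>. dens (rot \<theta> x) * curv (rot \<theta> x)) \<longrightarrow>
        (LBINT \<theta>:{0..2*pi}. dens (rot \<theta> x) * curv (rot \<theta> x)) > 0"
      using AE_lborel_norm_neq by eventually_elim (intro impI rotation_average_pos)
  qed
  then show ?thesis by (simp add: curv2_eq integral_P)
qed

end

subsection \<open>Averages of independent observations\<close>

text \<open>\<open>S\<close> need not be measurable; \<open>\<eta>\<close> bounds the asymptotic outer probability of its failure.\<close>

definition likely :: "'a measure \<Rightarrow> real \<Rightarrow> (nat \<Rightarrow> 'a \<Rightarrow> bool) \<Rightarrow> bool" where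
  "likely M \<eta> S \<longleftrightarrow> (\<forall>\<^sub>F n in sequentially. \<exists>A\<in>sets M. (\<forall>\<omega>\<in>A. S n \<omega>) \<and> measure M A \<ge> 1 - \<eta>)"

lemma likely_mono:
  assumes "likely M \<eta> S" and "\<forall>\<^sub>F n in sequentially. \<forall>\<omega>\<in>space M. S n \<omega> \<longrightarrow> S' n \<omega>"
  shows "likely M \<eta> S'"
  using assms unfolding likely_def
proof eventually_elim
  case (elim n)
  then obtain A where "A \<in> sets M" "\<forall>\<omega>\<in>A. S n \<omega>" "measure M A \<ge> 1 - \<eta>" by blast
  with elim(2) show ?case using sets.sets_into_space by blast
qed

lemma likely_mono':
  assumes "likely M \<eta> S" and "\<And>n \<omega>. n \<ge> 1 \<Longrightarrow> \<omega> \<in> space M \<Longrightarrow> S n \<omega> \<Longrightarrow> S' n \<omega>"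
  shows "likely M \<eta> S'"
  using assms(1) by (rule likely_mono) (use assms(2) in \<open>auto intro!: eventually_sequentiallyI[of 1]\<close>)

context prob_space
begin

lemma likely_conj:
  assumes "likely M \<eta> S" "likely M \<eta>' S'"
  shows "likely M (\<eta> + \<eta>') (\<lambda>n \<omega>. S n \<omega> \<and> S' n \<omega>)"
  using assms unfolding likely_def
proof eventually_elim
  case (elim n)
  then obtain A A' where A: "A \<in> events" "\<forall>\<omega>\<in>A. S n \<omega>" "prob A \<ge> 1 - \<eta>"
    and A': "A' \<in> events" "\<forall>\<omega>\<in>A'. S' n \<omega>" "prob A' \<ge> 1 - \<eta>'" by blast
  have "prob A + prob A' = prob (A \<union> A') + prob (A \<inter> A')"
    using A(1) A'(1) by (simp add: finite_measure_Union' finite_measure_Diff' Int_commute)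
  then have "prob (A \<inter> A') \<ge> 1 - (\<eta> + \<eta>')" using A(3) A'(3) prob_le_1[of "A \<union> A'"] by linarith
  then show ?case using A A' by (intro bexI[of _ "A \<inter> A'"]) auto
qed

lemma likely_measurable:
  assumes "\<And>n. {\<omega>\<in>space M. \<not> S n \<omega>} \<in> events" and "\<forall>\<^sub>F n in sequentially. prob {\<omega>\<in>space M. \<not> S n \<omega>} \<le> \<eta>"
  shows "likely M \<eta> S"
  unfolding likely_def using assms(2)
proof eventually_elim
  case (elim n)
  have "prob (space M - {\<omega>\<in>space M. \<not> S n \<omega>}) \<ge> 1 - \<eta>" using elim assms(1) by (subst prob_compl) auto
  then show ?case using assms(1) by (intro bexI[of _ "space M - {\<omega>\<in>space M. \<not> S n \<omega>}"]) auto
qed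

text \<open>Every single statement is available with every budget, so the induction can halve \<eta>
  at each step.\<close>

lemma likely_ball:
  assumes "finite I" "\<And>i \<eta>. i \<in> I \<Longrightarrow> \<eta> > 0 \<Longrightarrow> likely M \<eta> (S i)" "\<eta> > 0"
  shows "likely M \<eta> (\<lambda>n \<omega>. \<forall>i\<in>I. S i n \<omega>)"
  using assms
proof (induction I arbitrary: \<eta> rule: finite_induct)
  case empty
  then show ?case unfolding likely_def
    by (intro always_eventually allI bexI[of _ "space M"]) (auto simp: prob_space)
next
  case (insert i I)
  have "likely M (\<eta> / 2 + \<eta> / 2) (\<lambda>n \<omega>. S i n \<omega> \<and> (\<forall>i\<in>I. S i n \<omega>))"
    using insert by (intro likely_conj) auto
  then show ?case by simp
qed

end

section \<open>Laws of large numbers in probability\<close>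

locale iid_sample = prob_space M for M :: "'b measure" +
  fixes X :: "nat \<Rightarrow> 'b \<Rightarrow> 'c::{second_countable_topology, real_normed_vector}" and P :: "'c measure"
  assumes indep: "indep_vars (\<lambda>_. borel) X UNIV" and distr_X: "\<And>i. distr M borel (X i) = P"
begin

lemma X_meas [measurable]: "X i \<in> borel_measurable M"
  using indep by (auto simp: indep_vars_def)

lemma sets_P [simp, measurable_cong]: "sets P = sets borel"
  by (simp flip: distr_X[of 0])

lemma prob_space_law: "prob_space P"
  unfolding distr_X[of 0, symmetric] by (rule prob_space_distr) measurable

sublocale P: prob_space P by (rule prob_space_law)

lemma
  fixes f :: "'c \<Rightarrow> 'd::{banach, second_countable_topology}"
  assumes [measurable]: "f \<in> borel_measurable borel"
  shows integral_X: "(\<integral>\<omega>. f (X i \<omega>) \<partial>M) = (\<integral>x. f x \<partial>P)"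
    and integrable_X: "integrable M (\<lambda>\<omega>. f (X i \<omega>)) \<longleftrightarrow> integrable P f"
  unfolding distr_X[of i, symmetric] by (auto simp: integral_distr integrable_distr_eq)

definition avg :: "('c \<Rightarrow> real) \<Rightarrow> nat \<Rightarrow> 'b \<Rightarrow> real" where
  "avg f n \<omega> = (\<Sum>i<n. f (X i \<omega>)) / real n"

lemma avg_meas [measurable]:
  assumes [measurable]: "f \<in> borel_measurable borel"
  shows "avg f n \<in> borel_measurable M"
  unfolding avg_def by measurable

lemma avg_mono: "(\<And>x. f x \<le> g x) \<Longrightarrow> avg f n \<omega> \<le> avg g n \<omega>"
  unfolding avg_def by (intro divide_right_mono sum_mono) auto

lemma avg_diff: "avg (\<lambda>x. f x - g x) n \<omega> = avg f n \<omega> - avg g n \<omega>"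
  by (simp add: avg_def sum_subtractf diff_divide_distrib)

lemma avg_cmult: "avg (\<lambda>x. c * f x) n \<omega> = c * avg f n \<omega>"
  by (simp add: avg_def sum_distrib_left)

lemma avg_abs: "\<bar>avg f n \<omega>\<bar> \<le> avg (\<lambda>x. \<bar>f x\<bar>) n \<omega>"
  unfolding avg_def by (simp add: abs_divide divide_right_mono)

text \<open>Markov's inequality; the average has the mean of a single term, so the bound does not
  depend on n. This is what controls averaged remainders.\<close>

lemma likely_avg_le:
  assumes f: "integrable P f" "\<And>x. f x \<ge> 0" and e: "\<epsilon> > 0" and le: "(\<integral>x. f x \<partial>P) \<le> \<epsilon> * \<eta>"
  shows "likely M \<eta> (\<lambda>n \<omega>. avg f n \<omega> \<le> \<epsilon>)"
proof (rule likely_measurable)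
  have [measurable]: "f \<in> borel_measurable borel" using borel_measurable_integrable[OF f(1)] by simp
  show "{\<omega>\<in>space M. \<not> avg f n \<omega> \<le> \<epsilon>} \<in> events" for n by measurable
  show "\<forall>\<^sub>F n in sequentially. prob {\<omega>\<in>space M. \<not> avg f n \<omega> \<le> \<epsilon>} \<le> \<eta>"
  proof (rule eventually_sequentiallyI[of 1])
    fix n :: nat assume n: "1 \<le> n"
    have int: "integrable M (\<lambda>\<omega>. avg f n \<omega>)" unfolding avg_def using f(1) by (simp add: integrable_X)
    have mean: "(\<integral>\<omega>. avg f n \<omega> \<partial>M) = (\<integral>x. f x \<partial>P)"
      unfolding avg_def using f(1) n by (simp add: integral_X integrable_X)
    have "prob {\<omega>\<in>space M. avg f n \<omega> \<ge> \<epsilon>} \<le> (\<integral>x. f x \<partial>P) / \<epsilon>"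
      unfolding mean[symmetric]
      by (rule integral_Markov_inequality_measure[where A="{}"]) (use int e f(2) in \<open>auto simp: avg_def sum_nonneg\<close>)
    moreover have "prob {\<omega>\<in>space M. \<not> avg f n \<omega> \<le> \<epsilon>} \<le> prob {\<omega>\<in>space M. avg f n \<omega> \<ge> \<epsilon>}"
      by (rule finite_measure_mono) auto
    moreover have "(\<integral>x. f x \<partial>P) / \<epsilon> \<le> \<eta>" using le e by (simp add: pos_divide_le_eq mult.commute)
    ultimately show "prob {\<omega>\<in>space M. \<not> avg f n \<omega> \<le> \<epsilon>} \<le> \<eta>" by linarith
  qed
qed

text \<open>Independence and centring make the cross terms vanish.\<close>

lemma second_moment_sum:
  fixes g :: "'c \<Rightarrow> real"
  assumes [measurable]: "g \<in> borel_measurable borel" and g2: "integrable P (\<lambda>x. (g x)\<^sup>2)" and g0: "(\<integral>x. g x \<partial>P) = 0"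
  shows "integrable M (\<lambda>\<omega>. (\<Sum>i<n. g (X i \<omega>))\<^sup>2)"
    and "(\<integral>\<omega>. (\<Sum>i<n. g (X i \<omega>))\<^sup>2 \<partial>M) = real n * (\<integral>x. (g x)\<^sup>2 \<partial>P)"
proof -
  have g1: "integrable P g" by (rule P.square_integrable_imp_integrable[OF _ g2]) simp
  have ind: "indep_vars (\<lambda>_. borel) (\<lambda>i \<omega>. g (X i \<omega>)) UNIV"
    by (rule indep_vars_compose2[OF indep]) simp
  have cross: "integrable M (\<lambda>\<omega>. g (X i \<omega>) * g (X j \<omega>))" "(\<integral>\<omega>. g (X i \<omega>) * g (X j \<omega>) \<partial>M) = 0" if "i \<noteq> j" for i j
  proof -
    have sub: "indep_vars (\<lambda>_. borel) (\<lambda>i \<omega>. g (X i \<omega>)) {i, j}" by (rule indep_vars_subset[OF ind]) simp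
    have int: "integrable M (\<lambda>\<omega>. g (X k \<omega>))" for k using g1 by (simp add: integrable_X)
    show "integrable M (\<lambda>\<omega>. g (X i \<omega>) * g (X j \<omega>))"
      using indep_vars_integrable[OF _ sub int] that by simp
    show "(\<integral>\<omega>. g (X i \<omega>) * g (X j \<omega>) \<partial>M) = 0"
      using indep_vars_lebesgue_integral[OF _ sub int] that by (simp add: integral_X g0)
  qed
  have "integrable M (\<lambda>\<omega>. (\<Sum>i<n. g (X i \<omega>))\<^sup>2) \<and> (\<integral>\<omega>. (\<Sum>i<n. g (X i \<omega>))\<^sup>2 \<partial>M) = real n * (\<integral>x. (g x)\<^sup>2 \<partial>P)"
  proof (induction n)
    case (Suc n)
    have eq: "(\<Sum>i<Suc n. g (X i \<omega>))\<^sup>2 = (\<Sum>i<n. g (X i \<omega>))\<^sup>2 + 2 * (\<Sum>i<n. g (X i \<omega>) * g (X n \<omega>)) + (g (X n \<omega>))\<^sup>2" for \<omega>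
      by (simp add: power2_eq_square algebra_simps sum_distrib_left sum_distrib_right)
    have c: "integrable M (\<lambda>\<omega>. \<Sum>i<n. g (X i \<omega>) * g (X n \<omega>))"
      by (intro Bochner_Integration.integrable_sum cross) auto
    have c0: "(\<integral>\<omega>. (\<Sum>i<n. g (X i \<omega>) * g (X n \<omega>)) \<partial>M) = 0"
      by (subst Bochner_Integration.integral_sum) (auto intro!: cross sum.neutral)
    have q: "integrable M (\<lambda>\<omega>. (g (X n \<omega>))\<^sup>2)" "(\<integral>\<omega>. (g (X n \<omega>))\<^sup>2 \<partial>M) = (\<integral>x. (g x)\<^sup>2 \<partial>P)"
      using g2 integrable_X[of "\<lambda>x. (g x)\<^sup>2"] integral_X[of "\<lambda>x. (g x)\<^sup>2"] by auto
    show ?case unfolding eq using Suc c c0 q by (simp add: algebra_simps)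
  qed simp
  then show "integrable M (\<lambda>\<omega>. (\<Sum>i<n. g (X i \<omega>))\<^sup>2)"
    and "(\<integral>\<omega>. (\<Sum>i<n. g (X i \<omega>))\<^sup>2 \<partial>M) = real n * (\<integral>x. (g x)\<^sup>2 \<partial>P)" by auto
qed

lemma prob_abs_sum_le:
  fixes g :: "'c \<Rightarrow> real"
  assumes [measurable]: "g \<in> borel_measurable borel" and g2: "integrable P (\<lambda>x. (g x)\<^sup>2)" and g0: "(\<integral>x. g x \<partial>P) = 0"
    and t: "t > 0"
  shows "prob {\<omega>\<in>space M. \<not> \<bar>\<Sum>i<n. g (X i \<omega>)\<bar> \<le> t} \<le> real n * (\<integral>x. (g x)\<^sup>2 \<partial>P) / t\<^sup>2"
proof -
  have "prob {\<omega>\<in>space M. (\<Sum>i<n. g (X i \<omega>))\<^sup>2 \<ge> t\<^sup>2} \<le> (\<integral>\<omega>. (\<Sum>i<n. g (X i \<omega>))\<^sup>2 \<partial>M) / t\<^sup>2"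
    by (rule integral_Markov_inequality_measure[where A="{}"]) (use second_moment_sum(1)[OF assms(1-3)] t in auto)
  moreover have "prob {\<omega>\<in>space M. \<not> \<bar>\<Sum>i<n. g (X i \<omega>)\<bar> \<le> t} \<le> prob {\<omega>\<in>space M. (\<Sum>i<n. g (X i \<omega>))\<^sup>2 \<ge> t\<^sup>2}"
  proof (rule finite_measure_mono)
    show "{\<omega>\<in>space M. \<not> \<bar>\<Sum>i<n. g (X i \<omega>)\<bar> \<le> t} \<subseteq> {\<omega>\<in>space M. (\<Sum>i<n. g (X i \<omega>))\<^sup>2 \<ge> t\<^sup>2}"
    proof safe
      fix \<omega> assume "\<not> \<bar>\<Sum>i<n. g (X i \<omega>)\<bar> \<le> t"
      then have "t\<^sup>2 \<le> \<bar>\<Sum>i<n. g (X i \<omega>)\<bar>\<^sup>2" using t by (intro power_mono) auto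
      then show "t\<^sup>2 \<le> (\<Sum>i<n. g (X i \<omega>))\<^sup>2" by simp
    qed
  qed measurable
  ultimately show ?thesis unfolding second_moment_sum(2)[OF assms(1-3)] by linarith
qed

lemma likely_sum_sqrt:
  fixes g :: "'c \<Rightarrow> real"
  assumes [measurable]: "g \<in> borel_measurable borel" and g2: "integrable P (\<lambda>x. (g x)\<^sup>2)" and g0: "(\<integral>x. g x \<partial>P) = 0"
    and eta: "\<eta> > 0"
  shows "\<exists>K>0. likely M \<eta> (\<lambda>n \<omega>. \<bar>\<Sum>i<n. g (X i \<omega>)\<bar> \<le> K * sqrt (real n))"
proof -
  define V where "V = (\<integral>x. (g x)\<^sup>2 \<partial>P)"
  have V: "V \<ge> 0" by (simp add: V_def)
  \<comment> \<open>Chebyshev's bound is V / K^2; the added 1 keeps K positive when V = 0.\<close>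
  define K where "K = sqrt (V / \<eta>) + 1"
  have K: "K > 0" using V eta by (simp add: K_def add_nonneg_pos)
  have "V / \<eta> = (sqrt (V / \<eta>))\<^sup>2" using V eta by simp
  also have "\<dots> \<le> K\<^sup>2" unfolding K_def using V eta by (intro power_mono) auto
  finally have VK: "V / K\<^sup>2 \<le> \<eta>" using K eta by (simp add: field_simps)
  have "likely M \<eta> (\<lambda>n \<omega>. \<bar>\<Sum>i<n. g (X i \<omega>)\<bar> \<le> K * sqrt (real n))"
  proof (rule likely_measurable)
    show "\<forall>\<^sub>F n in sequentially. prob {\<omega>\<in>space M. \<not> \<bar>\<Sum>i<n. g (X i \<omega>)\<bar> \<le> K * sqrt (real n)} \<le> \<eta>"
    proof (rule eventually_sequentiallyI[of 1])
      fix n :: nat assume n: "1 \<le> n"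
      have "prob {\<omega>\<in>space M. \<not> \<bar>\<Sum>i<n. g (X i \<omega>)\<bar> \<le> K * sqrt (real n)} \<le> real n * V / (K * sqrt (real n))\<^sup>2"
        unfolding V_def using K n by (intro prob_abs_sum_le g2 g0) auto
      also have "\<dots> = V / K\<^sup>2" using n by (simp add: power_mult_distrib)
      finally show "prob {\<omega>\<in>space M. \<not> \<bar>\<Sum>i<n. g (X i \<omega>)\<bar> \<le> K * sqrt (real n)} \<le> \<eta>" using VK by simp
    qed
  qed measurable
  then show ?thesis using K by blast
qed

lemma weak_law_bounded:
  fixes f :: "'c \<Rightarrow> real"
  assumes [measurable]: "f \<in> borel_measurable borel" and B: "\<And>x. \<bar>f x\<bar> \<le> B" and e: "\<epsilon> > 0" and eta: "\<eta> > 0"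
  shows "likely M \<eta> (\<lambda>n \<omega>. \<bar>avg f n \<omega> - (\<integral>x. f x \<partial>P)\<bar> \<le> \<epsilon>)"
proof -
  define \<mu> where "\<mu> = (\<integral>x. f x \<partial>P)"
  define g where "g x = f x - \<mu>" for x
  have [measurable]: "g \<in> borel_measurable borel" unfolding g_def by measurable
  have fi: "integrable P f" by (rule P.integrable_const_bound[where B=B]) (auto simp: B)
  have g2: "integrable P (\<lambda>x. (g x)\<^sup>2)"
  proof (rule P.integrable_const_bound[where B="(B + \<bar>\<mu>\<bar>)\<^sup>2"])
    show "AE x in P. norm ((g x)\<^sup>2) \<le> (B + \<bar>\<mu>\<bar>)\<^sup>2"
    proof (rule AE_I2)
      fix x
      have "\<bar>g x\<bar> \<le> B + \<bar>\<mu>\<bar>" using B[of x] by (simp add: g_def)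
      then have "\<bar>g x\<bar>\<^sup>2 \<le> (B + \<bar>\<mu>\<bar>)\<^sup>2" by (intro power_mono) auto
      then show "norm ((g x)\<^sup>2) \<le> (B + \<bar>\<mu>\<bar>)\<^sup>2" by simp
    qed
  qed measurable
  have g0: "(\<integral>x. g x \<partial>P) = 0" unfolding g_def using fi by (simp add: \<mu>_def P.prob_space)
  obtain K where K: "K > 0" "likely M \<eta> (\<lambda>n \<omega>. \<bar>\<Sum>i<n. g (X i \<omega>)\<bar> \<le> K * sqrt (real n))"
    using likely_sum_sqrt[OF _ g2 g0 eta] by auto
  have ev: "\<forall>\<^sub>F n in sequentially. real n \<ge> (K / \<epsilon>)\<^sup>2 \<and> n \<ge> 1"
    by (intro eventually_conj eventually_ge_at_top eventually_sequentiallyI[of "nat \<lceil>(K / \<epsilon>)\<^sup>2\<rceil>"]) linarith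
  show ?thesis
  proof (rule likely_mono[OF K(2)])
    show "\<forall>\<^sub>F n in sequentially. \<forall>\<omega>\<in>space M. \<bar>\<Sum>i<n. g (X i \<omega>)\<bar> \<le> K * sqrt (real n) \<longrightarrow>
        \<bar>avg f n \<omega> - (\<integral>x. f x \<partial>P)\<bar> \<le> \<epsilon>"
      using ev
    proof eventually_elim
      case (elim n)
      have "K / \<epsilon> \<le> sqrt (real n)" using elim by (intro real_le_rsqrt) auto
      then have "K \<le> \<epsilon> * sqrt (real n)" using e by (simp add: pos_divide_le_eq mult.commute)
      then have "K * sqrt (real n) \<le> (\<epsilon> * sqrt (real n)) * sqrt (real n)" by (intro mult_right_mono) auto
      then have Kn: "K * sqrt (real n) \<le> \<epsilon> * real n" by (simp only: mult.assoc real_sqrt_mult_self abs_of_nat)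
      show ?case
      proof (intro ballI impI)
        fix \<omega> assume S: "\<bar>\<Sum>i<n. g (X i \<omega>)\<bar> \<le> K * sqrt (real n)"
        have "(\<Sum>i<n. g (X i \<omega>)) = real n * (avg f n \<omega> - \<mu>)"
          using elim by (simp add: g_def sum_subtractf avg_def field_simps)
        then have "real n * \<bar>avg f n \<omega> - \<mu>\<bar> \<le> real n * \<epsilon>" using S Kn by (simp add: abs_mult mult.commute)
        then show "\<bar>avg f n \<omega> - (\<integral>x. f x \<partial>P)\<bar> \<le> \<epsilon>" using elim by (simp add: \<mu>_def)
      qed
    qed
  qed
qed

text \<open>Truncation: Chebyshev's inequality handles the bounded part and Markov's inequality the
  tail, whose mean is small. A first moment is all that the envelope provides for the Hessian
  entries.\<close>

theorem weak_law:
  assumes f: "integrable P f" and e: "\<epsilon> > 0" and eta: "\<eta> > 0"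
  shows "likely M \<eta> (\<lambda>n \<omega>. \<bar>avg f n \<omega> - (\<integral>x. f x \<partial>P)\<bar> \<le> \<epsilon>)"
proof -
  have [measurable]: "f \<in> borel_measurable borel" using borel_measurable_integrable[OF f] by simp
  define f1 where "f1 L x = (if \<bar>f x\<bar> \<le> real L then f x else 0)" for L :: nat and x
  have [measurable]: "f1 L \<in> borel_measurable borel" for L unfolding f1_def by measurable
  have "(\<lambda>L. \<integral>x. \<bar>f x - f1 L x\<bar> \<partial>P) \<longlonglongrightarrow> (\<integral>x. 0 \<partial>P)"
  proof (rule integral_dominated_convergence[where w="\<lambda>x. \<bar>f x\<bar>"])
    show "AE x in P. (\<lambda>L. \<bar>f x - f1 L x\<bar>) \<longlonglongrightarrow> 0"
    proof (rule AE_I2)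
      fix x
      obtain L0 :: nat where "\<bar>f x\<bar> \<le> real L0" using real_arch_simple by blast
      then have "\<forall>\<^sub>F L in sequentially. \<bar>f x - f1 L x\<bar> = 0"
        by (intro eventually_sequentiallyI[of L0]) (auto simp: f1_def)
      then show "(\<lambda>L. \<bar>f x - f1 L x\<bar>) \<longlonglongrightarrow> 0" by (rule tendsto_eventually)
    qed
  qed (use f in \<open>auto simp: f1_def\<close>)
  then have "\<forall>\<^sub>F L in sequentially. (\<integral>x. \<bar>f x - f1 L x\<bar> \<partial>P) < min (\<epsilon> / 3) (\<epsilon> / 3 * (\<eta> / 2))"
    using e eta by (intro order_tendstoD) auto
  \<comment> \<open>The first bound serves the difference of the expectations, the second Markov's
    inequality at level \<epsilon> / 3 and probability \<eta> / 2.\<close>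
  then obtain L where L: "(\<integral>x. \<bar>f x - f1 L x\<bar> \<partial>P) < min (\<epsilon> / 3) (\<epsilon> / 3 * (\<eta> / 2))"
    by (auto simp: eventually_sequentially)
  have i1: "integrable P (f1 L)" by (rule P.integrable_const_bound[where B="real L"]) (auto simp: f1_def)
  have id: "integrable P (\<lambda>x. \<bar>f x - f1 L x\<bar>)" using f i1 by simp
  have "likely M (\<eta> / 2) (\<lambda>n \<omega>. \<bar>avg (f1 L) n \<omega> - (\<integral>x. f1 L x \<partial>P)\<bar> \<le> \<epsilon> / 3)"
    using e eta by (intro weak_law_bounded[where B="real L"]) (auto simp: f1_def)
  moreover have "likely M (\<eta> / 2) (\<lambda>n \<omega>. avg (\<lambda>x. \<bar>f x - f1 L x\<bar>) n \<omega> \<le> \<epsilon> / 3)"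
    using id e L by (intro likely_avg_le) auto
  ultimately have "likely M (\<eta> / 2 + \<eta> / 2) (\<lambda>n \<omega>. \<bar>avg (f1 L) n \<omega> - (\<integral>x. f1 L x \<partial>P)\<bar> \<le> \<epsilon> / 3 \<and>
      avg (\<lambda>x. \<bar>f x - f1 L x\<bar>) n \<omega> \<le> \<epsilon> / 3)" by (rule likely_conj)
  then have "likely M \<eta> (\<lambda>n \<omega>. \<bar>avg (f1 L) n \<omega> - (\<integral>x. f1 L x \<partial>P)\<bar> \<le> \<epsilon> / 3 \<and>
      avg (\<lambda>x. \<bar>f x - f1 L x\<bar>) n \<omega> \<le> \<epsilon> / 3)" by simp
  then show ?thesis
  proof (rule likely_mono')
    fix n \<omega>
    assume S: "\<bar>avg (f1 L) n \<omega> - (\<integral>x. f1 L x \<partial>P)\<bar> \<le> \<epsilon> / 3 \<and> avg (\<lambda>x. \<bar>f x - f1 L x\<bar>) n \<omega> \<le> \<epsilon> / 3"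
    have "\<bar>avg f n \<omega> - avg (f1 L) n \<omega>\<bar> \<le> avg (\<lambda>x. \<bar>f x - f1 L x\<bar>) n \<omega>"
      unfolding avg_diff[symmetric] by (rule avg_abs)
    moreover have "\<bar>(\<integral>x. f x \<partial>P) - (\<integral>x. f1 L x \<partial>P)\<bar> \<le> (\<integral>x. \<bar>f x - f1 L x\<bar> \<partial>P)"
      using integral_abs_bound[of P "\<lambda>x. f x - f1 L x"] f i1 by simp
    ultimately show "\<bar>avg f n \<omega> - (\<integral>x. f x \<partial>P)\<bar> \<le> \<epsilon>" using S L by linarith
  qed
qed

end

subsection \<open>The data-dependent ball\<close>

lemma emp_prob_le_1: "emp_prob n x A \<le> 1"
proof -
  have "card {i. i < n \<and> x i \<in> A} \<le> card {..<n}" by (intro card_mono) auto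
  then show ?thesis by (cases "n = 0") (auto simp: emp_prob_def divide_le_eq)
qed

text \<open>An observation in the ball contributes at least |u|^2 - 2 |u| r, any other at least
  -|u|^2.\<close>

lemma emp_obj_lower:
  assumes n: "n \<ge> 1" and r: "r \<ge> 0"
  shows "emp_obj n x u \<ge> (2 * emp_prob n x (cball 0 r) - 1) * (norm u)\<^sup>2 - 2 * emp_prob n x (cball 0 r) * norm u * r"
proof -
  let ?h = "norm u"
  let ?I = "\<lambda>i. if x i \<in> cball 0 r then (1::real) else 0"
  have card: "(\<Sum>i<n. ?I i) = real n * emp_prob n x (cball 0 r)"
  proof -
    have "(\<Sum>i<n. ?I i) = real (card {i \<in> {..<n}. x i \<in> cball 0 r})"
      by (simp add: sum.If_cases Int_def)
    then show ?thesis using n by (simp add: emp_prob_def)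
  qed
  have "loss u (x i) \<ge> ?I i * (2 * ?h\<^sup>2 - 2 * ?h * r) - ?h\<^sup>2" for i
  proof (cases "x i \<in> cball 0 r")
    case True
    then have "norm (x i) \<le> r" by (simp only: mem_cball_0)
    then have "2 * ?h * norm (x i) \<le> 2 * ?h * r" by (intro mult_left_mono) auto
    then show ?thesis using loss_lower[of u "x i"] True by simp
  next
    case False
    then show ?thesis using abs_loss_le[of u "x i"] by simp
  qed
  then have "(\<Sum>i<n. loss u (x i)) \<ge> (\<Sum>i<n. ?I i * (2 * ?h\<^sup>2 - 2 * ?h * r) - ?h\<^sup>2)" by (intro sum_mono)
  also have "(\<Sum>i<n. ?I i * (2 * ?h\<^sup>2 - 2 * ?h * r) - ?h\<^sup>2) = (\<Sum>i<n. ?I i) * (2 * ?h\<^sup>2 - 2 * ?h * r) - real n * ?h\<^sup>2"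
    unfolding sum_subtractf sum_distrib_right[symmetric] by simp
  also have "\<dots> = real n * ((2 * emp_prob n x (cball 0 r) - 1) * ?h\<^sup>2 - 2 * emp_prob n x (cball 0 r) * ?h * r)"
    unfolding card by (simp add: algebra_simps)
  finally show ?thesis using n by (simp add: emp_obj_def pos_le_divide_eq mult.commute)
qed

lemma emp_obj_0: "emp_obj n x 0 = 0"
  by (simp add: emp_obj_def loss_def power2_eq_square)

text \<open>The empirical distribution function is a step function that jumps at data points, so the
  infimum over all real levels is a minimum attained at one of the data.\<close>

lemma quantile_attained:
  fixes y :: "nat \<Rightarrow> real"
  assumes n: "n \<ge> 1" and y: "\<And>i. y i \<ge> 0" and q: "0 < q" "q \<le> 1"
  shows "emp_prob n y {..quantile q (emp_prob n y)} \<ge> q" "quantile q (emp_prob n y) \<ge> 0"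
proof -
  define D where "D = y ` {..<n}"
  define S where "S = {t. emp_prob n y {..t} \<ge> q}"
  have D: "finite D" "D \<noteq> {}" using n by (auto simp: D_def lessThan_empty_iff)
  have "Max D \<in> S"
  proof -
    have "y i \<le> Max D" if "i < n" for i using D that by (intro Max_ge) (auto simp: D_def)
    then have "{i. i < n \<and> y i \<in> {..Max D}} = {..<n}" by auto
    then show ?thesis using n q by (simp add: S_def emp_prob_def)
  qed
  then have SD: "finite (S \<inter> D)" "S \<inter> D \<noteq> {}" using D(1) Max_in[OF D] by blast+
  define m where "m = Min (S \<inter> D)"
  have m: "m \<in> S" "m \<in> D" using Min_in[OF SD] by (auto simp: m_def)
  have "m \<le> t" if "t \<in> S" for t
  proof -
    have "emp_prob n y {..t} > 0" using that q by (simp add: S_def)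
    then have "{i. i < n \<and> y i \<in> {..t}} \<noteq> {}" by (auto simp: emp_prob_def zero_less_divide_iff card_gt_0_iff)
    then have E: "finite {d\<in>D. d \<le> t}" "{d\<in>D. d \<le> t} \<noteq> {}" using D by (auto simp: D_def)
    \<comment> \<open>Lowering a level to the largest data point not above it loses no mass.\<close>
    define t' where "t' = Max {d\<in>D. d \<le> t}"
    have t': "t' \<in> D" "t' \<le> t" using Max_in[OF E] by (auto simp: t'_def)
    have "y i \<le> t' \<longleftrightarrow> y i \<le> t" if "i < n" for i
    proof
      assume "y i \<le> t"
      then show "y i \<le> t'" unfolding t'_def using E that by (intro Max_ge) (auto simp: D_def)
    qed (use t' in simp)
    then have "{i. i < n \<and> y i \<in> {..t'}} = {i. i < n \<and> y i \<in> {..t}}" by auto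
    then have "t' \<in> S" using that by (simp add: S_def emp_prob_def)
    then have "m \<le> t'" unfolding m_def using SD t' by (intro Min_le) auto
    then show ?thesis using t' by simp
  qed
  then have "Inf S = m" using m(1) by (intro cInf_eq_minimum)
  then have *: "quantile q (emp_prob n y) = m" by (simp add: quantile_def S_def)
  show "emp_prob n y {..quantile q (emp_prob n y)} \<ge> q" unfolding * using m(1) by (simp add: S_def)
  show "quantile q (emp_prob n y) \<ge> 0" unfolding * using m(2) y by (auto simp: D_def)
qed

text \<open>At the quantile the ball holds at least 3/4 of the sample, so the leading coefficient
  \<alpha> is at least 1/2 and \<open>y_poly\<close> is positive beyond its larger root. Evaluated
  at |u| it bounds the sample objective from below.\<close>

lemma H0_bounds:
  fixes x :: "nat \<Rightarrow> real^'p"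
  assumes n: "n \<ge> 1"
  shows "H0 n x \<ge> 0" and "norm u > H0 n x \<Longrightarrow> emp_obj n x u > 0"
proof -
  define r where "r = R0 n x"
  define w where "w = emp_prob n x (cball 0 r)"
  have w_eq: "w = emp_prob n (\<lambda>i. norm (x i)) {..r}"
    unfolding w_def emp_prob_def by (simp only: mem_cball_0 atMost_iff)
  have w: "w \<ge> 3/4" and r: "r \<ge> 0"
    using quantile_attained[OF n, of "\<lambda>i. norm (x i)" "0.75"] unfolding w_eq r_def R0_def by auto
  have w1: "w \<le> 1" unfolding w_def by (rule emp_prob_le_1)
  define \<alpha> where "\<alpha> = 2 * w - 1"
  have \<alpha>: "\<alpha> > 0" using w by (simp add: \<alpha>_def)
  have y: "y_poly n x h = \<alpha> * h\<^sup>2 - 2 * h * r - r\<^sup>2" for h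
    by (simp add: y_poly_def r_def w_def \<alpha>_def emp_obj_0)
  \<comment> \<open>The discriminant is 4 r^2 (1 + \<alpha>). For r = 0 both roots are 0 and the
    factorization still holds.\<close>
  define d where "d = sqrt (1 + \<alpha>)"
  have d2: "d\<^sup>2 = 1 + \<alpha>" using \<alpha> by (simp add: d_def)
  have d1: "d \<ge> 1" using \<alpha> by (simp add: d_def)
  define h1 where "h1 = r * (1 + d) / \<alpha>"
  define h2 where "h2 = r * (1 - d) / \<alpha>"
  have fact: "y_poly n x h = \<alpha> * ((h - h1) * (h - h2))" for h
  proof -
    have "\<alpha> * ((h - h1) * (h - h2)) = \<alpha> * h\<^sup>2 - 2 * h * r + r\<^sup>2 * (1 - d\<^sup>2) / \<alpha>"
      using \<alpha> by (simp add: h1_def h2_def field_simps power2_eq_square)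
    then show ?thesis using \<alpha> by (simp add: y d2)
  qed
  have roots: "{h. y_poly n x h = 0} = {h1, h2}" using \<alpha> by (auto simp: fact)
  have h1: "h1 \<ge> 0" using r d1 \<alpha> by (simp add: h1_def)
  have h12: "h2 \<le> h1" unfolding h1_def h2_def using r d1 \<alpha> by (intro divide_right_mono mult_left_mono) auto
  have H: "H0 n x = h1" unfolding H0_def roots using h12 by simp
  show "H0 n x \<ge> 0" using h1 H by simp
  assume u: "norm u > H0 n x"
  let ?h = "norm u"
  have "0 < y_poly n x ?h" unfolding fact using u \<alpha> h12 H by (intro mult_pos_pos) auto
  also have "\<dots> \<le> \<alpha> * ?h\<^sup>2 - 2 * w * ?h * r"
  proof -
    have "w * (?h * r) \<le> 1 * (?h * r)" using w1 r by (intro mult_right_mono) auto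
    then show ?thesis using zero_le_power2[of r] unfolding y mult.assoc by linarith
  qed
  also have "\<dots> \<le> emp_obj n x u" using emp_obj_lower[OF n r, of x u] by (simp add: w_def \<alpha>_def)
  finally show "emp_obj n x u > 0" .
qed

text \<open>Beyond \<open>H0\<close> every value exceeds the one at the origin, and the origin is a
  competitor in the ball. Afterwards global minimality stands in for the random radius.\<close>

lemma ball_minimizer_is_global:
  fixes x :: "nat \<Rightarrow> real^'p"
  assumes n: "n \<ge> 1" and w: "is_arg_min (emp_obj n x) (\<lambda>w. w \<in> cball 0 (H n x + 1/2)) w"
  shows "emp_obj n x w \<le> emp_obj n x u"
proof -
  have min: "emp_obj n x w \<le> emp_obj n x u" if "norm u \<le> H n x + 1/2" for u
    using w that unfolding is_arg_min_linorder mem_cball_0 by blast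
  have H: "H n x = H0 n x + 1" by (simp add: H_def)
  show ?thesis
  proof (cases "norm u \<le> H0 n x")
    case False
    have "emp_obj n x w \<le> emp_obj n x 0" using H0_bounds(1)[OF n, of x] by (intro min) (simp add: H)
    also have "\<dots> < emp_obj n x u" unfolding emp_obj_0 using False by (intro H0_bounds(2)[OF n]) simp
    finally show ?thesis by simp
  qed (auto intro!: min simp: H)
qed

subsection \<open>Asymptotics of the estimator\<close>

locale sampling = elliptical_min P e k1 k2 a \<kappa> \<psi> + smp: iid_sample M X P
  for P :: "(real^'p) measure" and e k1 k2 a \<kappa> \<psi> and M :: "'b measure" and X :: "nat \<Rightarrow> 'b \<Rightarrow> real^'p" +
  fixes v :: "nat \<Rightarrow> 'b \<Rightarrow> real^'p"
  assumes v_meas [measurable]: "\<And>n. v n \<in> borel_measurable M"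
    and unique: "\<And>w. (\<And>u. obj P w \<le> obj P u) \<Longrightarrow> w = \<psi> *\<^sub>R e k1 \<or> w = - (\<psi> *\<^sub>R e k1)"
    and v_min: "\<And>n \<omega> u. n \<ge> 1 \<Longrightarrow> \<omega> \<in> space M \<Longrightarrow> emp_obj n (\<lambda>i. X i \<omega>) (v n \<omega>) \<le> emp_obj n (\<lambda>i. X i \<omega>) u"
begin

lemma emp_obj_avg: "emp_obj n (\<lambda>i. X i \<omega>) w = smp.avg (loss w) n \<omega>"
  by (simp add: emp_obj_def smp.avg_def)

text \<open>A fixed ball with population mass above 7/8 has sample mass at least 3/4 with high
  probability, and \<open>emp_obj_lower\<close> then confines the minimizer to a nonrandom
  radius.\<close>

lemma estimator_tight: "\<exists>R>0. \<forall>\<eta>>0. likely M \<eta> (\<lambda>n \<omega>. norm (v n \<omega>) \<le> R)"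
proof -
  obtain K where K: "K > 0" "prob {x\<in>space P. norm x > K} < 1/8"
    using tight_norm[of "\<lambda>x. x" "1/8"] by auto
  let ?f = "indicator (cball 0 K) :: real^'p \<Rightarrow> real"
  have B: "cball (0 :: real^'p) K \<in> sets borel" by simp
  have "prob (cball 0 K) = 1 - prob {x\<in>space P. norm x > K}"
  proof -
    have "space P - cball 0 K = {x\<in>space P. norm x > K}" by auto
    then show ?thesis using prob_compl[of "cball 0 K"] B by simp
  qed
  then have pB: "(\<integral>x. ?f x \<partial>P) > 7/8" using K(2) by simp
  have fi: "integrable P ?f"
    using borel_measurable_indicator[OF B, where 'b=real] by (intro integrable_const_bound[where B=1]) (auto simp: indicator_def)
  have "likely M \<eta> (\<lambda>n \<omega>. norm (v n \<omega>) \<le> 5 * K)" if "\<eta> > 0" for \<eta>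
  proof (rule likely_mono')
    show "likely M \<eta> (\<lambda>n \<omega>. \<bar>smp.avg ?f n \<omega> - (\<integral>x. ?f x \<partial>P)\<bar> \<le> 1/8)"
      by (rule smp.weak_law[OF fi]) (use that in auto)
  next
    fix n :: nat and \<omega> assume n: "n \<ge> 1" and w: "\<omega> \<in> space M" and A: "\<bar>smp.avg ?f n \<omega> - (\<integral>x. ?f x \<partial>P)\<bar> \<le> 1/8"
    define x where "x i = X i \<omega>" for i
    define q where "q = emp_prob n x (cball 0 K)"
    have "q = smp.avg ?f n \<omega>"
    proof -
      have "(\<Sum>i<n. ?f (X i \<omega>)) = real (card {i \<in> {..<n}. X i \<omega> \<in> cball 0 K})"
        unfolding indicator_def by (simp add: sum.If_cases Int_def)
      then show ?thesis by (simp add: q_def emp_prob_def smp.avg_def x_def)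
    qed
    then have q: "q \<ge> 3/4" using A pB by linarith
    have q1: "q \<le> 1" unfolding q_def by (rule emp_prob_le_1)
    let ?h = "norm (v n \<omega>)"
    show "?h \<le> 5 * K"
    proof (rule ccontr)
      assume "\<not> ?h \<le> 5 * K"
      then have h: "?h > 5 * K" by simp
      \<comment> \<open>The objective at the minimizer is at most 0 but at least h^2 / 2 - 2 h K,
        which is positive for h > 4 K; the radius 5 K leaves a margin.\<close>
      have "(1/2) * ?h\<^sup>2 \<le> (2 * q - 1) * ?h\<^sup>2" using q by (intro mult_right_mono) auto
      moreover have "q * (?h * K) \<le> 1 * (?h * K)" using q1 K by (intro mult_right_mono) auto
      moreover have "?h * (5 * K) \<le> ?h\<^sup>2" unfolding power2_eq_square using h by (intro mult_left_mono) auto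
      moreover have "?h * K > 0" using h K by (intro mult_pos_pos) auto
      moreover have "(2 * q - 1) * ?h\<^sup>2 - 2 * q * ?h * K \<le> emp_obj n x (v n \<omega>)"
        unfolding q_def using K by (intro emp_obj_lower n) auto
      moreover have "emp_obj n x (v n \<omega>) \<le> emp_obj n x 0" unfolding x_def by (rule v_min[OF n w])
      ultimately show False unfolding emp_obj_0 mult.assoc by linarith
    qed
  qed
  then show ?thesis using K(1) by (intro exI[of _ "5 * K"]) auto
qed

lemma loss_lipschitz_ball:
  assumes "norm w \<le> R" "norm w' \<le> R"
  shows "\<bar>loss w x - loss w' x\<bar> \<le> norm (w - w') * (2 * norm x + 4 * R)"
proof -
  have "norm (w - w') \<le> 2 * R" using norm_triangle_ineq4[of w w'] assms by linarith
  then have "norm (w - w') * (2 * norm x + 2 * norm w' + norm (w - w')) \<le> norm (w - w') * (2 * norm x + 4 * R)"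
    using assms by (intro mult_left_mono) auto
  then show ?thesis using loss_lipschitz[of w x w'] by linarith
qed

lemma obj_lipschitz_ball:
  assumes "norm w \<le> R" "norm w' \<le> R"
  shows "\<bar>obj P w - obj P w'\<bar> \<le> norm (w - w') * (\<integral>x. 2 * norm x + 4 * R \<partial>P)"
proof -
  have "\<bar>obj P w - obj P w'\<bar> = \<bar>\<integral>x. loss w x - loss w' x \<partial>P\<bar>"
    unfolding obj_def by (simp add: integrable_loss)
  also have "\<dots> \<le> (\<integral>x. \<bar>loss w x - loss w' x\<bar> \<partial>P)" by (rule integral_abs_bound)
  also have "\<dots> \<le> (\<integral>x. norm (w - w') * (2 * norm x + 4 * R) \<partial>P)"
    using loss_lipschitz_ball[OF assms] integrable_norm by (intro integral_mono) (auto simp: integrable_loss)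
  finally show ?thesis by simp
qed

text \<open>A finite net of the ball leaves finitely many laws of large numbers. Between net points
  the oscillation is controlled by an integrable Lipschitz constant, whose sample mean obeys the law
  as well.\<close>

lemma uniform_law:
  assumes R: "R > 0" and ep: "\<epsilon> > 0" and eta: "\<eta> > 0"
  shows "likely M \<eta> (\<lambda>n \<omega>. \<forall>w. norm w \<le> R \<longrightarrow> \<bar>smp.avg (loss w) n \<omega> - obj P w\<bar> \<le> \<epsilon>)"
proof -
  let ?L = "\<lambda>x :: real^'p. 2 * norm x + 4 * R"
  have Li: "integrable P ?L" using integrable_norm by simp
  define L where "L = (\<integral>x. ?L x \<partial>P) + 1"
  have "(\<integral>x. ?L x \<partial>P) \<ge> 0" using R by (intro integral_nonneg_AE) auto
  then have L: "L \<ge> 1" by (simp add: L_def)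
  \<comment> \<open>The two oscillation errors are at most \<epsilon> / 4 each and the error at the
    net point \<epsilon> / 2. The 1 in \<open>L\<close> allows for the deviation of the averaged
    Lipschitz constant.\<close>
  define \<delta> where "\<delta> = \<epsilon> / (4 * L)"
  have d: "\<delta> > 0" "\<delta> * L = \<epsilon> / 4" using ep L by (auto simp: \<delta>_def)
  have "seq_compact (cball (0 :: real^'p) R)" by (simp add: compact_imp_seq_compact)
  then have "\<exists>T. finite T \<and> T \<subseteq> cball 0 R \<and> cball (0 :: real^'p) R \<subseteq> (\<Union>t\<in>T. ball t \<delta>)"
    using seq_compact_imp_totally_bounded d(1) by metis
  then obtain T where "finite T \<and> T \<subseteq> cball 0 R \<and> cball (0 :: real^'p) R \<subseteq> (\<Union>t\<in>T. ball t \<delta>)" ..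
  then have T: "finite T" "T \<subseteq> cball 0 R" "cball (0 :: real^'p) R \<subseteq> (\<Union>t\<in>T. ball t \<delta>)" by simp_all
  have "likely M (\<eta> / 2) (\<lambda>n \<omega>. \<forall>t\<in>T. \<bar>smp.avg (loss t) n \<omega> - (\<integral>x. loss t x \<partial>P)\<bar> \<le> \<epsilon> / 2)"
    using eta ep by (intro smp.likely_ball T(1) smp.weak_law integrable_loss) auto
  moreover have "likely M (\<eta> / 2) (\<lambda>n \<omega>. \<bar>smp.avg ?L n \<omega> - (\<integral>x. ?L x \<partial>P)\<bar> \<le> 1)"
    using eta by (intro smp.weak_law Li) auto
  ultimately have "likely M (\<eta> / 2 + \<eta> / 2) (\<lambda>n \<omega>. (\<forall>t\<in>T. \<bar>smp.avg (loss t) n \<omega> - (\<integral>x. loss t x \<partial>P)\<bar> \<le> \<epsilon> / 2) \<and>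
      \<bar>smp.avg ?L n \<omega> - (\<integral>x. ?L x \<partial>P)\<bar> \<le> 1)" by (rule smp.likely_conj)
  then have "likely M \<eta> (\<lambda>n \<omega>. (\<forall>t\<in>T. \<bar>smp.avg (loss t) n \<omega> - (\<integral>x. loss t x \<partial>P)\<bar> \<le> \<epsilon> / 2) \<and>
      \<bar>smp.avg ?L n \<omega> - (\<integral>x. ?L x \<partial>P)\<bar> \<le> 1)" by simp
  then show ?thesis
  proof (rule likely_mono')
    fix n \<omega>
    assume A: "(\<forall>t\<in>T. \<bar>smp.avg (loss t) n \<omega> - (\<integral>x. loss t x \<partial>P)\<bar> \<le> \<epsilon> / 2) \<and>
      \<bar>smp.avg ?L n \<omega> - (\<integral>x. ?L x \<partial>P)\<bar> \<le> 1"
    show "\<forall>w. norm w \<le> R \<longrightarrow> \<bar>smp.avg (loss w) n \<omega> - obj P w\<bar> \<le> \<epsilon>"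
    proof (intro allI impI)
      fix w :: "real^'p" assume w: "norm w \<le> R"
      then have "w \<in> (\<Union>t\<in>T. ball t \<delta>)" using T(3) by (auto simp: subset_iff)
      then obtain t where t: "t \<in> T" "norm (w - t) \<le> \<delta>" by (auto simp: dist_norm norm_minus_commute less_imp_le)
      have tR: "norm t \<le> R" using t T(2) by auto
      have "\<bar>smp.avg (loss w) n \<omega> - smp.avg (loss t) n \<omega>\<bar> \<le> smp.avg (\<lambda>x. \<bar>loss w x - loss t x\<bar>) n \<omega>"
        unfolding smp.avg_diff[symmetric] by (rule smp.avg_abs)
      also have "\<dots> \<le> smp.avg (\<lambda>x. norm (w - t) * ?L x) n \<omega>"
        by (intro smp.avg_mono loss_lipschitz_ball w tR)
      also have "\<dots> = norm (w - t) * smp.avg ?L n \<omega>" by (rule smp.avg_cmult)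
      also have "\<dots> \<le> \<delta> * L" using t(2) A d R
        by (intro mult_mono) (auto simp: L_def smp.avg_def intro!: divide_nonneg_nonneg sum_nonneg)
      finally have 1: "\<bar>smp.avg (loss w) n \<omega> - smp.avg (loss t) n \<omega>\<bar> \<le> \<epsilon> / 4" using d by simp
      have "\<bar>obj P w - obj P t\<bar> \<le> norm (w - t) * (\<integral>x. ?L x \<partial>P)" by (rule obj_lipschitz_ball[OF w tR])
      also have "\<dots> \<le> \<delta> * L" using t(2) d L \<open>(\<integral>x. ?L x \<partial>P) \<ge> 0\<close> by (intro mult_mono) (auto simp: L_def)
      finally have 2: "\<bar>obj P w - obj P t\<bar> \<le> \<epsilon> / 4" using d by simp
      have "\<bar>smp.avg (loss t) n \<omega> - obj P t\<bar> \<le> \<epsilon> / 2" using A t(1) by (simp add: obj_def)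
      then show "\<bar>smp.avg (loss w) n \<omega> - obj P w\<bar> \<le> \<epsilon>" using 1 2 by linarith
    qed
  qed
qed

text \<open>On a compact set away from the two minimizers the continuous population objective has a
  positive gap 3 \<epsilon> over its minimum, which exceeds twice the uniform error
  \<epsilon>.\<close>

lemma consistency:
  assumes d: "\<delta> > 0" and eta: "\<eta> > 0"
  shows "likely M \<eta> (\<lambda>n \<omega>. norm (v n \<omega> - v0) < \<delta> \<or> norm (v n \<omega> + v0) < \<delta>)"
proof -
  obtain R0 where R0: "R0 > 0" "\<And>\<eta>. \<eta> > 0 \<Longrightarrow> likely M \<eta> (\<lambda>n \<omega>. norm (v n \<omega>) \<le> R0)"
    using estimator_tight by blast
  define R where "R = max R0 \<psi>"
  have R: "R > 0" "norm v0 \<le> R" "R0 \<le> R" using R0 psi by (auto simp: R_def)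
  define S where "S = cball 0 R \<inter> {w. norm (w - v0) \<ge> \<delta>} \<inter> {w. norm (w + v0) \<ge> \<delta>}"
  have "compact S"
    unfolding S_def by (intro compact_Int_closed compact_cball closed_Collect_le continuous_intros)
  have "\<exists>\<epsilon>>0. \<forall>w\<in>S. obj P w \<ge> obj P v0 + 3 * \<epsilon>"
  proof (cases "S = {}")
    case False
    define L where "L = (\<integral>x. 2 * norm x + 4 * R \<partial>P)"
    have L: "L \<ge> 0" unfolding L_def using R by (intro integral_nonneg_AE) auto
    have "L-lipschitz_on S (obj P)"
    proof (rule lipschitz_onI)
      fix w w' assume "w \<in> S" "w' \<in> S"
      then show "dist (obj P w) (obj P w') \<le> L * dist w w'"
        using obj_lipschitz_ball[of w R w'] by (simp add: S_def L_def dist_norm mult.commute)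
    qed (rule L)
    then have "continuous_on S (obj P)" by (rule lipschitz_on_continuous_on)
    from continuous_attains_inf[OF \<open>compact S\<close> False this]
    obtain w0 where w0: "w0 \<in> S" "\<And>w. w \<in> S \<Longrightarrow> obj P w0 \<le> obj P w" by metis
    have "obj P w0 > obj P v0"
    proof (rule ccontr)
      assume "\<not> obj P w0 > obj P v0"
      then have "obj P w0 \<le> obj P u" for u using min[of u] by linarith
      from unique[OF this] show False using w0(1) d by (auto simp: S_def)
    qed
    moreover have "obj P v0 + 3 * ((obj P w0 - obj P v0) / 3) \<le> obj P w" if "w \<in> S" for w
      using w0(2)[OF that] by (simp add: field_simps)
    ultimately show ?thesis by (intro exI[of _ "(obj P w0 - obj P v0) / 3"]) simp
  qed (auto intro: exI[of _ 1])
  then obtain \<epsilon> where ep: "\<epsilon> > 0" "\<And>w. w \<in> S \<Longrightarrow> obj P w \<ge> obj P v0 + 3 * \<epsilon>" by blast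
  have "likely M (\<eta> / 2 + \<eta> / 2) (\<lambda>n \<omega>. (\<forall>w. norm w \<le> R \<longrightarrow> \<bar>smp.avg (loss w) n \<omega> - obj P w\<bar> \<le> \<epsilon>) \<and> norm (v n \<omega>) \<le> R0)"
    using eta by (intro smp.likely_conj uniform_law R ep R0(2)) auto
  then have "likely M \<eta> (\<lambda>n \<omega>. (\<forall>w. norm w \<le> R \<longrightarrow> \<bar>smp.avg (loss w) n \<omega> - obj P w\<bar> \<le> \<epsilon>) \<and> norm (v n \<omega>) \<le> R0)" by simp
  then show ?thesis
  proof (rule likely_mono')
    fix n :: nat and \<omega> assume n: "n \<ge> 1" and w: "\<omega> \<in> space M"
      and A: "(\<forall>w. norm w \<le> R \<longrightarrow> \<bar>smp.avg (loss w) n \<omega> - obj P w\<bar> \<le> \<epsilon>) \<and> norm (v n \<omega>) \<le> R0"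
    have vR: "norm (v n \<omega>) \<le> R" using A R by linarith
    have "smp.avg (loss (v n \<omega>)) n \<omega> \<le> smp.avg (loss v0) n \<omega>"
      using v_min[OF n w, of v0] by (simp add: emp_obj_avg)
    moreover have "\<bar>smp.avg (loss (v n \<omega>)) n \<omega> - obj P (v n \<omega>)\<bar> \<le> \<epsilon>" "\<bar>smp.avg (loss v0) n \<omega> - obj P v0\<bar> \<le> \<epsilon>"
      using A vR R(2) by blast+
    ultimately have "obj P (v n \<omega>) < obj P v0 + 3 * \<epsilon>" using ep(1) by linarith
    then have "v n \<omega> \<notin> S" using ep(2)[of "v n \<omega>"] by linarith
    then show "norm (v n \<omega> - v0) < \<delta> \<or> norm (v n \<omega> + v0) < \<delta>" using vR by (auto simp: S_def)
  qed
qed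

text \<open>Read off from \<open>v n\<close> alone, so it is measurable with respect to
  \<open>sample_algebra\<close>; a vanishing first component counts as positive.\<close>

definition sgn_v :: "nat \<Rightarrow> 'b \<Rightarrow> real" where
  "sgn_v n \<omega> = (if v n \<omega> \<bullet> e k1 \<ge> 0 then 1 else - 1)"

text \<open>Within distance \<psi> of \<open>v0\<close> or \<open>- v0\<close> the first component
  has the sign of that point, hence the radius min \<delta> \<psi>.\<close>

lemma consistency_sgn:
  assumes d: "\<delta> > 0" and eta: "\<eta> > 0"
  shows "likely M \<eta> (\<lambda>n \<omega>. norm (sgn_v n \<omega> *\<^sub>R v n \<omega> - v0) < \<delta>)"
proof (rule likely_mono'[OF consistency[of "min \<delta> \<psi>" \<eta>]])
  fix n \<omega> assume A: "norm (v n \<omega> - v0) < min \<delta> \<psi> \<or> norm (v n \<omega> + v0) < min \<delta> \<psi>"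
  have i: "v0 \<bullet> e k1 = \<psi>" by (simp add: ortho)
  from A show "norm (sgn_v n \<omega> *\<^sub>R v n \<omega> - v0) < \<delta>"
  proof
    assume *: "norm (v n \<omega> - v0) < min \<delta> \<psi>"
    have "\<bar>(v n \<omega> - v0) \<bullet> e k1\<bar> < \<psi>" using abs_inner_e_le[of "v n \<omega> - v0" k1] * by simp
    then have "v n \<omega> \<bullet> e k1 > 0" by (simp add: inner_diff_left ortho)
    then show ?thesis using * by (simp add: sgn_v_def)
  next
    assume *: "norm (v n \<omega> + v0) < min \<delta> \<psi>"
    have "\<bar>(v n \<omega> + v0) \<bullet> e k1\<bar> < \<psi>" using abs_inner_e_le[of "v n \<omega> + v0" k1] * by simp
    then have "v n \<omega> \<bullet> e k1 < 0" by (simp add: inner_add_left ortho)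
    moreover have "norm (- v n \<omega> - v0) = norm (v n \<omega> + v0)" by (metis minus_add_distrib norm_minus_cancel uminus_add_conv_diff add.commute diff_conv_add_uminus)
    ultimately show ?thesis using * by (simp add: sgn_v_def)
  qed
qed (use d psi eta in auto)

section \<open>Quadratic expansion of the sample objective\<close>

definition hess_eig :: "'p \<Rightarrow> real" where
  "hess_eig i = (if i = k1 then curv1 else curv2)"

definition hess_form :: "real^'p \<Rightarrow> real" where
  "hess_form h = (\<Sum>i\<in>UNIV. hess_eig i * (h \<bullet> e i)\<^sup>2)"

definition mean_score :: "nat \<Rightarrow> 'b \<Rightarrow> real^'p" where
  "mean_score n \<omega> = (\<Sum>i<n. score v0 (X i \<omega>)) /\<^sub>R real n"

lemma inner_mean_score: "mean_score n \<omega> \<bullet> h = smp.avg (\<lambda>x. score v0 x \<bullet> h) n \<omega>"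
  by (simp add: mean_score_def smp.avg_def inner_sum_left divide_inverse mult.commute)

lemma hess_mean: "(\<integral>x. hess v0 x (e i) (e j) \<partial>P) = (if i = j then hess_eig i else 0)"
proof -
  have neg: "hess v0 x (- u) w = - hess v0 x u w" "hess v0 x u (- w) = - hess v0 x u w" for x u w
    by (simp_all add: hess_def minus_divide_left algebra_simps)
  show ?thesis
  proof (cases "i = j")
    case False
    have "(\<integral>x. hess v0 x (e i) (e j) \<partial>P) = 0"
      by (rule kernel_offdiag[where K="hess v0"], rule hess_meas, erule (1) hess_invariant, rule neg, rule neg, rule False)
    then show ?thesis using False by simp
  next
    case True
    show ?thesis
    proof (cases "j = k1")
      case False
      have "(\<integral>x. hess v0 x (e j) (e j) \<partial>P) = (\<integral>x. hess v0 x (e k2) (e k2) \<partial>P)"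
        by (rule kernel_diag[where K="hess v0"], rule hess_meas, erule (1) hess_invariant) (use False ks in auto)
      then show ?thesis using True False by (simp add: hess_eig_def curv2_def)
    qed (simp add: True hess_eig_def curv1_def)
  qed
qed

text \<open>Reduces a statement uniform in h to finitely many laws of large numbers, one for each
  entry in the frame.\<close>

lemma hess_expand: "hess v0 x h h = (\<Sum>i\<in>UNIV. \<Sum>j\<in>UNIV. (h \<bullet> e i) * (h \<bullet> e j) * hess v0 x (e i) (e j))"
proof -
  have l1: "linear (\<lambda>u. hess v0 x u w)" for w
    by (rule linearI) (simp_all add: hess_def inner_add_right inner_add_left inner_diff_right add_divide_distrib diff_divide_distrib algebra_simps)
  have l2: "linear (\<lambda>w. hess v0 x u w)" for u
    by (rule linearI) (simp_all add: hess_def inner_add_right inner_add_left inner_diff_right add_divide_distrib diff_divide_distrib algebra_simps)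
  have "hess v0 x h h = hess v0 x (\<Sum>i\<in>UNIV. (h \<bullet> e i) *\<^sub>R e i) (\<Sum>j\<in>UNIV. (h \<bullet> e j) *\<^sub>R e j)"
    by (rule arg_cong2[where f="hess v0 x", OF expand expand])
  also have "\<dots> = (\<Sum>i\<in>UNIV. (h \<bullet> e i) * hess v0 x (e i) (\<Sum>j\<in>UNIV. (h \<bullet> e j) *\<^sub>R e j))"
    by (simp add: linear_sum[OF l1] linear_scale[OF l1])
  also have "\<dots> = (\<Sum>i\<in>UNIV. (h \<bullet> e i) * (\<Sum>j\<in>UNIV. (h \<bullet> e j) * hess v0 x (e i) (e j)))"
    by (simp add: linear_sum[OF l2] linear_scale[OF l2])
  finally show ?thesis by (simp add: sum_distrib_left mult.assoc)
qed

text \<open>Each observation avoids \<open>v0\<close> and \<open>- v0\<close> almost surely, so the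
  budget is 0; on this event the pointwise expansions hold for the whole sample.\<close>

lemma likely_nprod_pos: "likely M 0 (\<lambda>n \<omega>. \<forall>i<n. nprod v0 (X i \<omega>) > 0)"
  unfolding likely_def
proof (intro always_eventually allI)
  fix n
  let ?A = "{\<omega>\<in>space M. \<forall>i<n. nprod v0 (X i \<omega>) > 0}"
  have "AE \<omega> in M. nprod v0 (X i \<omega>) > 0" for i
  proof -
    have "AE x in distr M borel (X i). nprod v0 x > 0" unfolding smp.distr_X by (rule AE_nprod_pos)
    then show ?thesis by (subst (asm) AE_distr_iff) auto
  qed
  then have "AE \<omega> in M. \<forall>i<n. nprod v0 (X i \<omega>) > 0" by (simp add: AE_all_countable)
  moreover have "?A \<in> sets M" by measurable
  ultimately have "smp.prob ?A = 1" by (subst smp.prob_Collect_eq_1) auto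
  then show "\<exists>A\<in>sets M. (\<forall>\<omega>\<in>A. \<forall>i<n. nprod v0 (X i \<omega>) > 0) \<and> smp.prob A \<ge> 1 - 0"
    using \<open>?A \<in> sets M\<close> by (intro bexI[of _ ?A]) auto
qed

lemma quadratic_expansion:
  assumes ep: "\<epsilon> > 0" and eta: "\<eta> > 0"
  shows "\<exists>\<delta>>0. likely M \<eta> (\<lambda>n \<omega>. \<forall>h. norm h \<le> \<delta> \<longrightarrow>
     \<bar>smp.avg (loss (v0 + h)) n \<omega> - smp.avg (loss v0) n \<omega> - mean_score n \<omega> \<bullet> h - hess_form h / 2\<bar> \<le> \<epsilon> * (norm h)\<^sup>2)"
proof -
  define T where "T x = 2 * norm x + 2 * norm v0 + 1" for x :: "real^'p"
  \<comment> \<open>The factor 4 adds the constant 2 of the first-order remainder and the 2 of the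
    Hessian term.\<close>
  define env where "env x = 4 * ((T x)\<^sup>2 / nprod v0 x)" for x
  define cub where "cub x = (T x)\<^sup>2 / nprod v0 x + 2 * (T x) ^ 3 / (nprod v0 x)\<^sup>2" for x
  \<comment> \<open>In the plane \<open>cub\<close> is not integrable, because of the squared
    \<open>nprod\<close> in its denominator. The minimum is dominated by the integrable
    \<open>env\<close> and tends to 0 pointwise, which makes its mean small.\<close>
  define \<rho> where "\<rho> m x = min (env x) (1 / real (Suc m) * cub x)" for m x
  have Tpos: "T x > 0" for x using psi norm_ge_zero[of x] unfolding T_def norm_v0 by linarith
  have env0: "env x \<ge> 0" and cub0: "cub x \<ge> 0" for x using Tpos[of x] by (auto simp: env_def cub_def)
  have [measurable]: "env \<in> borel_measurable borel" "cub \<in> borel_measurable borel" "\<rho> m \<in> borel_measurable borel" for m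
    unfolding \<rho>_def env_def cub_def T_def by measurable
  have env_int: "integrable P env" unfolding env_def T_def by (intro integrable_mult_right integrable_envelope v0_neq_0)
  have rho0: "\<rho> m x \<ge> 0" for m x using env0[of x] cub0[of x] by (simp add: \<rho>_def)
  have rho_env: "\<rho> m x \<le> env x" for m x by (simp add: \<rho>_def)
  have rho_int: "integrable P (\<rho> m)" for m
    using env0 rho0 rho_env by (intro Bochner_Integration.integrable_bound[OF env_int]) auto
  have "(\<lambda>m. \<integral>x. \<rho> m x \<partial>P) \<longlonglongrightarrow> (\<integral>x. 0 \<partial>P)"
  proof (rule integral_dominated_convergence[OF _ _ env_int])
    show "AE x in P. (\<lambda>m. \<rho> m x) \<longlonglongrightarrow> 0"
    proof (rule AE_I2)
      fix x
      have "(\<lambda>m. 1 / real (Suc m) * cub x) \<longlonglongrightarrow> 0 * cub x"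
        using LIMSEQ_inverse_real_of_nat by (intro tendsto_mult tendsto_const) (simp add: inverse_eq_divide)
      then have "(\<lambda>m. 1 / real (Suc m) * cub x) \<longlonglongrightarrow> 0" by simp
      moreover have "\<forall>\<^sub>F m in sequentially. 0 \<le> \<rho> m x" "\<forall>\<^sub>F m in sequentially. \<rho> m x \<le> 1 / real (Suc m) * cub x"
        using rho0 by (auto simp: \<rho>_def)
      ultimately show "(\<lambda>m. \<rho> m x) \<longlonglongrightarrow> 0" using tendsto_sandwich[of "\<lambda>_. 0" "\<lambda>m. \<rho> m x" sequentially "\<lambda>m. 1 / real (Suc m) * cub x" 0] by simp
    qed
    show "AE x in P. norm (\<rho> m x) \<le> env x" for m using rho0 rho_env by auto
  qed auto
  then have "\<forall>\<^sub>F m in sequentially. (\<integral>x. \<rho> m x \<partial>P) < \<epsilon> / 2 * (\<eta> / 2)"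
    using ep eta by (intro order_tendstoD) auto
  then obtain m where m: "(\<integral>x. \<rho> m x \<partial>P) < \<epsilon> / 2 * (\<eta> / 2)" by (auto simp: eventually_sequentially)
  \<comment> \<open>The radius is tied to the truncation index m, which depends on \<epsilon> and
    \<eta> but not on n.\<close>
  define \<delta> where "\<delta> = 1 / real (Suc m)"
  have d: "\<delta> > 0" "\<delta> \<le> 1" by (auto simp: \<delta>_def)
  define p where "p = real CARD('p)"
  have p: "p > 0" by (simp add: p_def)
  let ?H = "\<lambda>(i, j) x. hess v0 x (e i) (e j)"
  \<comment> \<open>Each of the p^2 entries gets the accuracy \<epsilon> / p^2, since its
    coefficient is at most |h|^2.\<close>
  have "likely M (\<eta> / 2) (\<lambda>n \<omega>. \<forall>ij\<in>UNIV. \<bar>smp.avg (?H ij) n \<omega> - (\<integral>x. ?H ij x \<partial>P)\<bar> \<le> \<epsilon> / p\<^sup>2)"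
    using ep eta p by (intro smp.likely_ball smp.weak_law) (auto intro!: integrable_hess v0_neq_0)
  moreover have "likely M (\<eta> / 2) (\<lambda>n \<omega>. smp.avg (\<rho> m) n \<omega> \<le> \<epsilon> / 2)"
    using ep m rho0 by (intro smp.likely_avg_le rho_int) auto
  ultimately have "likely M ((\<eta> / 2 + \<eta> / 2) + 0) (\<lambda>n \<omega>. ((\<forall>ij\<in>UNIV. \<bar>smp.avg (?H ij) n \<omega> - (\<integral>x. ?H ij x \<partial>P)\<bar> \<le> \<epsilon> / p\<^sup>2) \<and>
      smp.avg (\<rho> m) n \<omega> \<le> \<epsilon> / 2) \<and> (\<forall>i<n. nprod v0 (X i \<omega>) > 0))"
    by (intro smp.likely_conj likely_nprod_pos)
  then have "likely M \<eta> (\<lambda>n \<omega>. ((\<forall>ij\<in>UNIV. \<bar>smp.avg (?H ij) n \<omega> - (\<integral>x. ?H ij x \<partial>P)\<bar> \<le> \<epsilon> / p\<^sup>2) \<and>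
      smp.avg (\<rho> m) n \<omega> \<le> \<epsilon> / 2) \<and> (\<forall>i<n. nprod v0 (X i \<omega>) > 0))" by simp
  then have "likely M \<eta> (\<lambda>n \<omega>. \<forall>h. norm h \<le> \<delta> \<longrightarrow>
     \<bar>smp.avg (loss (v0 + h)) n \<omega> - smp.avg (loss v0) n \<omega> - mean_score n \<omega> \<bullet> h - hess_form h / 2\<bar> \<le> \<epsilon> * (norm h)\<^sup>2)"
  proof (rule likely_mono', intro allI impI)
    fix n :: nat and \<omega> and h :: "real^'p"
    assume A: "((\<forall>ij\<in>UNIV. \<bar>smp.avg (?H ij) n \<omega> - (\<integral>x. ?H ij x \<partial>P)\<bar> \<le> \<epsilon> / p\<^sup>2) \<and>
      smp.avg (\<rho> m) n \<omega> \<le> \<epsilon> / 2) \<and> (\<forall>i<n. nprod v0 (X i \<omega>) > 0)" and h: "norm h \<le> \<delta>"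
    have h1: "norm h \<le> 1" using h d by linarith
    define r where "r x = loss (v0 + h) x - loss v0 x - score v0 x \<bullet> h - hess v0 x h h / 2" for x
    have r: "\<bar>r x\<bar> \<le> (norm h)\<^sup>2 * \<rho> m x" if "nprod v0 x > 0" for x
    proof -
      have "\<bar>r x\<bar> \<le> (norm h)\<^sup>2 * (2 * (T x)\<^sup>2 / nprod v0 x) + (norm h)\<^sup>2 * (2 * (T x)\<^sup>2 / nprod v0 x)"
        using loss_remainder_bound[OF that h1] hess_bound[OF that h1] unfolding r_def T_def by linarith
      also have "\<dots> = (norm h)\<^sup>2 * env x" by (simp add: env_def algebra_simps)
      finally have 1: "\<bar>r x\<bar> \<le> (norm h)\<^sup>2 * env x" .
      have "\<bar>r x\<bar> \<le> (norm h)^3 * cub x"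
        using loss_remainder_cubic[OF that h1] unfolding r_def T_def cub_def .
      also have "\<dots> = (norm h)\<^sup>2 * (norm h * cub x)" by (simp add: power2_eq_square power3_eq_cube)
      also have "\<dots> \<le> (norm h)\<^sup>2 * (\<delta> * cub x)" using h cub0 by (intro mult_left_mono mult_right_mono) auto
      finally have 2: "\<bar>r x\<bar> \<le> (norm h)\<^sup>2 * (\<delta> * cub x)" .
      show ?thesis using 1 2 unfolding \<rho>_def \<delta>_def min_def by (simp split: if_splits)
    qed
    have "\<bar>smp.avg r n \<omega>\<bar> \<le> smp.avg (\<lambda>x. \<bar>r x\<bar>) n \<omega>" by (rule smp.avg_abs)
    also have "\<dots> \<le> smp.avg (\<lambda>x. (norm h)\<^sup>2 * \<rho> m x) n \<omega>"
      unfolding smp.avg_def using A r by (intro divide_right_mono sum_mono) auto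
    also have "\<dots> = (norm h)\<^sup>2 * smp.avg (\<rho> m) n \<omega>" by (rule smp.avg_cmult)
    also have "\<dots> \<le> (norm h)\<^sup>2 * (\<epsilon> / 2)" using A by (intro mult_left_mono) auto
    finally have R: "\<bar>smp.avg r n \<omega>\<bar> \<le> (norm h)\<^sup>2 * (\<epsilon> / 2)" .
    have r_avg: "smp.avg r n \<omega> = smp.avg (loss (v0 + h)) n \<omega> - smp.avg (loss v0) n \<omega> - mean_score n \<omega> \<bullet> h - smp.avg (\<lambda>x. hess v0 x h h) n \<omega> / 2"
      unfolding r_def inner_mean_score smp.avg_diff using smp.avg_cmult[of "1/2" "\<lambda>x. hess v0 x h h" n \<omega>] by simp
    have "smp.avg (\<lambda>x. hess v0 x h h) n \<omega> - hess_form h =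
       (\<Sum>i\<in>UNIV. \<Sum>j\<in>UNIV. (h \<bullet> e i) * (h \<bullet> e j) * (smp.avg (?H (i, j)) n \<omega> - (\<integral>x. ?H (i, j) x \<partial>P)))"
    proof -
      have "smp.avg (\<lambda>x. hess v0 x h h) n \<omega> = (\<Sum>i\<in>UNIV. \<Sum>j\<in>UNIV. (h \<bullet> e i) * (h \<bullet> e j) * smp.avg (?H (i, j)) n \<omega>)"
        unfolding smp.avg_def hess_expand[of _ h] sum_divide_distrib prod.case
        by (subst sum.swap, intro sum.cong refl, subst sum.swap, intro sum.cong refl)
           (simp add: sum_distrib_left sum_divide_distrib)
      moreover have "hess_form h = (\<Sum>i\<in>UNIV. \<Sum>j\<in>UNIV. (h \<bullet> e i) * (h \<bullet> e j) * (\<integral>x. ?H (i, j) x \<partial>P))"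
        by (simp add: hess_form_def hess_mean if_distrib power2_eq_square mult_ac cong: if_cong)
      ultimately show ?thesis by (simp add: sum_subtractf right_diff_distrib)
    qed
    also have "\<bar>\<dots>\<bar> \<le> (\<Sum>i\<in>(UNIV :: 'p set). \<Sum>j\<in>(UNIV :: 'p set). (norm h)\<^sup>2 * (\<epsilon> / p\<^sup>2))"
    proof (intro order_trans[OF sum_abs] sum_mono)
      fix i j :: 'p
      have "\<bar>(h \<bullet> e i) * (h \<bullet> e j)\<bar> \<le> norm h * norm h"
        unfolding abs_mult by (intro mult_mono abs_inner_e_le) auto
      then show "\<bar>(h \<bullet> e i) * (h \<bullet> e j) * (smp.avg (?H (i, j)) n \<omega> - (\<integral>x. ?H (i, j) x \<partial>P))\<bar> \<le> (norm h)\<^sup>2 * (\<epsilon> / p\<^sup>2)"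
        unfolding abs_mult[of "_ * _" "_ - _"] power2_eq_square[of "norm h"] using A by (intro mult_mono) auto
    qed
    also have "\<dots> = (norm h)\<^sup>2 * \<epsilon>" using p by (simp add: p_def power2_eq_square)
    finally have "\<bar>smp.avg (\<lambda>x. hess v0 x h h) n \<omega> - hess_form h\<bar> \<le> \<epsilon> * (norm h)\<^sup>2" by (simp add: mult.commute)
    moreover have "\<bar>smp.avg r n \<omega>\<bar> \<le> \<epsilon> * (norm h)\<^sup>2 / 2" using R by (simp add: mult.commute)
    ultimately show "\<bar>smp.avg (loss (v0 + h)) n \<omega> - smp.avg (loss v0) n \<omega> - mean_score n \<omega> \<bullet> h - hess_form h / 2\<bar> \<le> \<epsilon> * (norm h)\<^sup>2"
      unfolding r_avg by linarith
  qed
  then show ?thesis using d(1) by blast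
qed

end

section \<open>Characteristic functions of nearby variables and of normalized sums\<close>

lemma norm_iexp_diff_le: "cmod (iexp s - iexp t) \<le> \<bar>s - t\<bar>"
proof -
  have "iexp s - iexp t = iexp t * (iexp (s - t) - 1)"
    by (simp add: algebra_simps flip: exp_add)
  then have "cmod (iexp s - iexp t) = cmod (iexp (s - t) - 1)" by (simp add: norm_mult)
  then show ?thesis using iexp_approx1[of "s - t" 0] by simp
qed

text \<open>Slutsky's theorem for characteristic functions: on the likely event the characters
  differ by at most |t| \<epsilon>, off it by at most 2.\<close>

lemma (in prob_space) char_conv_likely_close:
  fixes Y V :: "nat \<Rightarrow> 'a \<Rightarrow> real^'p"
  assumes [measurable]: "\<And>n. Y n \<in> borel_measurable M" "\<And>n. V n \<in> borel_measurable M"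
    and close: "\<And>\<epsilon> \<eta>. \<epsilon> > 0 \<Longrightarrow> \<eta> > 0 \<Longrightarrow> likely M \<eta> (\<lambda>n \<omega>. norm (V n \<omega> - Y n \<omega>) \<le> \<epsilon>)"
    and conv: "(\<lambda>n. \<integral>\<omega>. iexp (t \<bullet> Y n \<omega>) \<partial>M) \<longlonglongrightarrow> l"
  shows "(\<lambda>n. \<integral>\<omega>. iexp (t \<bullet> V n \<omega>) \<partial>M) \<longlonglongrightarrow> l"
proof -
  have int: "integrable M (\<lambda>\<omega>. iexp (t \<bullet> V n \<omega>))" "integrable M (\<lambda>\<omega>. iexp (t \<bullet> Y n \<omega>))" for n
    by (auto intro!: integrable_const_bound[where B=1])
  have "(\<lambda>n. (\<integral>\<omega>. iexp (t \<bullet> V n \<omega>) \<partial>M) - (\<integral>\<omega>. iexp (t \<bullet> Y n \<omega>) \<partial>M)) \<longlonglongrightarrow> 0"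
  proof (rule tendstoI)
    fix e :: real assume e: "e > 0"
    \<comment> \<open>The budget is e / 4 on the likely event and twice e / 8 off it; the added 1
      covers t = 0.\<close>
    define \<epsilon> where "\<epsilon> = e / (4 * (norm t + 1))"
    have ep: "\<epsilon> > 0" using e by (simp add: \<epsilon>_def add_nonneg_pos)
    have tep: "norm t * \<epsilon> \<le> e / 4"
    proof -
      have "norm t * \<epsilon> \<le> (norm t + 1) * \<epsilon>" using ep by (intro mult_right_mono) auto
      also have "\<dots> = e / 4"
      proof -
        have "N * (e / (4 * N)) = e / 4" if "N \<noteq> 0" for N :: real using that by (simp add: field_simps)
        moreover have "norm t + 1 \<noteq> 0" using norm_ge_zero[of t] by linarith
        ultimately show ?thesis unfolding \<epsilon>_def by blast
      qed
      finally show ?thesis .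
    qed
    have "likely M (e / 8) (\<lambda>n \<omega>. norm (V n \<omega> - Y n \<omega>) \<le> \<epsilon>)" using ep e by (intro close) auto
    then show "\<forall>\<^sub>F n in sequentially. dist ((\<integral>\<omega>. iexp (t \<bullet> V n \<omega>) \<partial>M) - (\<integral>\<omega>. iexp (t \<bullet> Y n \<omega>) \<partial>M)) 0 < e"
      unfolding likely_def
    proof eventually_elim
      case (elim n)
      then obtain A where A: "A \<in> events" "\<And>\<omega>. \<omega> \<in> A \<Longrightarrow> norm (V n \<omega> - Y n \<omega>) \<le> \<epsilon>" "prob A \<ge> 1 - e / 8" by blast
      have AC: "space M - A \<in> events" using A(1) by blast
      have iAC: "integrable M (\<lambda>\<omega>. norm t * \<epsilon> + 2 * indicator (space M - A) \<omega>)"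
        using AC by (intro Bochner_Integration.integrable_add integrable_mult_right integrable_real_indicator) (auto simp: emeasure_eq_measure)
      have "cmod ((\<integral>\<omega>. iexp (t \<bullet> V n \<omega>) \<partial>M) - (\<integral>\<omega>. iexp (t \<bullet> Y n \<omega>) \<partial>M)) =
          cmod (\<integral>\<omega>. iexp (t \<bullet> V n \<omega>) - iexp (t \<bullet> Y n \<omega>) \<partial>M)"
        using int by (subst Bochner_Integration.integral_diff) auto
      also have "\<dots> \<le> (\<integral>\<omega>. cmod (iexp (t \<bullet> V n \<omega>) - iexp (t \<bullet> Y n \<omega>)) \<partial>M)" by (rule integral_norm_bound)
      also have "\<dots> \<le> (\<integral>\<omega>. norm t * \<epsilon> + 2 * indicator (space M - A) \<omega> \<partial>M)"
      proof (rule integral_mono[OF _ iAC])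
        show "integrable M (\<lambda>\<omega>. cmod (iexp (t \<bullet> V n \<omega>) - iexp (t \<bullet> Y n \<omega>)))" using int by (intro integrable_norm Bochner_Integration.integrable_diff)
        fix \<omega> assume w: "\<omega> \<in> space M"
        show "cmod (iexp (t \<bullet> V n \<omega>) - iexp (t \<bullet> Y n \<omega>)) \<le> norm t * \<epsilon> + 2 * indicator (space M - A) \<omega>"
        proof (cases "\<omega> \<in> A")
          case True
          have "cmod (iexp (t \<bullet> V n \<omega>) - iexp (t \<bullet> Y n \<omega>)) \<le> \<bar>t \<bullet> (V n \<omega> - Y n \<omega>)\<bar>"
            unfolding inner_diff_right by (rule norm_iexp_diff_le)
          also have "\<dots> \<le> norm t * norm (V n \<omega> - Y n \<omega>)" by (rule Cauchy_Schwarz_ineq2)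
          also have "\<dots> \<le> norm t * \<epsilon>" using A(2)[OF True] by (intro mult_left_mono) auto
          finally show ?thesis using True by simp
        next
          case False
          have "cmod (iexp (t \<bullet> V n \<omega>) - iexp (t \<bullet> Y n \<omega>)) \<le> cmod (iexp (t \<bullet> V n \<omega>)) + cmod (iexp (t \<bullet> Y n \<omega>))"
            by (rule norm_triangle_ineq4)
          also have "\<dots> = 2" by (simp only: norm_exp_i_times)
          also have "2 \<le> norm t * \<epsilon> + 2" using ep by simp
          finally show ?thesis using False w by simp
        qed
      qed
      also have "\<dots> = norm t * \<epsilon> + 2 * prob (space M - A)"
        using AC by (subst Bochner_Integration.integral_add) (auto simp: prob_space emeasure_eq_measure)
      also have "prob (space M - A) = 1 - prob A" using A(1) by (rule prob_compl)
      finally have le: "cmod ((\<integral>\<omega>. iexp (t \<bullet> V n \<omega>) \<partial>M) - (\<integral>\<omega>. iexp (t \<bullet> Y n \<omega>) \<partial>M)) \<le> norm t * \<epsilon> + 2 * (1 - prob A)" .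
      have "2 * (1 - prob A) \<le> e / 4" using A(3) by simp
      then have "norm t * \<epsilon> + 2 * (1 - prob A) < e" using tep e by simp
      then show ?case using le unfolding dist_norm diff_0_right by (rule order.strict_trans1[rotated])
    qed
  qed
  from tendsto_add[OF this conv] show ?thesis by simp
qed

text \<open>The library's central limit theorem excludes zero variance.\<close>

lemma (in iid_sample) char_clt:
  fixes g :: "'c \<Rightarrow> real"
  assumes [measurable]: "g \<in> borel_measurable borel" and g2: "integrable P (\<lambda>x. (g x)\<^sup>2)" and g0: "(\<integral>x. g x \<partial>P) = 0"
  shows "(\<lambda>n. \<integral>\<omega>. iexp ((\<Sum>i<n. g (X i \<omega>)) / sqrt (real n)) \<partial>M) \<longlonglongrightarrow> complex_of_real (exp (- (\<integral>x. (g x)\<^sup>2 \<partial>P) / 2))"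
proof -
  define \<tau>2 where "\<tau>2 = (\<integral>x. (g x)\<^sup>2 \<partial>P)"
  have t0: "\<tau>2 \<ge> 0" by (simp add: \<tau>2_def)
  show ?thesis
  proof (cases "\<tau>2 = 0")
    case True
    then have "AE x in P. (g x)\<^sup>2 = 0"
      using integral_nonneg_eq_0_iff_AE[OF g2] by (simp add: \<tau>2_def)
    then have ae: "AE \<omega> in M. g (X i \<omega>) = 0" for i
      unfolding distr_X[of i, symmetric] by (subst (asm) AE_distr_iff) auto
    have "(\<integral>\<omega>. iexp ((\<Sum>i<n. g (X i \<omega>)) / sqrt (real n)) \<partial>M) = (\<integral>\<omega>. 1 \<partial>M)" for n
    proof (intro integral_cong_AE)
      have "AE \<omega> in M. \<forall>i. g (X i \<omega>) = 0" using ae by (simp add: AE_all_countable)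
      then show "AE \<omega> in M. iexp ((\<Sum>i<n. g (X i \<omega>)) / sqrt (real n)) = 1" by eventually_elim simp
    qed measurable
    then show ?thesis using True by (simp add: \<tau>2_def[symmetric] prob_space)
  next
    case False
    define \<sigma> where "\<sigma> = sqrt \<tau>2"
    have s: "\<sigma> > 0" "\<sigma>\<^sup>2 = \<tau>2" using False t0 by (auto simp: \<sigma>_def)
    have int: "integrable P g" by (rule P.square_integrable_imp_integrable[OF _ g2]) simp
    have clt: "weak_conv_m (\<lambda>n. distr M borel (\<lambda>\<omega>. (\<Sum>i<n. g (X i \<omega>)) / sqrt (real n * \<sigma>\<^sup>2))) std_normal_distribution"
    proof (rule central_limit_theorem_zero_mean[where X="\<lambda>i \<omega>. g (X i \<omega>)" and \<mu>="distr P borel g"])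
      show "indep_vars (\<lambda>i. borel) (\<lambda>i \<omega>. g (X i \<omega>)) UNIV" by (rule indep_vars_compose2[OF indep]) simp
      show m: "expectation (\<lambda>\<omega>. g (X n \<omega>)) = 0" for n using integral_X[of g] g0 by simp
      show "integrable M (\<lambda>\<omega>. (g (X n \<omega>))\<^sup>2)" for n using integrable_X[of "\<lambda>x. (g x)\<^sup>2"] g2 by simp
      show "variance (\<lambda>\<omega>. g (X n \<omega>)) = \<sigma>\<^sup>2" for n using integral_X[of "\<lambda>x. (g x)\<^sup>2"] m s by (simp add: \<tau>2_def)
      show "distr M borel (\<lambda>\<omega>. g (X n \<omega>)) = distr P borel g" for n
        unfolding distr_X[of n, symmetric] by (subst distr_distr) (auto simp: comp_def)
    qed (rule s)
    \<comment> \<open>Evaluation at \<sigma> undoes the standardization and leaves the sum divided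
      by sqrt n.\<close>
    have "(\<lambda>n. char (distr M borel (\<lambda>\<omega>. (\<Sum>i<n. g (X i \<omega>)) / sqrt (real n * \<sigma>\<^sup>2))) \<sigma>) \<longlonglongrightarrow> char std_normal_distribution \<sigma>"
      by (rule levy_continuity1[OF _ real_dist_normal_dist clt]) (auto intro!: real_distribution_distr)
    moreover have "char (distr M borel (\<lambda>\<omega>. (\<Sum>i<n. g (X i \<omega>)) / sqrt (real n * \<sigma>\<^sup>2))) \<sigma> =
        (\<integral>\<omega>. iexp ((\<Sum>i<n. g (X i \<omega>)) / sqrt (real n)) \<partial>M)" for n
    proof -
      have "\<sigma> * (S / sqrt (real n * \<sigma>\<^sup>2)) = S / sqrt (real n)" for S :: real
        using s(1) by (simp add: real_sqrt_mult)
      then show ?thesis unfolding char_def by (subst integral_distr) auto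
    qed
    ultimately show ?thesis
      by (simp only: char_std_normal_distribution s(2) \<tau>2_def)
  qed
qed

section \<open>Linearization of the estimator\<close>

context sampling
begin

definition hess_inv :: "real^'p \<Rightarrow> real^'p" where
  "hess_inv g = (\<Sum>i\<in>UNIV. ((g \<bullet> e i) / hess_eig i) *\<^sub>R e i)"

definition dmin :: real where "dmin = min curv1 curv2"

lemma dmin_pos: "dmin > 0" by (simp add: dmin_def curv1_pos curv2_pos)

lemma hess_eig_ge: "hess_eig i \<ge> dmin" by (simp add: hess_eig_def dmin_def)

lemma hess_eig_pos: "hess_eig i > 0" using hess_eig_ge[of i] dmin_pos by linarith

lemma inner_hess_inv: "hess_inv g \<bullet> e j = (g \<bullet> e j) / hess_eig j"
  by (simp add: hess_inv_def inner_sum_left ortho if_distrib cong: if_cong)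

lemma norm_hess_inv_le: "norm (hess_inv g) \<le> norm g / dmin"
proof (rule power2_le_imp_le)
  have "(norm (hess_inv g))\<^sup>2 = (\<Sum>i\<in>UNIV. (g \<bullet> e i)\<^sup>2 / (hess_eig i)\<^sup>2)"
    by (simp add: norm_sq_eq_sum inner_hess_inv power_divide)
  also have "\<dots> \<le> (\<Sum>i\<in>UNIV. (g \<bullet> e i)\<^sup>2 / dmin\<^sup>2)"
    using hess_eig_ge dmin_pos hess_eig_pos by (intro sum_mono divide_left_mono power_mono mult_pos_pos zero_less_power) (auto intro: less_imp_le)
  also have "\<dots> = (norm g / dmin)\<^sup>2" by (simp add: norm_sq_eq_sum power_divide sum_divide_distrib)
  finally show "(norm (hess_inv g))\<^sup>2 \<le> (norm g / dmin)\<^sup>2" .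
qed (use dmin_pos in simp)

lemma hess_inv_self_adjoint: "t \<bullet> hess_inv g = hess_inv t \<bullet> g"
  unfolding inner_eq_sum[of t "hess_inv g"] inner_eq_sum[of "hess_inv t" g] inner_hess_inv by simp

lemma hess_form_ge: "hess_form h \<ge> dmin * (norm h)\<^sup>2"
  unfolding hess_form_def norm_sq_eq_sum sum_distrib_left using hess_eig_ge by (intro sum_mono mult_right_mono) auto

text \<open>The quadratic approximation has its minimum at minus \<open>hess_inv g\<close>, and the
  excess over the minimum is half the form at the deviation from it.\<close>

lemma complete_square: "g \<bullet> h + hess_form h / 2 = hess_form (h + hess_inv g) / 2 - hess_form (hess_inv g) / 2"
proof -
  have "hess_eig i * (p + q / hess_eig i)\<^sup>2 / 2 - hess_eig i * (q / hess_eig i)\<^sup>2 / 2 = q * p + hess_eig i * p\<^sup>2 / 2" for i p q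
    using hess_eig_pos[of i] by (simp add: field_simps power2_eq_square)
  then have "(\<Sum>i\<in>UNIV. hess_eig i * ((h \<bullet> e i) + (g \<bullet> e i) / hess_eig i)\<^sup>2 / 2 - hess_eig i * ((g \<bullet> e i) / hess_eig i)\<^sup>2 / 2) =
      (\<Sum>i\<in>UNIV. (g \<bullet> e i) * (h \<bullet> e i) + hess_eig i * (h \<bullet> e i)\<^sup>2 / 2)" by simp
  then show ?thesis
    unfolding hess_form_def inner_eq_sum[of g h] inner_hess_inv inner_add_left
    by (simp add: sum_subtractf sum.distrib sum_divide_distrib)
qed

text \<open>The deterministic core. Comparing hn with 0 gives |hn| = O(|g|); comparing it with minus
  \<open>hess_inv g\<close> bounds the excess in \<open>complete_square\<close> by the approximation
  error at two points of that order.\<close>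

lemma argmin_linearization:
  assumes q: "q > 0" "q \<le> dmin / 4"
    and D: "\<And>h. norm h \<le> \<delta> \<Longrightarrow> \<bar>D h - g \<bullet> h - hess_form h / 2\<bar> \<le> q * (norm h)\<^sup>2"
    and hn: "norm hn \<le> \<delta>" and min: "\<And>h. D hn \<le> D h" and g: "norm g \<le> dmin * \<delta>"
  shows "(norm (hn + hess_inv g))\<^sup>2 \<le> 34 * q * (norm g)\<^sup>2 / dmin ^ 3"
proof -
  have c: "dmin > 0" by (rule dmin_pos)
  have d0: "\<delta> \<ge> 0" using hn norm_ge_zero[of hn] by linarith
  define N where "N = norm g / dmin"
  have N: "N \<ge> 0" using c by (simp add: N_def)
  have Wg: "norm (hess_inv g) \<le> N" unfolding N_def by (rule norm_hess_inv_le)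
  have "N \<le> \<delta>" using g c by (simp add: N_def divide_le_eq mult.commute)
  then have Wd: "norm (- hess_inv g) \<le> \<delta>" using Wg by simp
  have D0: "D 0 = 0" using D[of 0] d0 by (simp add: hess_form_def)
  have "norm hn \<le> 4 * N"
  proof -
    have "D hn \<le> 0" using min[of 0] D0 by simp
    moreover have "g \<bullet> hn \<ge> - (norm g * norm hn)" using Cauchy_Schwarz_ineq2[of g hn] by linarith
    ultimately have "dmin * (norm hn)\<^sup>2 / 2 - q * (norm hn)\<^sup>2 \<le> norm g * norm hn"
      using D[OF hn] hess_form_ge[of hn] by linarith
    moreover have "q * (norm hn)\<^sup>2 \<le> dmin / 4 * (norm hn)\<^sup>2" using q by (intro mult_right_mono) auto
    ultimately have "dmin / 4 * (norm hn)\<^sup>2 \<le> norm g * norm hn" by (simp add: field_simps)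
    then have "(dmin / 4 * norm hn) * norm hn \<le> norm g * norm hn" by (simp add: power2_eq_square mult.assoc)
    then have "dmin / 4 * norm hn \<le> norm g"
      using mult_le_cancel_right_pos[of "norm hn" "dmin / 4 * norm hn" "norm g"] by (cases "hn = 0") auto
    then show ?thesis using c by (simp add: N_def field_simps)
  qed
  then have hn2: "(norm hn)\<^sup>2 \<le> 16 * N\<^sup>2" using power_mono[of "norm hn" "4 * N" 2] by (simp add: power_mult_distrib)
  have W2: "(norm (- hess_inv g))\<^sup>2 \<le> N\<^sup>2" using power_mono[OF Wg, of 2] by simp
  have "g \<bullet> hn + hess_form hn / 2 - q * (norm hn)\<^sup>2 \<le> g \<bullet> (- hess_inv g) + hess_form (- hess_inv g) / 2 + q * (norm (- hess_inv g))\<^sup>2"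
    using D[OF hn] D[OF Wd] min[of "- hess_inv g"] by linarith
  moreover have "hess_form (- hess_inv g + hess_inv g) = 0" by (simp add: hess_form_def)
  ultimately have "hess_form (hn + hess_inv g) / 2 \<le> q * (norm hn)\<^sup>2 + q * (norm (- hess_inv g))\<^sup>2"
    unfolding complete_square by simp
  also have "\<dots> \<le> q * (16 * N\<^sup>2) + q * N\<^sup>2" using q hn2 W2 by (intro add_mono mult_left_mono) auto
  \<comment> \<open>34 is 2 (16 + 1): the squared norms of the two competitors are at most 16 N^2
    and N^2.\<close>
  finally have "dmin * (norm (hn + hess_inv g))\<^sup>2 \<le> 34 * q * N\<^sup>2" using hess_form_ge[of "hn + hess_inv g"] by simp
  then have "(norm (hn + hess_inv g))\<^sup>2 \<le> 34 * q * N\<^sup>2 / dmin" using c by (simp add: pos_le_divide_eq mult.commute)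
  also have "\<dots> = 34 * q * (norm g)\<^sup>2 / dmin ^ 3" using c by (simp add: N_def power_divide power2_eq_square power3_eq_cube)
  finally show ?thesis .
qed

text \<open>Each of the p components is bounded in probability with budget \<eta> / p, and the norm
  is at most the sum of their absolute values.\<close>

lemma likely_mean_score_le:
  assumes eta: "\<eta> > 0"
  shows "\<exists>K>0. likely M \<eta> (\<lambda>n \<omega>. sqrt (real n) * norm (mean_score n \<omega>) \<le> K)"
proof -
  define p where "p = real CARD('p)"
  have p: "p > 0" by (simp add: p_def)
  have "\<exists>K>0. likely M (\<eta> / p) (\<lambda>n \<omega>. \<bar>\<Sum>i<n. score v0 (X i \<omega>) \<bullet> e j\<bar> \<le> K * sqrt (real n))" for j
    using eta p integrable_score_mult[of v0 "e j" "e j"]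
    by (intro smp.likely_sum_sqrt score_mean_zero) (auto simp: power2_eq_square)
  then obtain K where "\<forall>j. K j > 0 \<and> likely M (\<eta> / p) (\<lambda>n \<omega>. \<bar>\<Sum>i<n. score v0 (X i \<omega>) \<bullet> e j\<bar> \<le> K j * sqrt (real n))"
    using choice[of "\<lambda>j K. K > 0 \<and> likely M (\<eta> / p) (\<lambda>n \<omega>. \<bar>\<Sum>i<n. score v0 (X i \<omega>) \<bullet> e j\<bar> \<le> K * sqrt (real n))"] by blast
  then have K: "\<And>j. K j > 0" "\<And>j. likely M (\<eta> / p) (\<lambda>n \<omega>. \<bar>\<Sum>i<n. score v0 (X i \<omega>) \<bullet> e j\<bar> \<le> K j * sqrt (real n))"
    by simp_all
  have "finite J \<Longrightarrow> likely M (real (card J) * (\<eta> / p)) (\<lambda>n \<omega>. \<forall>j\<in>J. \<bar>\<Sum>i<n. score v0 (X i \<omega>) \<bullet> e j\<bar> \<le> K j * sqrt (real n))" for J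
  proof (induction J rule: finite_induct)
    case empty
    then show ?case unfolding likely_def
      by (intro always_eventually allI bexI[of _ "space M"]) (auto simp: smp.prob_space)
  next
    case (insert j J)
    then show ?case using smp.likely_conj[OF K(2)[of j] insert.IH] by (simp add: algebra_simps)
  qed
  from this[of UNIV] have "likely M \<eta> (\<lambda>n \<omega>. \<forall>j. \<bar>\<Sum>i<n. score v0 (X i \<omega>) \<bullet> e j\<bar> \<le> K j * sqrt (real n))"
    using p by (simp add: p_def)
  then have "likely M \<eta> (\<lambda>n \<omega>. sqrt (real n) * norm (mean_score n \<omega>) \<le> (\<Sum>j\<in>UNIV. K j))"
  proof (rule likely_mono')
    fix n :: nat and \<omega> assume n: "n \<ge> 1" and A: "\<forall>j. \<bar>\<Sum>i<n. score v0 (X i \<omega>) \<bullet> e j\<bar> \<le> K j * sqrt (real n)"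
    have sn: "sqrt (real n) * sqrt (real n) = real n" "sqrt (real n) > 0" using n by auto
    have Gj: "sqrt (real n) * \<bar>mean_score n \<omega> \<bullet> e j\<bar> \<le> K j" for j
    proof -
      have "sqrt (real n) * (sqrt (real n) * \<bar>mean_score n \<omega> \<bullet> e j\<bar>) = \<bar>\<Sum>i<n. score v0 (X i \<omega>) \<bullet> e j\<bar>"
        unfolding mult.assoc[symmetric] sn(1) using n by (simp add: mean_score_def inner_sum_left abs_mult abs_divide)
      also have "\<dots> \<le> sqrt (real n) * K j" using A by (simp add: mult.commute)
      finally show ?thesis using sn(2) by (simp only: mult_le_cancel_left_pos)
    qed
    have "norm (mean_score n \<omega>) = norm (\<Sum>j\<in>UNIV. (mean_score n \<omega> \<bullet> e j) *\<^sub>R e j)" by (rule arg_cong[where f=norm, OF expand])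
    also have "\<dots> \<le> (\<Sum>j\<in>UNIV. \<bar>mean_score n \<omega> \<bullet> e j\<bar>)" by (rule order_trans[OF norm_sum]) simp
    finally have "sqrt (real n) * norm (mean_score n \<omega>) \<le> sqrt (real n) * (\<Sum>j\<in>UNIV. \<bar>mean_score n \<omega> \<bullet> e j\<bar>)" by (intro mult_left_mono) auto
    also have "\<dots> \<le> (\<Sum>j\<in>UNIV. K j)" unfolding sum_distrib_left by (intro sum_mono Gj)
    finally show "sqrt (real n) * norm (mean_score n \<omega>) \<le> (\<Sum>j\<in>UNIV. K j)" .
  qed
  moreover have "(\<Sum>j\<in>UNIV. K j) > 0" using K(1) by (intro sum_pos) auto
  ultimately show ?thesis by blast
qed

definition est_error :: "nat \<Rightarrow> 'b \<Rightarrow> real^'p" where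
  "est_error n \<omega> = sqrt (real n) *\<^sub>R (sgn_v n \<omega> *\<^sub>R v n \<omega> - v0)"

definition lin_error :: "nat \<Rightarrow> 'b \<Rightarrow> real^'p" where
  "lin_error n \<omega> = - (sqrt (real n) *\<^sub>R hess_inv (mean_score n \<omega>))"

text \<open>The accuracy q of the expansion is chosen after the bound K of the scaled score; n times
  the squared deviation is then a fixed multiple of q K^2 and can be pushed below
  \<epsilon>^2.\<close>

lemma linearization:
  assumes ep: "\<epsilon> > 0" and eta: "\<eta> > 0"
  shows "likely M \<eta> (\<lambda>n \<omega>. norm (est_error n \<omega> - lin_error n \<omega>) \<le> \<epsilon>)"
proof -
  have c: "dmin > 0" by (rule dmin_pos)
  have eta3: "\<eta> / 3 > 0" using eta by simp
  obtain K where K: "K > 0" "likely M (\<eta> / 3) (\<lambda>n \<omega>. sqrt (real n) * norm (mean_score n \<omega>) \<le> K)"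
    using likely_mean_score_le[OF eta3] by blast
  \<comment> \<open>The first entry is what \<open>argmin_linearization\<close> requires; the second
    turns its bound into \<epsilon>^2.\<close>
  define q where "q = min (dmin / 4) (\<epsilon>\<^sup>2 * dmin ^ 3 / (34 * K\<^sup>2))"
  have q: "q > 0" "q \<le> dmin / 4" using c ep K by (auto simp: q_def)
  have q_ep: "34 * q * K\<^sup>2 / dmin ^ 3 \<le> \<epsilon>\<^sup>2"
  proof -
    have "q \<le> \<epsilon>\<^sup>2 * dmin ^ 3 / (34 * K\<^sup>2)" by (simp add: q_def)
    then have "q * (34 * K\<^sup>2) \<le> \<epsilon>\<^sup>2 * dmin ^ 3" using K by (simp add: pos_le_divide_eq)
    then show ?thesis using c by (simp add: pos_divide_le_eq mult_ac)
  qed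
  obtain \<delta> where \<delta>: "\<delta> > 0" and quad: "likely M (\<eta> / 3) (\<lambda>n \<omega>. \<forall>h. norm h \<le> \<delta> \<longrightarrow>
     \<bar>smp.avg (loss (v0 + h)) n \<omega> - smp.avg (loss v0) n \<omega> - mean_score n \<omega> \<bullet> h - hess_form h / 2\<bar> \<le> q * (norm h)\<^sup>2)"
    using quadratic_expansion[OF q(1) eta3] by blast
  have cons: "likely M (\<eta> / 3) (\<lambda>n \<omega>. norm (sgn_v n \<omega> *\<^sub>R v n \<omega> - v0) < \<delta>)"
    by (rule consistency_sgn[OF \<delta> eta3])
  have "likely M (\<eta> / 3 + (\<eta> / 3 + \<eta> / 3)) (\<lambda>n \<omega>. sqrt (real n) * norm (mean_score n \<omega>) \<le> K \<and> (\<forall>h. norm h \<le> \<delta> \<longrightarrow>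
     \<bar>smp.avg (loss (v0 + h)) n \<omega> - smp.avg (loss v0) n \<omega> - mean_score n \<omega> \<bullet> h - hess_form h / 2\<bar> \<le> q * (norm h)\<^sup>2) \<and>
     norm (sgn_v n \<omega> *\<^sub>R v n \<omega> - v0) < \<delta>)"
    by (intro smp.likely_conj K quad cons)
  then have "likely M \<eta> (\<lambda>n \<omega>. sqrt (real n) * norm (mean_score n \<omega>) \<le> K \<and> (\<forall>h. norm h \<le> \<delta> \<longrightarrow>
     \<bar>smp.avg (loss (v0 + h)) n \<omega> - smp.avg (loss v0) n \<omega> - mean_score n \<omega> \<bullet> h - hess_form h / 2\<bar> \<le> q * (norm h)\<^sup>2) \<and>
     norm (sgn_v n \<omega> *\<^sub>R v n \<omega> - v0) < \<delta>)" by simp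
  then show ?thesis
  proof (rule likely_mono)
    have "\<forall>\<^sub>F n in sequentially. n \<ge> 1 \<and> real n \<ge> (K / (dmin * \<delta>))\<^sup>2"
      by (intro eventually_conj eventually_ge_at_top eventually_sequentiallyI[of "nat \<lceil>(K / (dmin * \<delta>))\<^sup>2\<rceil>"]) linarith
    then show "\<forall>\<^sub>F n in sequentially. \<forall>\<omega>\<in>space M. (sqrt (real n) * norm (mean_score n \<omega>) \<le> K \<and> (\<forall>h. norm h \<le> \<delta> \<longrightarrow>
     \<bar>smp.avg (loss (v0 + h)) n \<omega> - smp.avg (loss v0) n \<omega> - mean_score n \<omega> \<bullet> h - hess_form h / 2\<bar> \<le> q * (norm h)\<^sup>2) \<and>
     norm (sgn_v n \<omega> *\<^sub>R v n \<omega> - v0) < \<delta>) \<longrightarrow> norm (est_error n \<omega> - lin_error n \<omega>) \<le> \<epsilon>"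
    proof (eventually_elim, intro ballI impI, elim conjE)
      fix n :: nat and \<omega>
      assume n: "n \<ge> 1" and nK: "real n \<ge> (K / (dmin * \<delta>))\<^sup>2" and w: "\<omega> \<in> space M"
        and GK: "sqrt (real n) * norm (mean_score n \<omega>) \<le> K"
        and E: "\<forall>h. norm h \<le> \<delta> \<longrightarrow>
          \<bar>smp.avg (loss (v0 + h)) n \<omega> - smp.avg (loss v0) n \<omega> - mean_score n \<omega> \<bullet> h - hess_form h / 2\<bar> \<le> q * (norm h)\<^sup>2"
        and C: "norm (sgn_v n \<omega> *\<^sub>R v n \<omega> - v0) < \<delta>"
      define hn where "hn = sgn_v n \<omega> *\<^sub>R v n \<omega> - v0"
      have sn: "sqrt (real n) > 0" using n by simp
      have "K / (dmin * \<delta>) \<le> sqrt (real n)" using nK by (rule real_le_rsqrt)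
      then have "K \<le> sqrt (real n) * (dmin * \<delta>)" using c \<delta> by (simp add: pos_divide_le_eq)
      then have "sqrt (real n) * norm (mean_score n \<omega>) \<le> sqrt (real n) * (dmin * \<delta>)" using GK by linarith
      \<comment> \<open>For n this large the minimizer of the quadratic approximation lies in the
        ball where the expansion is valid.\<close>
      then have G: "norm (mean_score n \<omega>) \<le> dmin * \<delta>" using sn by simp
      define D where "D h = smp.avg (loss (v0 + h)) n \<omega> - smp.avg (loss v0) n \<omega>" for h
      have min: "D hn \<le> D h" for h
      proof -
        have "loss (sgn_v n \<omega> *\<^sub>R v n \<omega>) = loss (v n \<omega>)" by (auto simp: sgn_v_def fun_eq_iff)
        then have "smp.avg (loss (v0 + hn)) n \<omega> \<le> smp.avg (loss (v0 + h)) n \<omega>"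
          using v_min[OF n w, of "v0 + h"] by (simp add: emp_obj_avg hn_def)
        then show ?thesis by (simp add: D_def)
      qed
      have "(norm (hn + hess_inv (mean_score n \<omega>)))\<^sup>2 \<le> 34 * q * (norm (mean_score n \<omega>))\<^sup>2 / dmin ^ 3"
        by (rule argmin_linearization[OF q, where D=D and \<delta>=\<delta>]) (use E C min G in \<open>auto simp: D_def hn_def\<close>)
      then have "real n * (norm (hn + hess_inv (mean_score n \<omega>)))\<^sup>2 \<le> real n * (34 * q * (norm (mean_score n \<omega>))\<^sup>2 / dmin ^ 3)" by (intro mult_left_mono) auto
      also have "\<dots> = 34 * q * (sqrt (real n) * norm (mean_score n \<omega>))\<^sup>2 / dmin ^ 3" by (simp add: power_mult_distrib)
      also have "\<dots> \<le> 34 * q * K\<^sup>2 / dmin ^ 3"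
        using GK q c by (intro divide_right_mono mult_left_mono power_mono) auto
      also have "\<dots> \<le> \<epsilon>\<^sup>2" by (rule q_ep)
      finally have "(sqrt (real n) * norm (hn + hess_inv (mean_score n \<omega>)))\<^sup>2 \<le> \<epsilon>\<^sup>2" by (simp add: power_mult_distrib)
      then have le: "sqrt (real n) * norm (hn + hess_inv (mean_score n \<omega>)) \<le> \<epsilon>" by (rule power2_le_imp_le) (use ep in simp)
      have "est_error n \<omega> - lin_error n \<omega> = sqrt (real n) *\<^sub>R (hn + hess_inv (mean_score n \<omega>))"
        by (simp add: est_error_def lin_error_def hn_def scaleR_add_right)
      then show "norm (est_error n \<omega> - lin_error n \<omega>) \<le> \<epsilon>" using le by simp
    qed
  qed
qed

definition score_var :: "'p \<Rightarrow> real" where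
  "score_var i = (\<integral>x. (score v0 x \<bullet> e i)\<^sup>2 \<partial>P)"

text \<open>Mixed moments vanish by \<open>kernel_offdiag\<close>, so the score covariance is
  diagonal in the same frame as the Hessian.\<close>

lemma score_quadratic: "(\<integral>x. (score v0 x \<bullet> u)\<^sup>2 \<partial>P) = (\<Sum>i\<in>UNIV. score_var i * (u \<bullet> e i)\<^sup>2)"
proof -
  have off: "(\<integral>x. (score v0 x \<bullet> e i) * (score v0 x \<bullet> e j) \<partial>P) = (if i = j then score_var i else 0)" for i j
  proof (cases "i = j")
    case False
    then show ?thesis
      using kernel_offdiag[where K="\<lambda>x u w. (score v0 x \<bullet> u) * (score v0 x \<bullet> w)" and i=i and j=j]
      by (simp add: score_invariant)
  qed (simp add: score_var_def power2_eq_square)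
  have "(score v0 x \<bullet> u)\<^sup>2 = (\<Sum>i\<in>UNIV. \<Sum>j\<in>UNIV. (u \<bullet> e i) * (u \<bullet> e j) * ((score v0 x \<bullet> e i) * (score v0 x \<bullet> e j)))" for x
    unfolding inner_eq_sum[of "score v0 x" u] power2_eq_square sum_product by (simp add: mult_ac)
  then have "(\<integral>x. (score v0 x \<bullet> u)\<^sup>2 \<partial>P) =
      (\<Sum>i\<in>UNIV. \<Sum>j\<in>UNIV. (u \<bullet> e i) * (u \<bullet> e j) * (\<integral>x. (score v0 x \<bullet> e i) * (score v0 x \<bullet> e j) \<partial>P))"
    by (simp add: integrable_score_mult)
  then show ?thesis by (simp add: off if_distrib power2_eq_square mult_ac cong: if_cong)
qed

lemma est_error_meas [measurable]: "est_error n \<in> borel_measurable M"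
  unfolding est_error_def sgn_v_def by measurable

lemma lin_error_meas [measurable]: "lin_error n \<in> borel_measurable M"
  unfolding lin_error_def hess_inv_def mean_score_def by measurable

text \<open>In the manner of Cramer and Wold: as the inverse Hessian is self-adjoint, the inner
  product of t with the linear term is a normalized sum of the scalar variables g, to which the
  one-dimensional limit theorem applies.\<close>

theorem est_error_char_conv:
  "(\<lambda>n. \<integral>\<omega>. iexp (t \<bullet> est_error n \<omega>) \<partial>M) \<longlonglongrightarrow>
     complex_of_real (exp (- (\<Sum>i\<in>UNIV. score_var i / (hess_eig i)\<^sup>2 * (t \<bullet> e i)\<^sup>2) / 2))"
proof (rule smp.char_conv_likely_close[OF lin_error_meas est_error_meas linearization])
  define g where "g x = - (score v0 x \<bullet> hess_inv t)" for x
  have [measurable]: "g \<in> borel_measurable borel" unfolding g_def by measurable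
  have g2: "integrable P (\<lambda>x. (g x)\<^sup>2)" unfolding g_def using integrable_score_mult[of v0 "hess_inv t" "hess_inv t"] by (simp add: power2_eq_square)
  have g0: "(\<integral>x. g x \<partial>P) = 0" unfolding g_def by (simp add: score_mean_zero)
  have "t \<bullet> lin_error n \<omega> = (\<Sum>i<n. g (X i \<omega>)) / sqrt (real n)" for n \<omega>
  proof (cases "n = 0")
    case False
    have "sqrt (real n) / real n = 1 / sqrt (real n)" using False by (simp add: real_div_sqrt field_simps)
    moreover have "t \<bullet> lin_error n \<omega> = - (sqrt (real n) / real n) * (\<Sum>i<n. score v0 (X i \<omega>) \<bullet> hess_inv t)"
      by (simp add: lin_error_def hess_inv_self_adjoint[of t] mean_score_def inner_sum_right inner_commute divide_inverse)
    ultimately show ?thesis by (simp add: g_def sum_negf)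
  qed (simp add: lin_error_def)
  then have "(\<lambda>n. \<integral>\<omega>. iexp (t \<bullet> lin_error n \<omega>) \<partial>M) \<longlonglongrightarrow> complex_of_real (exp (- (\<integral>x. (g x)\<^sup>2 \<partial>P) / 2))"
    using smp.char_clt[OF _ g2 g0] by simp
  also have "(\<integral>x. (g x)\<^sup>2 \<partial>P) = (\<Sum>i\<in>UNIV. score_var i / (hess_eig i)\<^sup>2 * (t \<bullet> e i)\<^sup>2)"
    by (simp add: g_def score_quadratic inner_hess_inv power_divide)
  finally show "(\<lambda>n. \<integral>\<omega>. iexp (t \<bullet> lin_error n \<omega>) \<partial>M) \<longlonglongrightarrow>
     complex_of_real (exp (- (\<Sum>i\<in>UNIV. score_var i / (hess_eig i)\<^sup>2 * (t \<bullet> e i)\<^sup>2) / 2))" .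
qed

end

subsection \<open>The limiting covariance\<close>

lemma outer_nth: "outer u w $ i $ j = u $ i * w $ j"
  by (simp add: outer_def matrix_matrix_mult_def columnvector_def rowvector_def)

lemma outer_mult_vec: "outer u w *v x = (w \<bullet> x) *\<^sub>R u"
  by (simp add: vec_eq_iff matrix_vector_mult_def outer_nth inner_vec_def sum_distrib_left mult_ac)

lemma qform_outer: "qform (outer u w) x = (x \<bullet> u) * (x \<bullet> w)"
  by (simp add: qform_def outer_mult_vec inner_commute mult.commute)

lemma norm_outer: "norm (outer u w) = norm u * norm w"
proof -
  have "outer u w $ i = (u $ i) *\<^sub>R w" for i by (simp add: vec_eq_iff outer_nth)
  then have "norm (outer u w) = L2_set (\<lambda>i. \<bar>u $ i\<bar> * norm w) UNIV" by (simp add: norm_vec_def[of "outer u w"])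
  also have "\<dots> = norm u * norm w" by (simp add: L2_set_left_distrib[symmetric] norm_vec_def[of u])
  finally show ?thesis .
qed

lemma outer_measurable [measurable]:
  fixes f g :: "'a \<Rightarrow> real^'p"
  assumes [measurable]: "f \<in> borel_measurable M" "g \<in> borel_measurable M"
  shows "(\<lambda>x. outer (f x) (g x)) \<in> borel_measurable M"
proof -
  have "outer u w = (\<Sum>i\<in>UNIV. \<Sum>j\<in>UNIV. (u $ i * w $ j) *\<^sub>R axis i (axis j 1))" for u w :: "real^'p"
    by (simp add: vec_eq_iff outer_nth axis_def if_distrib if_distribR sum.If_cases cong: if_cong)
  moreover have "(\<lambda>x. f x $ i) \<in> borel_measurable M" "(\<lambda>x. g x $ i) \<in> borel_measurable M" for i
    using borel_measurable_inner[OF assms(1), of "\<lambda>_. axis i 1"] borel_measurable_inner[OF assms(2), of "\<lambda>_. axis i 1"]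
    by (simp_all add: inner_axis)
  ultimately show ?thesis
    by (simp only:) (intro borel_measurable_sum borel_measurable_scaleR borel_measurable_times borel_measurable_const)
qed

lemma qform_scaleR: "qform (c *\<^sub>R A) u = c * qform A u"
  by (simp add: qform_def scaleR_matrix_vector_assoc[symmetric])

lemma bounded_linear_mult_vec: "bounded_linear (\<lambda>A :: real^'p^'p. A *v u)"
proof -
  have "linear (\<lambda>A :: real^'p^'p. A *v u)"
    by (rule linearI) (simp_all add: matrix_vector_mult_add_rdistrib scaleR_matrix_vector_assoc)
  then show ?thesis by (simp add: linear_conv_bounded_linear)
qed

lemma integral_mult_vec:
  fixes F :: "'a \<Rightarrow> real^'p^'p"
  assumes "integrable M F"
  shows "integrable M (\<lambda>x. F x *v u)" "(\<integral>x. F x *v u \<partial>M) = (\<integral>x. F x \<partial>M) *v u"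
  using integrable_bounded_linear[OF bounded_linear_mult_vec assms] integral_bounded_linear[OF bounded_linear_mult_vec assms] by auto

text \<open>The quadratic form is bounded linear in the matrix, so it commutes with the
  matrix-valued integrals that define the constants.\<close>

lemma qform_integral:
  fixes F :: "'a \<Rightarrow> real^'p^'p"
  assumes "integrable M F"
  shows "qform (\<integral>x. F x \<partial>M) u = (\<integral>x. qform (F x) u \<partial>M)" "integrable M (\<lambda>x. qform (F x) u)"
  unfolding qform_def integral_mult_vec(2)[OF assms, symmetric]
  using integral_mult_vec(1)[OF assms] by (auto simp: integral_inner_right)

lemma matrix_eq_axis:
  fixes A B :: "real^'p^'p"
  assumes "\<And>j. A *v axis j 1 = B *v axis j 1"
  shows "A = B"
  using assms by (simp add: matrix_vector_mult_basis vec_eq_iff column_def)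

definition diag :: "('p \<Rightarrow> real) \<Rightarrow> real^'p^'p" where
  "diag f = (\<chi> i j. if i = j then f i else 0)"

lemma transpose_diag: "transpose (diag f) = diag f"
  by (auto simp: diag_def vec_eq_iff transpose_def)

lemma diag_mult_vec: "(diag f *v x) $ i = f i * x $ i"
  by (simp add: diag_def matrix_vector_mult_def if_distrib if_distribR cong: if_cong)

lemma diag_mult: "diag f ** diag g = diag (\<lambda>i. f i * g i)"
  by (simp add: matrix_eq matrix_vector_mul_assoc[symmetric] vec_eq_iff[where 'a=real] diag_mult_vec mult.assoc)

text \<open>The columns of U diagonalize A. By m2 <= m1 the maximal eigenvalue is m1, and the
  characteristic polynomial has the shape that \<open>phi_rest\<close> asks for; the definite
  description also requires uniqueness of the repeated root.\<close>

lemma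
  fixes A U :: "real^'p^'p"
  assumes U: "orthogonal_matrix U" and ks: "k1 \<noteq> (k2 :: 'p)" and m: "m2 \<le> m1"
    and eig: "\<And>j. A *v column j U = (if j = k1 then m1 else m2) *\<^sub>R column j U"
  shows phi1_eqI: "phi1 A = m1" and phi_rest_eqI: "phi_rest A = m2"
proof -
  define mm where "mm j = (if j = k1 then m1 else m2)" for j
  have UU: "U ** transpose U = mat 1" "transpose U ** U = mat 1" using U by (auto simp: orthogonal_matrix_def)
  have "norm (column j U) = 1" for j
    using U by (simp add: orthogonal_matrix_orthonormal_columns)
  then have nz: "column j U \<noteq> 0" for j using norm_zero zero_neq_one by metis
  have "{l. is_eigenvalue A l} = {m1, m2}"
  proof (intro equalityI subsetI)
    fix l assume "l \<in> {l. is_eigenvalue A l}"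
    then obtain x where x: "x \<noteq> 0" "A *v x = l *\<^sub>R x" by (auto simp: is_eigenvalue_def)
    define y where "y = transpose U *v x"
    have xy: "x = U *v y" unfolding y_def matrix_vector_mul_assoc UU by simp
    then have "y \<noteq> 0" using x(1) by auto
    then obtain j where j: "y $ j \<noteq> 0" by (auto simp: vec_eq_iff)
    define D where "D = diag mm"
    have "A ** U = U ** D"
    proof (rule matrix_eq_axis)
      fix j
      have "D *v axis j 1 = mm j *\<^sub>R axis j 1"
        by (simp add: vec_eq_iff D_def diag_mult_vec axis_def)
      then have "(U ** D) *v axis j 1 = mm j *\<^sub>R column j U"
        by (simp only: matrix_vector_mul_assoc[symmetric] matrix_vector_mult_scaleR) (simp only: matrix_vector_mult_basis)
      moreover have "(A ** U) *v axis j 1 = A *v column j U"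
        by (simp only: matrix_vector_mul_assoc[symmetric]) (simp only: matrix_vector_mult_basis)
      ultimately show "(A ** U) *v axis j 1 = (U ** D) *v axis j 1" by (simp only: eig mm_def)
    qed
    then have "A *v x = U *v (D *v y)" by (simp add: xy matrix_vector_mul_assoc)
    then have "transpose U *v (l *\<^sub>R x) = transpose U *v (U *v (D *v y))" using x(2) by simp
    then have "l *\<^sub>R y = D *v y"
      unfolding matrix_vector_mult_scaleR y_def[symmetric] by (simp only: matrix_vector_mul_assoc[of "transpose U" U] UU matrix_vector_mul_lid)
    moreover have "(D *v y) $ j = mm j * y $ j"
      by (simp add: D_def diag_mult_vec)
    ultimately have "l * y $ j = mm j * y $ j" by (metis vector_scaleR_component real_scaleR_def)
    then show "l \<in> {m1, m2}" using j by (auto simp: mm_def split: if_splits)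
  next
    fix l assume "l \<in> {m1, m2}"
    then show "l \<in> {l. is_eigenvalue A l}"
      using eig[of k1] eig[of k2] nz ks by (auto simp: is_eigenvalue_def)
  qed
  then show phi1: "phi1 A = m1" using m by (simp add: phi1_def)
  have det: "det (mat t - A) = (t - m1) * (t - m2) ^ (CARD('p) - 1)" for t
  proof -
    define D where "D = diag (\<lambda>i. t - mm i)"
    have "(mat t - A) ** U = U ** D"
    proof (rule matrix_eq_axis)
      fix j
      have "D *v axis j 1 = (t - mm j) *\<^sub>R axis j 1"
        by (simp add: vec_eq_iff D_def diag_mult_vec axis_def)
      then have "(U ** D) *v axis j 1 = (t - mm j) *\<^sub>R column j U"
        by (simp only: matrix_vector_mul_assoc[symmetric] matrix_vector_mult_scaleR) (simp only: matrix_vector_mult_basis)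
      moreover have "mat t *v x = t *\<^sub>R x" for x :: "real^'p"
        by (simp add: vec_eq_iff mat_def matrix_vector_mult_def if_distrib if_distribR cong: if_cong)
      then have "(mat t - A) *v column j U = t *\<^sub>R column j U - A *v column j U"
        by (simp only: matrix_vector_mult_diff_rdistrib)
      moreover have "((mat t - A) ** U) *v axis j 1 = (mat t - A) *v column j U"
        by (simp only: matrix_vector_mul_assoc[symmetric]) (simp only: matrix_vector_mult_basis)
      ultimately show "((mat t - A) ** U) *v axis j 1 = (U ** D) *v axis j 1"
        by (simp only: eig mm_def scaleR_diff_left)
    qed
    then have "det ((mat t - A) ** U) = det (U ** D)" by simp
    then have "det (mat t - A) * det U = det U * det D" by (simp only: det_mul)
    moreover have "det U \<noteq> 0" using det_orthogonal_matrix[OF U] by auto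
    ultimately have "det (mat t - A) = det D" by simp
    also have "\<dots> = (\<Prod>i\<in>UNIV. t - mm i)" by (subst det_diagonal) (auto simp: D_def diag_def)
    also have "\<dots> = (t - mm k1) * (\<Prod>i\<in>UNIV - {k1}. t - mm i)" by (rule prod.remove) auto
    also have "(\<Prod>i\<in>UNIV - {k1}. t - mm i) = (\<Prod>i\<in>UNIV - {k1}. t - m2)" by (intro prod.cong) (auto simp: mm_def)
    also have "\<dots> = (t - m2) ^ (CARD('p) - 1)" by (simp add: card_Diff_singleton)
    finally show ?thesis by (simp add: mm_def)
  qed
  have card: "CARD('p) - 1 > 0" using card_mono[of UNIV "{k1, k2}"] ks by simp
  show "phi_rest A = m2"
    unfolding phi_rest_def phi1 det
  proof (rule the_equality)
    fix l assume l: "\<forall>t. (t - m1) * (t - m2) ^ (CARD('p) - 1) = (t - m1) * (t - l) ^ (CARD('p) - 1)"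
    show "l = m2"
    \<comment> \<open>Evaluation at t = l forces l = m2 unless l = m1, when it says nothing; in that
      case t = m2 is used.\<close>
    proof (cases "l = m1")
      case True
      then show ?thesis using spec[OF l, of m2] card by (auto simp: zero_power)
    next
      case False
      then show ?thesis using spec[OF l, of l] card by (auto simp: zero_power)
    qed
  qed simp
qed

lemma quadratic_form_diag:
  fixes U :: "real^'p^'p"
  shows "t \<bullet> ((U ** diag f ** transpose U) *v t) = (\<Sum>i\<in>UNIV. f i * (t \<bullet> column i U)\<^sup>2)"
proof -
  have c: "(t v* U) $ i = t \<bullet> column i U" for i
    using transpose_mult_nth[of U t i] by simp
  have "t \<bullet> ((U ** diag f ** transpose U) *v t) = t \<bullet> (U *v (diag f *v (t v* U)))"
    by (simp add: matrix_vector_mul_assoc[symmetric])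
  also have "\<dots> = (t v* U) \<bullet> (diag f *v (t v* U))" by (simp add: dot_lmul_matrix)
  also have "\<dots> = (\<Sum>i\<in>UNIV. f i * (t \<bullet> column i U)\<^sup>2)"
    by (simp add: inner_vec_def diag_mult_vec c power2_eq_square mult_ac)
  finally show ?thesis .
qed

text \<open>Every square root A of S yields the same characteristic function, since the squared norm
  of A' t is t . S t. The given \<open>A0\<close> guarantees that the choice in
  \<open>mvnormal\<close> satisfies its specification.\<close>

lemma
  fixes S A0 :: "real^'p^'p"
  assumes A0: "A0 ** transpose A0 = S"
  shows prob_space_mvnormal: "prob_space (mvnormal 0 S)"
    and sets_mvnormal: "sets (mvnormal 0 S) = sets borel"
    and char_mvnormal: "(\<integral>x. iexp (t \<bullet> x) \<partial>mvnormal 0 S) = complex_of_real (exp (- (t \<bullet> (S *v t)) / 2))"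
proof -
  define A where "A = (SOME A :: real^'p^'p. A ** transpose A = S)"
  have A: "A ** transpose A = S" unfolding A_def by (rule someI[of _ A0]) (rule A0)
  have m: "mvnormal 0 S = distr std_mvnormal borel (\<lambda>w. A *v w)" by (simp add: mvnormal_def A_def)
  have [measurable]: "(\<lambda>w. A *v w) \<in> borel_measurable borel"
    by (auto intro!: borel_measurable_continuous_onI linear_continuous_on)
  show "prob_space (mvnormal 0 S)" unfolding m
    by (rule prob_space.prob_space_distr[OF prob_space_std_mvnormal]) measurable
  show "sets (mvnormal 0 S) = sets borel" by (simp add: m)
  have "(norm (t v* A))\<^sup>2 = t \<bullet> (A *v (t v* A))" by (simp add: power2_norm_eq_inner dot_lmul_matrix)
  also have "\<dots> = t \<bullet> (S *v t)" by (simp add: A[symmetric] matrix_vector_mul_assoc[symmetric])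
  finally have n: "(norm (t v* A))\<^sup>2 = t \<bullet> (S *v t)" .
  have "(\<integral>x. iexp (t \<bullet> x) \<partial>mvnormal 0 S) = (\<integral>w. iexp (t \<bullet> (A *v w)) \<partial>std_mvnormal)"
    unfolding m by (subst integral_distr) auto
  also have "\<dots> = (\<integral>w. iexp ((t v* A) \<bullet> w) \<partial>std_mvnormal)" by (simp only: dot_lmul_matrix)
  finally show "(\<integral>x. iexp (t \<bullet> x) \<partial>mvnormal 0 S) = complex_of_real (exp (- (t \<bullet> (S *v t)) / 2))"
    by (simp only: char_std_mvnormal n)
qed

section \<open>Moments of the law and the constants of the limit\<close>

context elliptical
begin

definition mom :: "'p \<Rightarrow> real" where
  "mom i = (\<integral>x. (x \<bullet> e i)\<^sup>2 \<partial>P)"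

lemma integrable_inner_sq: "integrable P (\<lambda>x. (x \<bullet> u) * (x \<bullet> w))"
proof (rule Bochner_Integration.integrable_bound)
  show "integrable P (\<lambda>x. (norm u * norm w) * (norm x)\<^sup>2)" using second_moment by simp
  have "\<bar>(x \<bullet> u) * (x \<bullet> w)\<bar> \<le> (norm u * norm w) * (norm x)\<^sup>2" for x
    using mult_mono[OF Cauchy_Schwarz_ineq2[of x u] Cauchy_Schwarz_ineq2[of x w]]
    by (simp add: abs_mult power2_eq_square mult_ac)
  then show "AE x in P. norm ((x \<bullet> u) * (x \<bullet> w)) \<le> norm ((norm u * norm w) * (norm x)\<^sup>2)" by (intro AE_I2) simp
qed measurable

lemma inner_moment: "(\<integral>x. (x \<bullet> e i) * (x \<bullet> e j) \<partial>P) = (if i = j then (if i = k1 then mom k1 else mom k2) else 0)"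
proof -
  have inv: "(T x \<bullet> T u) * (T x \<bullet> T w) = (x \<bullet> u) * (x \<bullet> w)" if "orthogonal_transformation T" for T x u w
    using that by (simp add: orthogonal_transformation_def)
  show ?thesis
  proof (cases "i = j")
    case False
    then show ?thesis
      using kernel_offdiag[where K="\<lambda>x u w. (x \<bullet> u) * (x \<bullet> w)" and i=i and j=j] by (simp add: inv)
  next
    case True
    show ?thesis
    proof (cases "i = k1")
      case False
      then show ?thesis using True ks
          kernel_diag[where K="\<lambda>x u w. (x \<bullet> u) * (x \<bullet> w)" and i=i and j=k2] by (simp add: inv mom_def power2_eq_square)
    qed (use True in \<open>simp add: mom_def power2_eq_square\<close>)
  qed
qed

lemma integrable_id: "integrable P (\<lambda>x. x)"
  using integrable_norm by (rule Bochner_Integration.integrable_bound) auto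

lemma mean_zero: "(\<integral>x. x \<partial>P) = 0"
proof -
  have "(\<integral>x. x \<partial>P) \<bullet> e i = 0" for i
  proof -
    have "(\<integral>x. (- x) \<bullet> e i \<partial>P) = (\<integral>x. x \<bullet> e i \<partial>P)"
      by (rule integral_P_uminus) measurable
    then show ?thesis by (simp add: integral_inner_left[OF integrable_id])
  qed
  then show ?thesis using expand[of "\<integral>x. x \<partial>P"] by simp
qed

text \<open>The mean is 0 and mixed second moments vanish by symmetry, so the frame consists of
  eigenvectors.\<close>

lemma cov_eigen: "cov P *v e j = (if j = k1 then mom k1 else mom k2) *\<^sub>R e j"
proof -
  have int: "integrable P (\<lambda>x. outer x x)"
    by (rule Bochner_Integration.integrable_bound[OF second_moment]) (auto simp: norm_outer power2_eq_square)
  have "cov P = (\<integral>x. outer x x \<partial>P)" by (simp add: cov_def mean_zero)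
  then have *: "cov P *v e j = (\<integral>x. outer x x *v e j \<partial>P)" using integral_mult_vec(2)[OF int] by simp
  have "(cov P *v e j) \<bullet> e i = (if i = j then (if i = k1 then mom k1 else mom k2) else 0)" for i
  proof -
    have "(cov P *v e j) \<bullet> e i = (\<integral>x. (outer x x *v e j) \<bullet> e i \<partial>P)"
      unfolding * by (rule integral_inner_left[OF integral_mult_vec(1)[OF int], symmetric])
    also have "\<dots> = (\<integral>x. (x \<bullet> e i) * (x \<bullet> e j) \<partial>P)" by (simp add: outer_mult_vec mult.commute)
    finally show ?thesis by (simp add: inner_moment)
  qed
  note comp = this
  have "cov P *v e j = (\<Sum>i\<in>UNIV. ((cov P *v e j) \<bullet> e i) *\<^sub>R e i)" by (rule expand)
  also have "\<dots> = (\<Sum>i\<in>UNIV. if i = j then (if j = k1 then mom k1 else mom k2) *\<^sub>R e j else 0)"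
    unfolding comp by (intro sum.cong) auto
  finally show ?thesis by simp
qed

text \<open>Swapping the two axes, under which the density decreases wherever \<open>x\<^sub>1\<^sup>2 > x\<^sub>2\<^sup>2\<close>.\<close>

lemma mom_le: "mom k2 \<le> mom k1"
proof -
  let ?T = "reflection (e k1 - e k2)"
  define h where "h x = dens x * ((x \<bullet> e k1)\<^sup>2 - (x \<bullet> e k2)\<^sup>2)" for x
  have T: "orthogonal_transformation ?T" by (rule orthogonal_transformation_reflection)
  note [measurable] = borel_measurable_orthogonal_transformation[OF T]
  have Te: "?T (e k1) = e k2" by (rule reflection_swap) simp
  then have Te2: "?T (e k2) = e k1" using reflection_involution[of "e k1 - e k2" "e k1"] by simp
  have T1: "?T x \<bullet> e k1 = x \<bullet> e k2" and T2: "?T x \<bullet> e k2 = x \<bullet> e k1" for x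
    using T Te Te2 unfolding orthogonal_transformation_def by metis+
  have i2: "integrable P (\<lambda>x. (x \<bullet> e i)\<^sup>2)" for i using integrable_inner_sq[of "e i" "e i"] by (simp add: power2_eq_square)
  have [measurable]: "h \<in> borel_measurable borel" unfolding h_def by measurable
  have hi: "integrable lborel h" unfolding h_def by (rule integrable_P[THEN iffD1]) (use i2 in auto)
  have "mom k1 - mom k2 = (\<integral>x. (x \<bullet> e k1)\<^sup>2 - (x \<bullet> e k2)\<^sup>2 \<partial>P)" unfolding mom_def using i2 by simp
  also have "\<dots> = (\<integral>x. h x \<partial>lborel)" unfolding h_def by (rule integral_P) measurable
  finally have m: "mom k1 - mom k2 = (\<integral>x. h x \<partial>lborel)" .
  have dl: "distr lborel borel ?T = lborel" using orthogonal_invariant_lborel T by (auto simp: orthogonal_invariant_def)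
  have hT: "(\<integral>x. h (?T x) \<partial>lborel) = (\<integral>x. h x \<partial>lborel)" "integrable lborel (\<lambda>x. h (?T x))"
  proof -
    show "(\<integral>x. h (?T x) \<partial>lborel) = (\<integral>x. h x \<partial>lborel)"
      by (subst (2) dl[symmetric], subst integral_distr) auto
    have "integrable (distr lborel borel ?T) h" using hi by (simp add: dl)
    then show "integrable lborel (\<lambda>x. h (?T x))" by (subst (asm) integrable_distr_eq) auto
  qed
  \<comment> \<open>Adding the swapped copy gives the product of \<open>dens x - dens (?T x)\<close>
    with the difference of the two squared components; its factors never have opposite
    signs.\<close>
  have "0 \<le> (\<integral>x. h x + h (?T x) \<partial>lborel)"
  proof (rule integral_nonneg_AE)
    have mono: "dens y \<le> dens x" if "x \<noteq> 0" "y \<noteq> 0" "norm y = norm x" "(y \<bullet> e k1)\<^sup>2 \<le> (x \<bullet> e k1)\<^sup>2" for x y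
    proof -
      let ?r = "\<lambda>x. (norm x)\<^sup>2 - a * (x \<bullet> e k1)\<^sup>2"
      have "a * (y \<bullet> e k1)\<^sup>2 \<le> a * (x \<bullet> e k1)\<^sup>2" using a that by (intro mult_left_mono) auto
      then have le: "sqrt (?r x) \<le> sqrt (?r y)" using that by simp
      have pos: "sqrt (?r x) > 0" "sqrt (?r y) > 0" using radicand_pos[OF that(1)] radicand_pos[OF that(2)] by simp_all
      show ?thesis
        using monotone_onD[OF \<kappa>_anti, of "sqrt (?r x)" "sqrt (?r y)"] le pos
        unfolding dens_def greaterThan_iff by (cases "sqrt (?r x) = sqrt (?r y)") (simp, linarith)
    qed
    show "AE x in lborel. 0 \<le> h x + h (?T x)"
      using AE_lborel_neq_0
    proof eventually_elim
      case (elim x)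
      have n: "norm (?T x) = norm x" by simp
      then have Tx: "?T x \<noteq> 0" using elim by (metis norm_eq_zero)
      have "h x + h (?T x) = (dens x - dens (?T x)) * ((x \<bullet> e k1)\<^sup>2 - (x \<bullet> e k2)\<^sup>2)"
        by (simp add: h_def T1 T2 algebra_simps)
      moreover have "\<dots> \<ge> 0"
      proof (cases "(x \<bullet> e k2)\<^sup>2 \<le> (x \<bullet> e k1)\<^sup>2")
        case True
        then show ?thesis using mono[OF elim Tx n] by (intro mult_nonneg_nonneg) (auto simp: T1)
      next
        case False
        then show ?thesis using mono[OF Tx elim n[symmetric]] by (intro mult_nonpos_nonpos) (auto simp: T1)
      qed
      ultimately show ?case by simp
    qed
  qed
  also have "\<dots> = 2 * (mom k1 - mom k2)" using hi hT by (simp add: m)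
  finally show ?thesis by simp
qed

text \<open>By Cauchy-Schwarz the squared inner product cancels the denominator, and what remains is
  quadratic in x.\<close>

lemma integrable_grad_moment: "integrable P (\<lambda>x. ((norm (v + x))\<^sup>2 / (norm (v - x))\<^sup>2) * (u \<bullet> (v - x))\<^sup>2)"
proof (rule Bochner_Integration.integrable_bound)
  show "integrable P (\<lambda>x. (2 * (norm v)\<^sup>2 + 2 * (norm x)\<^sup>2) * (norm u)\<^sup>2)" using second_moment by simp
  show "AE x in P. norm (((norm (v + x))\<^sup>2 / (norm (v - x))\<^sup>2) * (u \<bullet> (v - x))\<^sup>2) \<le> norm ((2 * (norm v)\<^sup>2 + 2 * (norm x)\<^sup>2) * (norm u)\<^sup>2)"
  proof (rule AE_I2)
    fix x
    have "(u \<bullet> (v - x))\<^sup>2 \<le> (norm u)\<^sup>2 * (norm (v - x))\<^sup>2"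
      using power_mono[OF Cauchy_Schwarz_ineq2[of u "v - x"], of 2] by (simp add: power_mult_distrib)
    then have "(norm (v + x))\<^sup>2 / (norm (v - x))\<^sup>2 * (u \<bullet> (v - x))\<^sup>2 \<le> (norm (v + x))\<^sup>2 / (norm (v - x))\<^sup>2 * ((norm u)\<^sup>2 * (norm (v - x))\<^sup>2)"
      by (intro mult_left_mono) auto
    also have "\<dots> \<le> (norm (v + x))\<^sup>2 * (norm u)\<^sup>2" by (cases "norm (v - x) = 0") auto
    also have "\<dots> \<le> (2 * (norm v)\<^sup>2 + 2 * (norm x)\<^sup>2) * (norm u)\<^sup>2"
    proof (rule mult_right_mono)
      have "(norm (v + x))\<^sup>2 \<le> (norm v + norm x)\<^sup>2" by (intro power_mono norm_triangle_ineq) auto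
      also have "\<dots> \<le> 2 * (norm v)\<^sup>2 + 2 * (norm x)\<^sup>2"
        using zero_le_power2[of "norm v - norm x"] by (simp add: power2_eq_square algebra_simps)
      finally show "(norm (v + x))\<^sup>2 \<le> 2 * (norm v)\<^sup>2 + 2 * (norm x)\<^sup>2" .
    qed simp
    finally show "norm (((norm (v + x))\<^sup>2 / (norm (v - x))\<^sup>2) * (u \<bullet> (v - x))\<^sup>2) \<le> norm ((2 * (norm v)\<^sup>2 + 2 * (norm x)\<^sup>2) * (norm u)\<^sup>2)"
      by simp
  qed
qed measurable

text \<open>The two singular parts of the squared score have the same mean because P is symmetric,
  hence the factor 2; the cross term contributes the other two summands. For v = \<open>v0\<close>
  and u = \<open>e k1\<close> this is the numerator of \<open>q1\<close>.\<close>

lemma score_second_moment: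
  "(\<integral>x. (score v x \<bullet> u)\<^sup>2 \<partial>P) = 2 * grad_moment P v u + 2 * (v \<bullet> u)\<^sup>2 - 2 * (\<integral>x. (x \<bullet> u)\<^sup>2 \<partial>P)"
proof -
  define A where "A x = ((norm (v + x))\<^sup>2 / (norm (v - x))\<^sup>2) * (u \<bullet> (v - x))\<^sup>2" for x
  have A: "integrable P A" unfolding A_def by (rule integrable_grad_moment)
  have [measurable]: "A \<in> borel_measurable borel" unfolding A_def by measurable
  have A': "integrable P (\<lambda>x. A (- x))" "(\<integral>x. A (- x) \<partial>P) = (\<integral>x. A x \<partial>P)"
    using integrable_P_uminus[OF A] integral_P_uminus[of A] by auto
  have i2: "integrable P (\<lambda>x. (x \<bullet> u)\<^sup>2)" using integrable_inner_sq[of u u] by (simp add: power2_eq_square)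
  have "(\<integral>x. (score v x \<bullet> u)\<^sup>2 \<partial>P) = (\<integral>x. A x + A (- x) + 2 * (v \<bullet> u)\<^sup>2 - 2 * (x \<bullet> u)\<^sup>2 \<partial>P)"
  proof (rule integral_cong_AE)
    show "AE x in P. (score v x \<bullet> u)\<^sup>2 = A x + A (- x) + 2 * (v \<bullet> u)\<^sup>2 - 2 * (x \<bullet> u)\<^sup>2"
      using AE_nprod_pos[of v] by eventually_elim (simp add: score_inner_sq(1) A_def)
  qed measurable
  also have "\<dots> = 2 * (\<integral>x. A x \<partial>P) + 2 * (v \<bullet> u)\<^sup>2 - 2 * (\<integral>x. (x \<bullet> u)\<^sup>2 \<partial>P)"
    using A A' i2 prob_space by simp
  finally show ?thesis by (simp add: grad_moment_def A_def)
qed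

text \<open>The integrand of \<open>M2\<close> and its image under x -> -x have the same mean, hence
  twice \<open>M2\<close>; the factor 2 of \<open>M4\<close> is what remains of the cross
  term.\<close>

lemma hess_moment:
  assumes v: "v \<noteq> 0"
  shows "(\<integral>x. hess v x u u \<partial>P) = qform (M1 P v) u - 2 * qform (M2 P v) u + 2 * qform (M4 P v) u"
proof -
  let ?env = "\<lambda>x. (2 * norm x + 2 * norm v + 1)\<^sup>2 / nprod v x"
  have ratio: "norm (v + x) / norm (v - x) \<le> ?env x" "norm (v - x) / norm (v + x) \<le> ?env x"
    if "nprod v x > 0" for x
  proof -
    have p: "norm (v - x) > 0" "norm (v + x) > 0" using that by (auto simp: nprod_pos_iff eq_neg_iff_add_eq_0 add.commute)
    have s: "nprod v x = norm (v - x) * norm (v + x)" by (simp add: nprod_def norm_minus_commute add.commute)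
    have T: "norm (v + x) \<le> 2 * norm x + 2 * norm v + 1" "norm (v - x) \<le> 2 * norm x + 2 * norm v + 1"
      using norm_triangle_ineq[of v x] norm_triangle_ineq4[of v x] norm_ge_zero[of v] norm_ge_zero[of x] by linarith+
    have "norm (v + x) / norm (v - x) = (norm (v + x))\<^sup>2 / nprod v x"
      "norm (v - x) / norm (v + x) = (norm (v - x))\<^sup>2 / nprod v x"
      using p by (auto simp: s power2_eq_square)
    then show "norm (v + x) / norm (v - x) \<le> ?env x" "norm (v - x) / norm (v + x) \<le> ?env x"
      using T that by (auto intro!: divide_right_mono power_mono)
  qed
  have env: "integrable P ?env" by (rule integrable_envelope[OF v])
  have env0: "?env x \<ge> 0" for x by simp
  define F1 where "F1 x = norm (v + x) / norm (v - x) + norm (v - x) / norm (v + x)" for x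
  define F2 where "F2 x = (norm (v + x) / norm (v - x) ^ 3) *\<^sub>R outer (v - x) (v - x)" for x
  define F4 where "F4 x = (1 / (norm (v + x) * norm (v - x))) *\<^sub>R outer (v + x) (v - x)" for x
  have [measurable]: "F1 \<in> borel_measurable borel" "F2 \<in> borel_measurable borel" "F4 \<in> borel_measurable borel"
    unfolding F1_def F2_def F4_def by measurable
  have i1: "integrable P F1"
  proof (rule Bochner_Integration.integrable_bound)
    show "integrable P (\<lambda>x. 2 * ?env x)" by (intro integrable_mult_right env)
    show "AE x in P. norm (F1 x) \<le> norm (2 * ?env x)"
      using AE_nprod_pos[of v] by eventually_elim (use ratio in \<open>force simp: F1_def abs_of_nonneg\<close>)
  qed measurable
  have i2: "integrable P F2"
  proof (rule Bochner_Integration.integrable_bound[OF env])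
    show "AE x in P. norm (F2 x) \<le> norm (?env x)"
      using AE_nprod_pos[of v]
    proof eventually_elim
      case (elim x)
      have "norm (F2 x) = norm (v + x) / norm (v - x)"
        by (cases "norm (v - x) = 0") (auto simp: F2_def norm_outer power3_eq_cube)
      then show ?case using ratio(1)[OF elim] by simp
    qed
  qed measurable
  have i4: "integrable P F4"
  proof (rule integrable_const_bound[where B=1])
    show "AE x in P. norm (F4 x) \<le> 1" by (auto simp: F4_def norm_outer)
  qed measurable
  define q2 where "q2 x = qform (F2 x) u" for x
  have q2: "q2 x = norm (v + x) / norm (v - x) ^ 3 * (u \<bullet> (v - x))\<^sup>2" for x
    by (simp add: q2_def F2_def qform_scaleR qform_outer power2_eq_square)
  have [measurable]: "q2 \<in> borel_measurable borel" unfolding q2[abs_def] by measurable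
  have iq2: "integrable P q2" unfolding q2_def by (rule qform_integral(2)[OF i2])
  have q2': "integrable P (\<lambda>x. q2 (- x))" "(\<integral>x. q2 (- x) \<partial>P) = (\<integral>x. q2 x \<partial>P)"
    using integrable_P_uminus[OF iq2] integral_P_uminus[of q2] by auto
  have iq4: "integrable P (\<lambda>x. qform (F4 x) u)" by (rule qform_integral(2)[OF i4])
  have "(\<integral>x. hess v x u u \<partial>P) = (\<integral>x. F1 x * (u \<bullet> u) + 2 * qform (F4 x) u - q2 x - q2 (- x) \<partial>P)"
  proof (rule integral_cong_AE)
    show "AE x in P. hess v x u u = F1 x * (u \<bullet> u) + 2 * qform (F4 x) u - q2 x - q2 (- x)"
      using AE_nprod_pos[of v]
      by eventually_elim (simp add: score_inner_sq(2) F1_def F4_def q2 qform_scaleR qform_outer)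
    show "(\<lambda>x. F1 x * (u \<bullet> u) + 2 * qform (F4 x) u - q2 x - q2 (- x)) \<in> borel_measurable P"
      using borel_measurable_integrable[OF iq4] by measurable
  qed measurable
  also have "\<dots> = (\<integral>x. F1 x \<partial>P) * (u \<bullet> u) + 2 * (\<integral>x. qform (F4 x) u \<partial>P) - 2 * (\<integral>x. q2 x \<partial>P)"
    using i1 iq4 iq2 q2' by simp
  also have "(\<integral>x. F1 x \<partial>P) * (u \<bullet> u) = qform (M1 P v) u"
    by (simp add: M1_def F1_def qform_scaleR) (simp add: qform_def)
  also have "(\<integral>x. qform (F4 x) u \<partial>P) = qform (M4 P v) u"
    unfolding M4_def F4_def[symmetric] by (rule qform_integral(1)[OF i4, symmetric])
  also have "(\<integral>x. q2 x \<partial>P) = qform (M2 P v) u"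
    unfolding M2_def F2_def[symmetric] q2_def by (rule qform_integral(1)[OF i2, symmetric])
  finally show ?thesis by simp
qed

end

context sampling
begin

text \<open>\<open>M1\<close> is a multiple of the identity, so a1 occurs in both formulas. The term
  \<psi>^2 is the squared component of \<open>v0\<close> along \<open>e k1\<close>; it vanishes in
  the other directions, which \<open>kernel_diag\<close> makes equivalent to k2.\<close>

lemma
  assumes e: "\<And>i. e i = column i U" and U: "orthogonal_matrix U"
  shows score_var_e1: "score_var k1 / (hess_eig k1)\<^sup>2 = q1 P \<psi> (e k1)"
    and score_var_other: "i \<noteq> k1 \<Longrightarrow> score_var i / (hess_eig i)\<^sup>2 = q2 P \<psi> (e k1) (e k2)"
proof -
  have cov: "phi1 (cov P) = mom k1" "phi_rest (cov P) = mom k2"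
    using phi1_eqI[OF U ks mom_le, of "cov P"] phi_rest_eqI[OF U ks mom_le, of "cov P"] cov_eigen by (simp_all add: e)
  have sv: "score_var i = 2 * (grad_moment P v0 (e i) - mom i + (v0 \<bullet> e i)\<^sup>2)" for i
    unfolding score_var_def score_second_moment mom_def by simp
  have M1: "qform (M1 P v0) (e i) = qform (M1 P v0) (e k1)" for i
    by (simp add: M1_def qform_scaleR) (simp add: qform_def ortho)
  show "score_var k1 / (hess_eig k1)\<^sup>2 = q1 P \<psi> (e k1)"
    unfolding sv q1_def Let_def cov hess_eig_def curv1_def hess_moment[OF v0_neq_0]
    by (simp add: ortho power_int_minus divide_inverse)
  have "score_var k2 / (hess_eig k2)\<^sup>2 = q2 P \<psi> (e k1) (e k2)"
    using ks unfolding sv q2_def Let_def cov hess_eig_def curv2_def hess_moment[OF v0_neq_0] M1[of k2]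
    by (simp add: ortho power_int_minus divide_inverse)
  moreover have "score_var i = score_var k2" if "i \<noteq> k1"
    unfolding score_var_def power2_eq_square
    using that ks kernel_diag[where K="\<lambda>x u w. (score v0 x \<bullet> u) * (score v0 x \<bullet> w)" and i=i and j=k2]
    by (simp add: score_invariant)
  ultimately show "i \<noteq> k1 \<Longrightarrow> score_var i / (hess_eig i)\<^sup>2 = q2 P \<psi> (e k1) (e k2)"
    using ks by (simp add: hess_eig_def)
qed

lemma sgn_v_sample_algebra: "sgn_v n \<in> borel_measurable (sample_algebra M X n (v n))"
proof -
  let ?N = "(\<Pi>\<^sub>M i\<in>{..<n}. borel) \<Otimes>\<^sub>M (borel :: (real^'p) measure)"
  let ?f = "\<lambda>\<omega>. (\<lambda>i\<in>{..<n}. X i \<omega>, v n \<omega>)"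
  have "?f \<in> measurable (sample_algebra M X n (v n)) ?N"
    unfolding sample_algebra_def
    by (rule measurable_vimage_algebra1) (auto simp: space_pair_measure space_PiM)
  from measurable_compose[OF this measurable_snd]
  have [measurable]: "v n \<in> borel_measurable (sample_algebra M X n (v n))" by simp
  show ?thesis unfolding sgn_v_def by measurable
qed

end

theorem theorem8:
  fixes U \<Lambda> :: "real^'p^'p" and k1 k2 :: 'p and P :: "(real^'p) measure"
    and M0 :: "'a measure" and Z :: "'a \<Rightarrow> real^'p" and fR :: "real \<Rightarrow> real"
    and M :: "'b measure" and X :: "nat \<Rightarrow> 'b \<Rightarrow> real^'p" and v :: "nat \<Rightarrow> 'b \<Rightarrow> real^'p"
    and \<psi> :: real
  assumes "k1 \<noteq> k2"
    and "elliptical_rep k1 U \<Lambda> P M0 Z fR"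
    and "bounded (fR ` {0<..})"
    and "phi1 (sign_cov P) > 1/2"
    and "integrable M0 (\<lambda>\<omega>. (Z \<omega> $ k1)\<^sup>2)"
    and "\<psi> > 0"
    and "{w. is_arg_min (obj P) (\<lambda>_. True) w} = {\<psi> *\<^sub>R column k1 U, - (\<psi> *\<^sub>R column k1 U)}"
    and "prob_space M"
    and "prob_space.indep_vars M (\<lambda>_. borel) X UNIV"
    and "\<And>i. distr M borel (X i) = P"
    and "\<And>n. v n \<in> borel_measurable M"
    and "\<And>n \<omega>. n \<ge> 1 \<Longrightarrow> \<omega> \<in> space M \<Longrightarrow>
           is_arg_min (emp_obj n (\<lambda>i. X i \<omega>))
             (\<lambda>w. w \<in> cball 0 (H n (\<lambda>i. X i \<omega>) + 1/2)) (v n \<omega>)"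
  shows "\<exists>s :: nat \<Rightarrow> 'b \<Rightarrow> real.
    (\<forall>n. s n \<in> borel_measurable (sample_algebra M X n (v n)) \<and>
         (\<forall>\<omega>\<in>space M. s n \<omega> \<in> {-1, 1})) \<and>
    conv_in_distr M
      (\<lambda>n \<omega>. sqrt (real n) *\<^sub>R (s n \<omega> *\<^sub>R v n \<omega> - \<psi> *\<^sub>R column k1 U))
      (mvnormal 0
        (let e1 = axis k1 1 :: real^'p; E = outer e1 e1
         in U ** (q1 P \<psi> (column k1 U) *\<^sub>R E
                  + q2 P \<psi> (column k1 U) (column k2 U) *\<^sub>R (mat 1 - E)) ** transpose U))"
proof -
  define e where "e i = column i U" for i
  have U: "orthogonal_matrix U" and P: "P = distr M0 borel (\<lambda>\<omega>. (U ** \<Lambda>) *v Z \<omega>)"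
    and M0: "prob_space M0" and Z: "Z \<in> borel_measurable M0"
    using assms(2) by (auto simp: elliptical_rep_def spherical_def)
  obtain a \<kappa> where law: "0 < a" "a < 1" "\<kappa> \<in> borel_measurable borel" "\<And>r. r > 0 \<Longrightarrow> \<kappa> r > 0"
    "strict_antimono_on {0<..} \<kappa>"
    "P = density lborel (\<lambda>x. ennreal (\<kappa> (sqrt ((norm x)\<^sup>2 - a * (x \<bullet> column k1 U)\<^sup>2))))"
    using elliptical_rep_density[OF assms(2)] by blast
  \<comment> \<open>The set equation yields both facts used later: the two points are minimizers,
    and there are no others.\<close>
  have argmin: "(\<forall>u. obj P w \<le> obj P u) \<longleftrightarrow> w = \<psi> *\<^sub>R e k1 \<or> w = - (\<psi> *\<^sub>R e k1)" for w
    using assms(7) unfolding e_def is_arg_min_linorder by (auto simp: set_eq_iff)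
  interpret M: prob_space M by fact
  have [measurable]: "X i \<in> borel_measurable M" for i using assms(9) by (auto simp: M.indep_vars_def)
  interpret sampling P e k1 k2 a \<kappa> \<psi> M X v
  proof (intro sampling.intro elliptical_min.intro elliptical.intro iid_sample.intro
      sampling_axioms.intro elliptical_min_axioms.intro iid_sample_axioms.intro)
    show "prob_space P" unfolding assms(10)[of 0, symmetric] by (rule M.prob_space_distr) measurable
    show "P = density lborel (\<lambda>x. ennreal (\<kappa> (sqrt ((norm x)\<^sup>2 - a * (x \<bullet> e k1)\<^sup>2))))"
      unfolding e_def by (rule law(6))
    show "e i \<bullet> e j = (if i = j then 1 else 0)" for i j
      using U by (auto simp: e_def orthogonal_matrix_orthonormal_columns orthogonal_def norm_eq_1)
    show "x = (\<Sum>i\<in>UNIV. (x \<bullet> e i) *\<^sub>R e i)" for x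
    proof -
      have "x = U *v (transpose U *v x)"
        using U unfolding orthogonal_matrix_def matrix_vector_mul_assoc by simp
      also have "\<dots> = (\<Sum>i\<in>UNIV. (transpose U *v x) $ i *s column i U)" by (rule matrix_mult_sum)
      finally show ?thesis unfolding transpose_mult_nth e_def scalar_mult_eq_scaleR .
    qed
    show "integrable P (\<lambda>x. (norm x)\<^sup>2)" by (rule elliptical_rep_second_moment[OF assms(2,5)])
    show "obj P (\<psi> *\<^sub>R e k1) \<le> obj P w" for w using argmin by blast
    show "w = \<psi> *\<^sub>R e k1 \<or> w = - (\<psi> *\<^sub>R e k1)" if "\<And>u. obj P w \<le> obj P u" for w using argmin that by blast
    show "emp_obj n (\<lambda>i. X i \<omega>) (v n \<omega>) \<le> emp_obj n (\<lambda>i. X i \<omega>) u" if "1 \<le> n" "\<omega> \<in> space M" for n \<omega> u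
      using assms(12)[OF that] by (rule ball_minimizer_is_global[OF that(1)])
  qed (use assms law in auto)
  define qq where "qq i = (if i = k1 then q1 P \<psi> (e k1) else q2 P \<psi> (e k1) (e k2))" for i
  have qq: "qq i = score_var i / (hess_eig i)\<^sup>2" for i
    using score_var_e1[OF e_def U] score_var_other[OF e_def U, of i] by (simp add: qq_def)
  \<comment> \<open>Not visible from the formulas for \<open>q1\<close> and \<open>q2\<close>; it
    follows from reading them as a variance over a square.\<close>
  have qq0: "qq i \<ge> 0" for i unfolding qq by (simp add: score_var_def)
  let ?E = "outer (axis k1 1) (axis k1 1) :: real^'p^'p"
  let ?S = "U ** (q1 P \<psi> (column k1 U) *\<^sub>R ?E + q2 P \<psi> (column k1 U) (column k2 U) *\<^sub>R (mat 1 - ?E)) ** transpose U"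
  have "q1 P \<psi> (e k1) *\<^sub>R ?E + q2 P \<psi> (e k1) (e k2) *\<^sub>R (mat 1 - ?E) = diag qq"
    by (simp add: vec_eq_iff outer_nth diag_def qq_def mat_def axis_def)
  then have S: "?S = U ** diag qq ** transpose U" by (simp add: e_def)
  \<comment> \<open>The witness that a square root exists, as the choice in \<open>mvnormal\<close>
    presupposes.\<close>
  let ?A = "U ** diag (\<lambda>i. sqrt (qq i))"
  have "?A ** transpose ?A = U ** (diag (\<lambda>i. sqrt (qq i)) ** diag (\<lambda>i. sqrt (qq i))) ** transpose U"
    by (simp add: matrix_transpose_mul transpose_diag matrix_mul_assoc)
  also have "\<dots> = ?S" unfolding S diag_mult using qq0 by simp
  finally have A: "?A ** transpose ?A = ?S" .
  have "conv_in_distr M est_error (mvnormal 0 ?S)"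
  proof (rule conv_in_distr_charI[OF assms(8) est_error_meas prob_space_mvnormal[OF A] sets_mvnormal[OF A]])
    fix t
    have "t \<bullet> (?S *v t) = (\<Sum>i\<in>UNIV. score_var i / (hess_eig i)\<^sup>2 * (t \<bullet> e i)\<^sup>2)"
      unfolding S quadratic_form_diag by (simp add: qq e_def)
    then show "(\<lambda>n. \<integral>\<omega>. iexp (t \<bullet> est_error n \<omega>) \<partial>M) \<longlonglongrightarrow> (\<integral>x. iexp (t \<bullet> x) \<partial>mvnormal 0 ?S)"
      unfolding char_mvnormal[OF A] using est_error_char_conv[of t] by simp
  qed
  then have "conv_in_distr M (\<lambda>n \<omega>. sqrt (real n) *\<^sub>R (sgn_v n \<omega> *\<^sub>R v n \<omega> - \<psi> *\<^sub>R column k1 U)) (mvnormal 0 ?S)"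
    unfolding est_error_def[abs_def] e_def .
  moreover have "\<forall>n. sgn_v n \<in> borel_measurable (sample_algebra M X n (v n)) \<and> (\<forall>\<omega>\<in>space M. sgn_v n \<omega> \<in> {- 1, 1})"
    using sgn_v_sample_algebra by (auto simp: sgn_v_def)
  ultimately show ?thesis unfolding Let_def by (intro exI[of _ sgn_v]) blast
qed

end
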